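(* The affine distance tariff design problem can be solved in linear time $\mathcal{O}(\vert D\vert)$.
   Context: The affine distance tariff design problem: given a finite set $D$ of OD (origin-destination) pairs, reference prices $r_d\in\mathbb{R}_{\ge 0}$, passenger numbers $t_d\in\mathbb{N}_{\ge 1}$ and distances $l_d\in\mathbb{R}_{\ge 0}$ for all $d\in D$, determine a price per kilometer $p\in\mathbb{R}_{\ge 0}$ and a base amount $f\in\mathbb{R}_{\ge 0}$ such that $\sum_{d\in D} t_d\,\vert r_d-(p\cdot l_d+f)\vert$ is minimized. *)

theory Defs
  imports Complex_Main "HOL-Library.Landau_Symbols"
begin

section \<open>The affine distance tariff design problem\<close>

definition tariff_instance ::
    "'d set \<Rightarrow> ('d \<Rightarrow> real) \<Rightarrow> ('d \<Rightarrow> nat) \<Rightarrow> ('d \<Rightarrow> real) \<Rightarrow> bool" where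
  "tariff_instance D r t l \<longleftrightarrow>
     finite D \<and> (\<forall>d\<in>D. r d \<ge> 0 \<and> t d \<ge> 1 \<and> l d \<ge> 0)"

definition tariff_deviation ::
    "'d set \<Rightarrow> ('d \<Rightarrow> real) \<Rightarrow> ('d \<Rightarrow> nat) \<Rightarrow> ('d \<Rightarrow> real) \<Rightarrow> real \<times> real \<Rightarrow> real" where
  "tariff_deviation D r t l = (\<lambda>(p, f). \<Sum>d\<in>D. real (t d) * \<bar>r d - (p * l d + f)\<bar>)"

definition optimal_affine_tariff ::
    "'d set \<Rightarrow> ('d \<Rightarrow> real) \<Rightarrow> ('d \<Rightarrow> nat) \<Rightarrow> ('d \<Rightarrow> real) \<Rightarrow> real \<times> real \<Rightarrow> bool" where
  "optimal_affine_tariff D r t l =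
     is_arg_min (tariff_deviation D r t l) (\<lambda>(p, f). p \<ge> 0 \<and> f \<ge> 0)"


section \<open>Real RAM\<close>

text \<open>
  The inputs are real numbers, so running time is measured on a real RAM with unit costs: real
  arithmetic and real comparison are exact and cost one step each, and memory is accessed through
  integer indices. Programs are structured and may call parameterless, possibly recursive
  subroutines; these act on the global state, so there are no local variables to be saved.

  The instruction set is deliberately restricted to rule out the known abuses of unit costs.
  There is no rounding or any other conversion between reals and integers. Indices can only be
  incremented and decremented, hence never exceed (up to an additive constant that depends on
  the program) the input size plus the number of executed steps. Real constants in programs are
  integers, so a program cannot hide information in a real number.

  Memory consists of index registers, real registers, index arrays and real arrays. The first
  argument of \<open>iarr\<close> and \<open>rarr\<close> names an array. Array names occur in programs
  only as constants, so a program uses finitely many arrays, which could be interleaved in a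
  single one.
\<close>

record state =
  ireg :: "nat \<Rightarrow> nat"
  rreg :: "nat \<Rightarrow> real"
  iarr :: "nat \<Rightarrow> nat \<Rightarrow> nat"
  rarr :: "nat \<Rightarrow> nat \<Rightarrow> real"

datatype instr =
    ISet nat nat
  | IMove nat nat
  | IInc nat
  | IDec nat
  | ILoad nat nat nat
  | IStore nat nat nat
  | RSet nat int
  | RMove nat nat
  | RAdd nat nat nat
  | RSub nat nat nat
  | RMul nat nat nat
  | RDiv nat nat nat
  | RLoad nat nat nat
  | RStore nat nat nat

text \<open>
  The destination comes first. In loads, \<open>ILoad x a i\<close> stands for \<open>x := a[i]\<close>;
  in stores, \<open>IStore a i x\<close> stands for \<open>a[i] := x\<close>, where \<open>i\<close> is the
  index register that holds the index. Decrementing 0 yields 0, division by 0 yields 0.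
\<close>

fun step :: "instr \<Rightarrow> state \<Rightarrow> state" where
  "step (ISet x c) s = s\<lparr>ireg := (ireg s)(x := c)\<rparr>"
| "step (IMove x y) s = s\<lparr>ireg := (ireg s)(x := ireg s y)\<rparr>"
| "step (IInc x) s = s\<lparr>ireg := (ireg s)(x := ireg s x + 1)\<rparr>"
| "step (IDec x) s = s\<lparr>ireg := (ireg s)(x := ireg s x - 1)\<rparr>"
| "step (ILoad x a i) s = s\<lparr>ireg := (ireg s)(x := iarr s a (ireg s i))\<rparr>"
| "step (IStore a i x) s = s\<lparr>iarr := (iarr s)(a := (iarr s a)(ireg s i := ireg s x))\<rparr>"
| "step (RSet x c) s = s\<lparr>rreg := (rreg s)(x := of_int c)\<rparr>"
| "step (RMove x y) s = s\<lparr>rreg := (rreg s)(x := rreg s y)\<rparr>"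
| "step (RAdd x y z) s = s\<lparr>rreg := (rreg s)(x := rreg s y + rreg s z)\<rparr>"
| "step (RSub x y z) s = s\<lparr>rreg := (rreg s)(x := rreg s y - rreg s z)\<rparr>"
| "step (RMul x y z) s = s\<lparr>rreg := (rreg s)(x := rreg s y * rreg s z)\<rparr>"
| "step (RDiv x y z) s = s\<lparr>rreg := (rreg s)(x := rreg s y / rreg s z)\<rparr>"
| "step (RLoad x a i) s = s\<lparr>rreg := (rreg s)(x := rarr s a (ireg s i))\<rparr>"
| "step (RStore a i x) s = s\<lparr>rarr := (rarr s)(a := (rarr s a)(ireg s i := rreg s x))\<rparr>"

datatype test = ILess nat nat | RLess nat nat

fun holds :: "test \<Rightarrow> state \<Rightarrow> bool" where
  "holds (ILess x y) s \<longleftrightarrow> ireg s x < ireg s y"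
| "holds (RLess x y) s \<longleftrightarrow> rreg s x < rreg s y"

datatype com =
    Skip
  | Do instr
  | Seq com com
  | Cond test com com
  | While test com
  | Call nat

text \<open>The list contains the bodies of the subroutines; execution starts with \<open>Call 0\<close>.\<close>

type_synonym program = "com list"

text \<open>
  \<open>exec P c s k s'\<close>: started in \<open>s\<close>, the command \<open>c\<close> terminates in
  \<open>s'\<close> after exactly \<open>k\<close> steps. Every instruction, evaluation of a test and
  subroutine call is one step.
\<close>

inductive exec :: "program \<Rightarrow> com \<Rightarrow> state \<Rightarrow> nat \<Rightarrow> state \<Rightarrow> bool" for P where
  Skip: "exec P Skip s 1 s"
| Do: "exec P (Do i) s 1 (step i s)"
| Seq: "exec P c1 s k1 s1 \<Longrightarrow> exec P c2 s1 k2 s2 \<Longrightarrow> exec P (Seq c1 c2) s (k1 + k2) s2"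
| CondTrue: "holds b s \<Longrightarrow> exec P c1 s k s1 \<Longrightarrow> exec P (Cond b c1 c2) s (k + 1) s1"
| CondFalse: "\<not> holds b s \<Longrightarrow> exec P c2 s k s1 \<Longrightarrow> exec P (Cond b c1 c2) s (k + 1) s1"
| WhileTrue: "holds b s \<Longrightarrow> exec P c s k1 s1 \<Longrightarrow> exec P (While b c) s1 k2 s2 \<Longrightarrow>
    exec P (While b c) s (k1 + k2 + 1) s2"
| WhileFalse: "\<not> holds b s \<Longrightarrow> exec P (While b c) s 1 s"
| Call: "i < length P \<Longrightarrow> exec P (P ! i) s k s1 \<Longrightarrow> exec P (Call i) s (k + 1) s1"

text \<open>
  By determinism, the existence of a terminating execution with \<open>k\<close> steps means that
  the one and only run terminates after \<open>k\<close> steps.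
\<close>

lemma exec_deterministic:
  assumes "exec P c s k s1" and "exec P c s k' s2"
  shows "k = k' \<and> s1 = s2"
  using assms
proof (induction arbitrary: k' s2 rule: exec.induct)
  case Skip
  from Skip.prems show ?case by (auto elim: exec.cases)
next
  case Do
  from Do.prems show ?case by (auto elim: exec.cases)
next
  case (Seq c1 s k1 s1 c2 k2 s2)
  from Seq.prems show ?case by (cases rule: exec.cases) (use Seq.IH in blast)
next
  case (CondTrue b s c1 k s1 c2)
  from CondTrue.prems show ?case
    by (cases rule: exec.cases) (use CondTrue.IH CondTrue.hyps in blast)+
next
  case (CondFalse b s c2 k s1 c1)
  from CondFalse.prems show ?case
    by (cases rule: exec.cases) (use CondFalse.IH CondFalse.hyps in blast)+
next
  case (WhileTrue b s c k1 s1 k2 s2)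
  from WhileTrue.prems show ?case
    by (cases rule: exec.cases) (use WhileTrue.IH WhileTrue.hyps in blast)+
next
  case (WhileFalse b s c)
  from WhileFalse.prems show ?case
    by (cases rule: exec.cases) (use WhileFalse.hyps in blast)+
next
  case (Call i s k s1)
  from Call.prems show ?case by (cases rule: exec.cases) (use Call.IH in blast)
qed


section \<open>Input and output\<close>

text \<open>
  The OD pairs are presented in an arbitrary order: index register 0 holds their number, and the
  real arrays 0, 1, 2 hold the reference prices, passenger numbers and distances. All other
  memory cells are 0. The result is read off from real registers 0 and 1.
\<close>

definition input_state ::
    "('d \<Rightarrow> real) \<Rightarrow> ('d \<Rightarrow> nat) \<Rightarrow> ('d \<Rightarrow> real) \<Rightarrow> 'd list \<Rightarrow> state" where
  "input_state r t l ds =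
     \<lparr>ireg = (\<lambda>_. 0)(0 := length ds),
      rreg = (\<lambda>_. 0),
      iarr = (\<lambda>_ _. 0),
      rarr = (\<lambda>a i. if i < length ds
                     then (if a = 0 then r (ds ! i)
                           else if a = 1 then real (t (ds ! i))
                           else if a = 2 then l (ds ! i)
                           else 0)
                     else 0)\<rparr>"

definition output_tariff :: "state \<Rightarrow> real \<times> real" where
  "output_tariff s = (rreg s 0, rreg s 1)"

end

theory Submission
  imports Defs
begin

text \<open>
  In the coordinates \<open>x = p - f\<close>, \<open>y = p + f\<close>, and with exact penalties for the sign constraints, one
  has to minimise \<open>\<Phi>(x, y) = (\<Sum>i. w i * \<bar>y - m i * x - c i\<bar>) + \<alpha> * x + \<beta> * y\<close> without constraints.
  This is done by Megiddo's prune and search. Minimising \<open>\<Phi>\<close> along a line is a weighted median problem,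
  and a subgradient at the minimiser that is orthogonal to the line tells on which side of it \<open>\<Phi>\<close> can
  be smaller. Pair the lines of slope at most the median slope \<open>s\<close> with those of slope at least \<open>s\<close>.
  Query the vertical line at the median abscissa of the intersection points of the pairs, then the
  line of slope \<open>s\<close> at a suitable quartile height over this abscissa. At least an eighth of the lines
  miss the interior of the resulting quadrant; their absolute values become linear and are moved to \<open>\<alpha>\<close> and \<open>\<beta>\<close>.

  Only closed sides are known, so the recursive call may return a point outside the quadrant, but
  then one of the two query points is already optimal. Hence the best of the three points is
  returned, and boundedness from below is the only hypothesis the recursion has to carry.

  Selection takes as pivot the recursively computed median of the medians of three medians of three:
  this leaves about \<open>n / 9\<close> and \<open>7 * n / 9\<close> elements for the two recursive calls.
\<close>

text \<open>Two obstacles shape the proof. First, nobody tells the recursion whether the best query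
  point is already optimal. If it is, pruning can destroy boundedness, and deeper calls then use
  thresholds outside the range in which selection means anything. Hence running time, shrinking and
  preserved memory are proved for arbitrary states, and only optimality is conditional on
  boundedness. Second, subroutines share one global state. Sublists are therefore copied behind the
  segment of the caller, never partitioned in place, and the few values needed after a call go on
  explicit stacks; a caller relies only on the cells below the end of its segment and below its
  stack depth.

  Plain groups of three would leave \<open>n / 3\<close> and \<open>2 * n / 3\<close> elements,
  whose sum is not smaller than \<open>n\<close>. The ninther has \<open>1 / 9 + 7 / 9 < 1\<close>
  and still needs no code beyond a median of three. The pruned eighth is half of a quarter: there
  are at least \<open>n / 2\<close> pairs, and at least a quarter of them lose a line.\<close>

subsection \<open>Executions\<close>

fun seq :: "com list \<Rightarrow> com" where
  "seq [] = Skip"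
| "seq [c] = c"
| "seq (c # c' # cs) = Seq c (seq (c' # cs))"

abbreviation block :: "instr list \<Rightarrow> com" where
  "block is \<equiv> seq (map Do is)"

definition for_range :: "nat \<Rightarrow> nat \<Rightarrow> nat \<Rightarrow> com \<Rightarrow> com" where
  "for_range i l h c = Seq (Do (IMove i l)) (While (ILess i h) (Seq c (Do (IInc i))))"

abbreviation (input) with_index :: "nat \<Rightarrow> nat \<Rightarrow> state \<Rightarrow> state" where
  "with_index i j s \<equiv> s\<lparr>ireg := (ireg s)(i := j)\<rparr>"

text \<open>An array counts as one location, so a frame only says which arrays are untouched. Which
  cells of a written array survive is stated separately, by predicates such as
  \<open>same_below\<close> and \<open>same_lines\<close>.\<close>

datatype loc = IReg nat | RReg nat | IArr nat | RArr nat

lemma loc_in_image [simp]: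
  "IReg x \<in> IReg ` A \<longleftrightarrow> x \<in> A" "IReg x \<notin> RReg ` A" "IReg x \<notin> IArr ` A" "IReg x \<notin> RArr ` A"
  "RReg x \<notin> IReg ` A" "RReg x \<in> RReg ` A \<longleftrightarrow> x \<in> A" "RReg x \<notin> IArr ` A" "RReg x \<notin> RArr ` A"
  "IArr x \<notin> IReg ` A" "IArr x \<notin> RReg ` A" "IArr x \<in> IArr ` A \<longleftrightarrow> x \<in> A" "IArr x \<notin> RArr ` A"
  "RArr x \<notin> IReg ` A" "RArr x \<notin> RReg ` A" "RArr x \<notin> IArr ` A" "RArr x \<in> RArr ` A \<longleftrightarrow> x \<in> A"
  by auto

fun written :: "instr \<Rightarrow> loc" where
  "written (ISet x c) = IReg x"
| "written (IMove x y) = IReg x"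
| "written (IInc x) = IReg x"
| "written (IDec x) = IReg x"
| "written (ILoad x a i) = IReg x"
| "written (IStore a i x) = IArr a"
| "written (RSet x q) = RReg x"
| "written (RMove x y) = RReg x"
| "written (RAdd x y z) = RReg x"
| "written (RSub x y z) = RReg x"
| "written (RMul x y z) = RReg x"
| "written (RDiv x y z) = RReg x"
| "written (RLoad x a i) = RReg x"
| "written (RStore a i x) = RArr a"

text \<open>The footprints of subroutines are a parameter \<open>T\<close>, so recursion needs no
  fixed point: it suffices to guess \<open>T\<close> and to check that it is closed under the
  bodies, which is the premise of \<open>exec_frame\<close>.\<close>

fun writes :: "(nat \<Rightarrow> loc set) \<Rightarrow> com \<Rightarrow> loc set" where
  "writes T Skip = {}"
| "writes T (Do i) = {written i}"
| "writes T (Seq c1 c2) = writes T c1 \<union> writes T c2"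
| "writes T (Cond b c1 c2) = writes T c1 \<union> writes T c2"
| "writes T (While b c) = writes T c"
| "writes T (Call i) = T i"

definition frame :: "loc set \<Rightarrow> state \<Rightarrow> state \<Rightarrow> bool" where
  "frame W s s' \<longleftrightarrow>
     (\<forall>x. IReg x \<notin> W \<longrightarrow> ireg s' x = ireg s x) \<and>
     (\<forall>x. RReg x \<notin> W \<longrightarrow> rreg s' x = rreg s x) \<and>
     (\<forall>a. IArr a \<notin> W \<longrightarrow> iarr s' a = iarr s a) \<and>
     (\<forall>a. RArr a \<notin> W \<longrightarrow> rarr s' a = rarr s a)"

lemma frame_refl [simp]: "frame W s s"
  by (simp add: frame_def)

lemma frame_trans: "frame W s s' \<Longrightarrow> frame W s' s'' \<Longrightarrow> frame W s s''"
  by (simp add: frame_def)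

lemma frame_mono: "frame W s s' \<Longrightarrow> W \<subseteq> W' \<Longrightarrow> frame W' s s'"
  by (auto simp: frame_def)

lemma frame_Un:
  "frame W s s' \<Longrightarrow> frame W' s' s'' \<Longrightarrow> frame (W \<union> W') s s''"
  by (simp add: frame_def)

lemma frame_step: "frame {written i} s (step i s)"
  by (cases i) (auto simp: frame_def)

lemma exec_frame:
  assumes "\<And>i. i < length P \<Longrightarrow> writes T (P ! i) \<subseteq> T i"
  shows "exec P c s k s' \<Longrightarrow> frame (writes T c) s s'"
proof (induction rule: exec.induct)
  case (Do i s)
  then show ?case by (simp add: frame_step)
next
  case (Call i s k s1)
  then show ?case using assms frame_mono by (metis writes.simps(6))
next
  case (CondTrue b s c1 k s1 c2)
  then show ?case by (auto elim: frame_mono)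
next
  case (CondFalse b s c2 k s1 c1)
  then show ?case by (auto elim: frame_mono)
next
  case (WhileTrue b s c k1 s1 k2 s2)
  then show ?case by (auto elim: frame_trans)
qed (simp_all add: frame_Un)

text \<open>Without loops and calls the effect of a command is a total function \<open>run\<close>,
  which the simplifier can compute. \<open>cost\<close> is only an upper bound because of the
  maximum over the branches.\<close>

fun simple :: "com \<Rightarrow> bool" where
  "simple Skip \<longleftrightarrow> True"
| "simple (Do i) \<longleftrightarrow> True"
| "simple (Seq c1 c2) \<longleftrightarrow> simple c1 \<and> simple c2"
| "simple (Cond b c1 c2) \<longleftrightarrow> simple c1 \<and> simple c2"
| "simple (While b c) \<longleftrightarrow> False"
| "simple (Call i) \<longleftrightarrow> False"

fun run :: "com \<Rightarrow> state \<Rightarrow> state" where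
  "run Skip s = s"
| "run (Do i) s = step i s"
| "run (Seq c1 c2) s = run c2 (run c1 s)"
| "run (Cond b c1 c2) s = (if holds b s then run c1 s else run c2 s)"
| "run (While b c) s = s"
| "run (Call i) s = s"

fun cost :: "com \<Rightarrow> nat" where
  "cost Skip = 1"
| "cost (Do i) = 1"
| "cost (Seq c1 c2) = cost c1 + cost c2"
| "cost (Cond b c1 c2) = max (cost c1) (cost c2) + 1"
| "cost (While b c) = 0"
| "cost (Call i) = 0"

lemma exec_simple:
  assumes "simple c"
  obtains k where "exec P c s k (run c s)" "k \<le> cost c"
proof -
  have "\<exists>k \<le> cost c. exec P c s k (run c s)"
    using assms
  proof (induction c arbitrary: s)
    case Skip
    show ?case by (rule exI[of _ 1]) (simp add: exec.Skip[unfolded One_nat_def])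
  next
    case (Do i)
    show ?case by (rule exI[of _ 1]) (simp add: exec.Do[unfolded One_nat_def])
  next
    case (Seq c1 c2)
    obtain k1 where 1: "exec P c1 s k1 (run c1 s)" "k1 \<le> cost c1" using Seq by auto
    obtain k2 where 2: "exec P c2 (run c1 s) k2 (run c2 (run c1 s))" "k2 \<le> cost c2"
      using Seq by auto
    show ?case using exec.Seq[OF 1(1) 2(1)] 1(2) 2(2) by (intro exI[of _ "k1 + k2"]) auto
  next
    case (Cond b c1 c2)
    obtain k1 where "exec P c1 s k1 (run c1 s)" "k1 \<le> cost c1" using Cond by auto
    moreover obtain k2 where "exec P c2 s k2 (run c2 s)" "k2 \<le> cost c2" using Cond by auto
    ultimately show ?case
      using exec.CondTrue[of b s P c1 k1 "run c1 s" c2] exec.CondFalse[of b s P c2 k2 "run c2 s" c1]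
      by (cases "holds b s"; intro exI[of _ "(if holds b s then k1 else k2) + 1"])
        (simp_all add: max_def)
  qed auto
  then show ?thesis using that by blast
qed

lemma exec_simple_le:
  assumes "simple c" "cost c \<le> K"
  obtains k where "exec P c s k (run c s)" "k \<le> K"
proof -
  obtain k where "exec P c s k (run c s)" "k \<le> cost c" using exec_simple[OF assms(1)] .
  then show ?thesis using that assms(2) by auto
qed

lemma frame_run:
  assumes "simple c"
  shows "frame (writes T c) s (run c s)"
  using assms
proof (induction c arbitrary: s)
  case (Do i)
  then show ?case by (simp add: frame_step)
next
  case (Seq c1 c2)
  then show ?case by (auto intro: frame_Un)
next
  case (Cond b c1 c2)
  then show ?case
    by (auto intro: frame_mono[of "writes T c1"] frame_mono[of "writes T c2"])
qed auto

text \<open>The number \<open>n\<close> of rounds is fixed in advance and the invariant carries the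
  current round. A round costs at most \<open>K\<close> and one test; the final 1 is the failing
  test.\<close>

lemma exec_while:
  assumes "I (0::nat) s"
    and "\<And>j s. I j s \<Longrightarrow> j \<le> n \<Longrightarrow> holds b s \<longleftrightarrow> j < n"
    and "\<And>j s. I j s \<Longrightarrow> j < n \<Longrightarrow> \<exists>k s'. exec P c s k s' \<and> k \<le> K \<and> I (Suc j) s'"
  obtains k s' where "exec P (While b c) s k s'" "k \<le> n * (K + 1) + 1" "I n s'"
proof -
  have "\<exists>k s'. exec P (While b c) s k s' \<and> k \<le> m * (K + 1) + 1 \<and> I n s'"
    if "I (n - m) s" "m \<le> n" for m s
    using that
  proof (induction m arbitrary: s)
    case 0
    then show ?case
      using exec.WhileFalse[of b s P c] assms(2)[of n s] by auto
  next
    case (Suc m)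
    have b: "holds b s" using assms(2) Suc.prems by auto
    obtain k1 s1 where 1: "exec P c s k1 s1" "k1 \<le> K" "I (Suc (n - Suc m)) s1"
      using assms(3) Suc.prems by fastforce
    have "Suc (n - Suc m) = n - m" using Suc.prems by simp
    then obtain k2 s2 where 2: "exec P (While b c) s1 k2 s2" "k2 \<le> m * (K + 1) + 1" "I n s2"
      using Suc.IH[of s1] 1 Suc.prems by auto
    show ?case
      using exec.WhileTrue[OF b 1(1) 2(1)] 1 2 by (intro exI conjI) auto
  qed
  from this[of n s] show ?thesis using assms(1) that by auto
qed

text \<open>The premise \<open>inv\<close> receives the frame relative to the initial state, so
  \<open>I\<close> has to mention only what the body changes. Per round, \<open>K + 2\<close> pays
  for body, increment and test; the final 2 pays for the initial move and the failing test.\<close>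

lemma exec_for_range:
  assumes body: "simple c" "IReg i \<notin> writes T c" "IReg h \<notin> writes T c" "i \<noteq> h"
    and le: "ireg s0 l \<le> ireg s0 h" and cost: "cost c \<le> K"
    and init: "I (ireg s0 l) (with_index i (ireg s0 l) s0)"
    and inv: "\<And>j s. I j s \<Longrightarrow> frame (insert (IReg i) (writes T c)) s0 s \<Longrightarrow> ireg s i = j \<Longrightarrow>
      ireg s0 l \<le> j \<Longrightarrow> j < ireg s0 h \<Longrightarrow>
      I (Suc j) (with_index i (Suc j) (run c s))"
  obtains k s' where "exec P (for_range i l h c) s0 k s'"
    "k \<le> (ireg s0 h - ireg s0 l) * (K + 2) + 2" "I (ireg s0 h) s'"
    "frame (insert (IReg i) (writes T c)) s0 s'"
proof -
  define s1 where "s1 = with_index i (ireg s0 l) s0"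
  define W where "W = insert (IReg i) (writes T c)"
  define J where "J = (\<lambda>j s. I (ireg s0 l + j) s \<and> frame W s0 s \<and> ireg s i = ireg s0 l + j)"
  have h: "ireg s h = ireg s0 h" if "frame W s0 s" for s
    using that body by (simp add: frame_def W_def)
  obtain k s' where w: "exec P (While (ILess i h) (Seq c (Do (IInc i)))) s1 k s'"
      "k \<le> (ireg s0 h - ireg s0 l) * (K + 1 + 1) + 1" "J (ireg s0 h - ireg s0 l) s'"
  proof (rule exec_while[of J s1 "ireg s0 h - ireg s0 l" "ILess i h" P _ "K + 1"])
    show "J 0 s1"
      using init by (simp add: J_def s1_def frame_def W_def)
  next
    fix j s assume "J j s" "j \<le> ireg s0 h - ireg s0 l"
    then show "holds (ILess i h) s \<longleftrightarrow> j < ireg s0 h - ireg s0 l"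
      using h[of s] le by (auto simp: J_def)
  next
    fix j s assume J: "J j s" and j: "j < ireg s0 h - ireg s0 l"
    obtain k where k: "exec P c s k (run c s)" "k \<le> cost c"
      using exec_simple body(1) by blast
    have fr: "frame W s (run c s)"
      using frame_run[OF body(1), of T s] by (auto simp: W_def intro: frame_mono)
    have i: "ireg (run c s) i = ireg s i"
      using frame_run[OF body(1), of T s] body by (simp add: frame_def)
    have e: "exec P (Seq c (Do (IInc i))) s (k + 1) (step (IInc i) (run c s))"
      by (rule exec.Seq[OF k(1) exec.Do])
    have st: "step (IInc i) (run c s) =
        with_index i (Suc (ireg s0 l + j)) (run c s)"
      using J i by (simp add: J_def)
    have "I (Suc (ireg s0 l + j)) (step (IInc i) (run c s))"
      unfolding st using J j by (intro inv) (auto simp: J_def W_def)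
    moreover have "frame W s0 (step (IInc i) (run c s))"
    proof -
      have "frame W s0 (run c s)" using J fr frame_trans[of W s0 s "run c s"] by (simp add: J_def)
      then show ?thesis by (auto simp: frame_def W_def)
    qed
    ultimately have "J (Suc j) (step (IInc i) (run c s))"
      using J i by (simp add: J_def)
    then show "\<exists>k s'. exec P (Seq c (Do (IInc i))) s k s' \<and> k \<le> K + 1 \<and> J (Suc j) s'"
      using e k cost by (meson add_le_mono1 le_trans)
  qed auto
  have "exec P (Do (IMove i l)) s0 1 s1"
    using exec.Do[of P "IMove i l" s0] by (simp add: s1_def)
  from exec.Seq[OF this w(1)] have "exec P (for_range i l h c) s0 (1 + k) s'"
    by (simp add: for_range_def)
  moreover have "1 + k \<le> (ireg s0 h - ireg s0 l) * (K + 2) + 2" using w by simp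
  ultimately show ?thesis using that w(3) le by (auto simp: J_def W_def)
qed

section \<open>Weighted ranks and their restriction to one side of a pivot\<close>

subsection \<open>Weighted selection\<close>

definition below :: "(real \<times> real) list \<Rightarrow> real \<Rightarrow> real" where
  "below L t = (\<Sum>x\<leftarrow>L. if fst x < t then snd x else 0)"

definition atmost :: "(real \<times> real) list \<Rightarrow> real \<Rightarrow> real" where
  "atmost L t = (\<Sum>x\<leftarrow>L. if fst x \<le> t then snd x else 0)"

definition weight_sum :: "(real \<times> real) list \<Rightarrow> real" where
  "weight_sum L = (\<Sum>x\<leftarrow>L. snd x)"

text \<open>A weighted quantile: \<open>\<theta>\<close> lies in the closed rank interval of the key
  \<open>t\<close>. Consecutive keys share an endpoint and the intervals lead from 0 to
  \<open>weight_sum L\<close>, so on a nonempty list every \<open>\<theta>\<close> in that range is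
  attained, ties and zero weights included.\<close>

definition splits :: "(real \<times> real) list \<Rightarrow> real \<Rightarrow> real \<Rightarrow> bool" where
  "splits L \<theta> t \<longleftrightarrow> t \<in> fst ` set L \<and> below L t \<le> \<theta> \<and> \<theta> \<le> atmost L t"

lemma below_less: "t \<le> p \<Longrightarrow> below (filter (\<lambda>x. fst x < p) L) t = below L t"
  by (induction L) (auto simp: below_def)

lemma atmost_less: "t < p \<Longrightarrow> atmost (filter (\<lambda>x. fst x < p) L) t = atmost L t"
  by (induction L) (auto simp: atmost_def)

lemma weight_sum_less: "weight_sum (filter (\<lambda>x. fst x < p) L) = below L p"
  by (induction L) (auto simp: below_def weight_sum_def)

lemma below_greater: "p < t \<Longrightarrow> below L t = atmost L p + below (filter (\<lambda>x. p < fst x) L) t"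
  by (induction L) (auto simp: below_def atmost_def)

lemma atmost_greater: "p < t \<Longrightarrow> atmost L t = atmost L p + atmost (filter (\<lambda>x. p < fst x) L) t"
  by (induction L) (auto simp: atmost_def)

lemma weight_sum_greater: "weight_sum L = atmost L p + weight_sum (filter (\<lambda>x. p < fst x) L)"
  by (induction L) (auto simp: weight_sum_def atmost_def)

lemma splits_less:
  "splits (filter (\<lambda>x. fst x < p) L) \<theta> t \<Longrightarrow> splits L \<theta> t"
  by (auto simp: splits_def below_less atmost_less)

lemma splits_greater:
  "splits (filter (\<lambda>x. p < fst x) L) (\<theta> - atmost L p) t \<Longrightarrow> splits L \<theta> t"
  using below_greater[of p t L] atmost_greater[of p t L] by (auto simp: splits_def)

lemma below_eq_length:
  "(\<And>x. x \<in> set L \<Longrightarrow> snd x = 1) \<Longrightarrow> below L t = length (filter (\<lambda>x. fst x < t) L)"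
  by (induction L) (auto simp: below_def)

lemma atmost_eq_length:
  "(\<And>x. x \<in> set L \<Longrightarrow> snd x = 1) \<Longrightarrow> atmost L t = length (filter (\<lambda>x. fst x \<le> t) L)"
  by (induction L) (auto simp: atmost_def)

lemma weight_sum_eq_length: "(\<And>x. x \<in> set L \<Longrightarrow> snd x = 1) \<Longrightarrow> weight_sum L = length L"
  by (induction L) (auto simp: weight_sum_def)

lemma splits_unit:
  assumes "splits (map (\<lambda>x. (f x, 1)) L) \<theta> t"
  shows "real (length (filter (\<lambda>x. f x < t) L)) \<le> \<theta>"
    and "\<theta> \<le> real (length (filter (\<lambda>x. f x \<le> t) L))"
proof -
  let ?M = "map (\<lambda>x. (f x, 1 :: real)) L"
  have "below ?M t = length (filter (\<lambda>x. fst x < t) ?M)"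
    by (rule below_eq_length) auto
  moreover have "atmost ?M t = length (filter (\<lambda>x. fst x \<le> t) ?M)"
    by (rule atmost_eq_length) auto
  ultimately show "real (length (filter (\<lambda>x. f x < t) L)) \<le> \<theta>"
    and "\<theta> \<le> real (length (filter (\<lambda>x. f x \<le> t) L))"
    using assms by (simp_all add: splits_def filter_map o_def)
qed

lemma filter_less_add_filter_not:
  "length (filter P L) + length (filter (\<lambda>x. \<not> P x) L) = length L"
  by (induction L) auto

section \<open>Ninthers and the rank of their median\<close>

subsection \<open>Pivots\<close>

definition med3 :: "real \<Rightarrow> real \<Rightarrow> real \<Rightarrow> real" where
  "med3 a b c =
     (if b < a then (if c < b then b else if c < a then c else a)
      else (if c < a then a else if c < b then c else b))"

lemma med3_le: "med3 a b c \<le> t \<Longrightarrow> 2 \<le> of_bool (a \<le> t) + of_bool (b \<le> t) + (of_bool (c \<le> t) :: nat)"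
  by (auto simp: med3_def split: if_splits)

lemma med3_ge: "t \<le> med3 a b c \<Longrightarrow> 2 \<le> of_bool (t \<le> a) + of_bool (t \<le> b) + (of_bool (t \<le> c) :: nat)"
  by (auto simp: med3_def split: if_splits)

text \<open>Tukey's ninther. If it is at most \<open>t\<close>, so are two of the three inner
  medians, and with each of these two of its three entries: four of nine. The dual count holds for
  lower bounds.\<close>

definition ninther :: "(nat \<Rightarrow> real) \<Rightarrow> nat \<Rightarrow> real" where
  "ninther f i = med3 (med3 (f i) (f (i + 1)) (f (i + 2)))
     (med3 (f (i + 3)) (f (i + 4)) (f (i + 5))) (med3 (f (i + 6)) (f (i + 7)) (f (i + 8)))"

lemma ninther_in: "ninther f i \<in> f ` {i..<i + 9}"
proof -
  have "med3 a b c \<in> A" if "a \<in> A" "b \<in> A" "c \<in> A" for a b c A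
    using that by (simp add: med3_def)
  then show ?thesis unfolding ninther_def by (simp add: imageI)
qed

lemma upt_9: "[i..<i + 9] = [i, i+1, i+2, i+3, i+4, i+5, i+6, i+7, i+8]"
  by (simp add: eval_nat_numeral upt_conv_Cons)

lemma length_filter_9:
  "length (filter P [i..<i + 9]) = of_bool (P i) + of_bool (P (i+1)) + of_bool (P (i+2)) +
     of_bool (P (i+3)) + of_bool (P (i+4)) + of_bool (P (i+5)) +
     of_bool (P (i+6)) + of_bool (P (i+7)) + of_bool (P (i+8))"
proof -
  have "length (filter P (x # xs)) = of_bool (P x) + length (filter P xs)" for x xs
    by simp
  then show ?thesis unfolding upt_9 by simp
qed

lemma two_thirds_twice:
  fixes a :: nat
  assumes "a * 2 \<le> x1 + x2 + x3" "b * 2 \<le> x4 + x5 + x6" "c * 2 \<le> x7 + x8 + x9"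
    and "2 \<le> a + b + c"
  shows "4 \<le> x1 + x2 + x3 + x4 + x5 + x6 + x7 + x8 + x9"
  using assms by linarith

lemma ninther_le:
  assumes "ninther f i \<le> t"
  shows "4 \<le> length (filter (\<lambda>i. f i \<le> t) [i..<i + 9])"
proof -
  have "of_bool (med3 a b c \<le> t) * 2 \<le> of_bool (a \<le> t) + of_bool (b \<le> t) + (of_bool (c \<le> t) :: nat)"
    for a b c using med3_le[of a b c t] by (cases "med3 a b c \<le> t") auto
  from two_thirds_twice[OF this this this med3_le[OF assms[unfolded ninther_def]]]
  show ?thesis unfolding length_filter_9 .
qed

lemma ninther_ge:
  assumes "t \<le> ninther f i"
  shows "4 \<le> length (filter (\<lambda>i. t \<le> f i) [i..<i + 9])"
proof -
  have "of_bool (t \<le> med3 a b c) * 2 \<le> of_bool (t \<le> a) + of_bool (t \<le> b) + (of_bool (t \<le> c) :: nat)"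
    for a b c using med3_ge[of t a b c] by (cases "t \<le> med3 a b c") auto
  from two_thirds_twice[OF this this this med3_ge[OF assms[unfolded ninther_def]]]
  show ?thesis unfolding length_filter_9 .
qed

lemma groups_count:
  assumes "\<And>i. Q i \<Longrightarrow> 4 \<le> length (filter P [i..<i + 9])" and "a + 9 * g \<le> b"
  shows "4 * length (filter (\<lambda>j. Q (a + 9 * j)) [0..<g]) \<le> length (filter P [a..<b])"
proof -
  have "4 * length (filter (\<lambda>j. Q (a + 9 * j)) [0..<g]) \<le> length (filter P [a..<a + 9 * g])"
  proof (induction g)
    case (Suc g)
    have "[a..<a + 9 * Suc g] = [a..<a + 9 * g] @ [a + 9 * g..<a + 9 * g + 9]"
      using upt_add_eq_append[of a "a + 9 * g" 9] by (simp add: algebra_simps)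
    then show ?case using Suc assms(1)[of "a + 9 * g"] by (cases "Q (a + 9 * g)") simp_all
  qed simp
  also have "[a..<b] = [a..<a + 9 * g] @ [a + 9 * g..<b]"
    using upt_add_eq_append[of a "a + 9 * g" "b - (a + 9 * g)"] assms(2) by simp
  then have "length (filter P [a..<a + 9 * g]) \<le> length (filter P [a..<b])" by simp
  finally show ?thesis .
qed

text \<open>On each side of \<open>p\<close>, ties counted for both, there are at least half of the
  \<open>g\<close> ninthers, and each brings four elements of its group. So \<open>2 * g\<close>
  elements are not smaller than \<open>p\<close> and \<open>2 * g\<close> are not larger.\<close>

lemma pivot_quality:
  fixes f :: "nat \<Rightarrow> real"
  assumes g: "a + 9 * g \<le> b"
    and s: "splits (map (\<lambda>j. (ninther f (a + 9 * j), 1)) [0..<g]) (real g / 2) p"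
  shows "length (filter (\<lambda>i. f i < p) [a..<b]) + 2 * g \<le> b - a"
    and "length (filter (\<lambda>i. p < f i) [a..<b]) + 2 * g \<le> b - a"
proof -
  note s = splits_unit[OF s]
  let ?lt = "length (filter (\<lambda>j. ninther f (a + 9 * j) < p) [0..<g])"
  let ?le = "length (filter (\<lambda>j. ninther f (a + 9 * j) \<le> p) [0..<g])"
  let ?ge = "length (filter (\<lambda>j. p \<le> ninther f (a + 9 * j)) [0..<g])"
  have 1: "?lt + ?ge = g"
    using filter_less_add_filter_not[of "\<lambda>j. ninther f (a + 9 * j) < p" "[0..<g]"]
    by (simp add: not_less)
  have "4 * ?le \<le> length (filter (\<lambda>i. f i \<le> p) [a..<b])"
    by (rule groups_count[where Q = "\<lambda>i. ninther f i \<le> p", OF ninther_le g])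
  moreover have "4 * ?ge \<le> length (filter (\<lambda>i. p \<le> f i) [a..<b])"
    by (rule groups_count[where Q = "\<lambda>i. p \<le> ninther f i", OF ninther_ge g])
  moreover have "length (filter (\<lambda>i. f i < p) [a..<b]) + length (filter (\<lambda>i. p \<le> f i) [a..<b]) = b - a"
    using filter_less_add_filter_not[of "\<lambda>i. f i < p" "[a..<b]"] by (simp add: not_less)
  moreover have "length (filter (\<lambda>i. f i \<le> p) [a..<b]) + length (filter (\<lambda>i. p < f i) [a..<b]) = b - a"
    using filter_less_add_filter_not[of "\<lambda>i. f i \<le> p" "[a..<b]"] by (simp add: not_le)
  moreover have "2 * ?lt \<le> g" "g \<le> 2 * ?le" using s by linarith+
  ultimately show "length (filter (\<lambda>i. f i < p) [a..<b]) + 2 * g \<le> b - a"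
    and "length (filter (\<lambda>i. p < f i) [a..<b]) + 2 * g \<le> b - a"
    using 1 by linarith+
qed

section \<open>The convex objective: growth in a direction, subgradients on a line\<close>

subsection \<open>Deviation from weighted lines\<close>

text \<open>A triple \<open>(m, c, w)\<close> is the line \<open>y = m * x + c\<close> with weight \<open>w\<close>.\<close>

type_synonym line = "real \<times> real \<times> real"

abbreviation slope :: "line \<Rightarrow> real" where "slope \<equiv> fst"
abbreviation icpt :: "line \<Rightarrow> real" where "icpt l \<equiv> fst (snd l)"
abbreviation wgt :: "line \<Rightarrow> real" where "wgt l \<equiv> snd (snd l)"

definition resid :: "real \<times> real \<Rightarrow> line \<Rightarrow> real" where
  "resid z l = snd z - slope l * fst z - icpt l"

definition dev :: "line list \<Rightarrow> real \<Rightarrow> real \<Rightarrow> real \<times> real \<Rightarrow> real" where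
  "dev L \<alpha> \<beta> z = (\<Sum>l\<leftarrow>L. wgt l * \<bar>resid z l\<bar>) + \<alpha> * fst z + \<beta> * snd z"

definition seg :: "real \<times> real \<Rightarrow> real \<times> real \<Rightarrow> real \<Rightarrow> real \<times> real" where
  "seg z w \<theta> = ((1 - \<theta>) * fst z + \<theta> * fst w, (1 - \<theta>) * snd z + \<theta> * snd w)"

abbreviation (input) bounded_dev :: "line list \<Rightarrow> real \<Rightarrow> real \<Rightarrow> bool" where
  "bounded_dev L \<alpha> \<beta> \<equiv> \<exists>B. \<forall>y. B \<le> dev L \<alpha> \<beta> y"

abbreviation (input) nonneg_wgts :: "line list \<Rightarrow> bool" where
  "nonneg_wgts L \<equiv> \<forall>l\<in>set L. 0 \<le> wgt l"

lemma dev_convex: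
  assumes "nonneg_wgts L" "0 \<le> \<theta>" "\<theta> \<le> 1"
  shows "dev L \<alpha> \<beta> (seg z w \<theta>) \<le> (1 - \<theta>) * dev L \<alpha> \<beta> z + \<theta> * dev L \<alpha> \<beta> w"
proof -
  have "wgt l * \<bar>resid (seg z w \<theta>) l\<bar>
      \<le> (1 - \<theta>) * (wgt l * \<bar>resid z l\<bar>) + \<theta> * (wgt l * \<bar>resid w l\<bar>)" if "l \<in> set L" for l
  proof -
    have "resid (seg z w \<theta>) l = (1 - \<theta>) * resid z l + \<theta> * resid w l"
      by (simp add: resid_def seg_def algebra_simps)
    then have "\<bar>resid (seg z w \<theta>) l\<bar> \<le> (1 - \<theta>) * \<bar>resid z l\<bar> + \<theta> * \<bar>resid w l\<bar>"
      using abs_triangle_ineq[of "(1 - \<theta>) * resid z l" "\<theta> * resid w l"] assms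
      by (simp add: abs_mult)
    from mult_left_mono[OF this, of "wgt l"] show ?thesis
      using assms that by (simp add: algebra_simps)
  qed
  then have "(\<Sum>l\<leftarrow>L. wgt l * \<bar>resid (seg z w \<theta>) l\<bar>)
      \<le> (\<Sum>l\<leftarrow>L. (1 - \<theta>) * (wgt l * \<bar>resid z l\<bar>) + \<theta> * (wgt l * \<bar>resid w l\<bar>))"
    by (rule sum_list_mono)
  also have "\<dots> = (1 - \<theta>) * (\<Sum>l\<leftarrow>L. wgt l * \<bar>resid z l\<bar>) + \<theta> * (\<Sum>l\<leftarrow>L. wgt l * \<bar>resid w l\<bar>)"
    by (simp add: sum_list_addf sum_list_const_mult)
  finally show ?thesis
    by (simp add: dev_def seg_def algebra_simps)
qed

lemma linear_le_imp_slope_le: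
  fixes a :: real
  assumes "\<And>T. 0 \<le> T \<Longrightarrow> T * a \<le> T * b + c"
  shows "a \<le> b"
proof (rule ccontr)
  assume "\<not> a \<le> b"
  define T where "T = (\<bar>c\<bar> + 1) / (a - b)"
  have "0 \<le> T" "T * (a - b) = \<bar>c\<bar> + 1" using \<open>\<not> a \<le> b\<close> by (auto simp: T_def)
  then show False using assms[of T] by (simp add: algebra_simps)
qed

text \<open>Far out along \<open>u\<close> the absolute values grow with slope at most
  \<open>?W\<close>; a steeper linear part would pull the objective to minus infinity in one of the
  two directions. For a query direction this puts the median threshold between 0 and the total
  weight; for the unit vectors and no lines it gives \<open>\<alpha> = \<beta> = 0\<close>.\<close>

lemma bounded_imp_directional:
  assumes w: "nonneg_wgts L" and B: "\<And>z. B \<le> dev L \<alpha> \<beta> z"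
  shows "\<bar>\<alpha> * ux + \<beta> * uy\<bar> \<le> (\<Sum>l\<leftarrow>L. \<bar>wgt l * (uy - slope l * ux)\<bar>)"
proof -
  let ?W = "\<Sum>l\<leftarrow>L. \<bar>wgt l * (uy - slope l * ux)\<bar>"
  let ?E = "\<Sum>l\<leftarrow>L. wgt l * \<bar>icpt l\<bar>"
  have key: "B \<le> \<bar>T\<bar> * ?W + ?E + T * (\<alpha> * ux + \<beta> * uy)" for T
  proof -
    have "wgt l * \<bar>resid (T * ux, T * uy) l\<bar>
        \<le> \<bar>T\<bar> * \<bar>wgt l * (uy - slope l * ux)\<bar> + wgt l * \<bar>icpt l\<bar>" if "l \<in> set L" for l
    proof -
      have "resid (T * ux, T * uy) l = T * (uy - slope l * ux) - icpt l"
        by (simp add: resid_def algebra_simps)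
      then have "\<bar>resid (T * ux, T * uy) l\<bar> \<le> \<bar>T\<bar> * \<bar>uy - slope l * ux\<bar> + \<bar>icpt l\<bar>"
        using abs_triangle_ineq4[of "T * (uy - slope l * ux)" "icpt l"] by (simp add: abs_mult)
      then have "wgt l * \<bar>resid (T * ux, T * uy) l\<bar>
          \<le> wgt l * (\<bar>T\<bar> * \<bar>uy - slope l * ux\<bar> + \<bar>icpt l\<bar>)"
        using w that by (simp add: mult_left_mono)
      also have "\<dots> = \<bar>T\<bar> * \<bar>wgt l * (uy - slope l * ux)\<bar> + wgt l * \<bar>icpt l\<bar>"
        using w that by (simp add: abs_mult distrib_left)
      finally show ?thesis .
    qed
    then have "(\<Sum>l\<leftarrow>L. wgt l * \<bar>resid (T * ux, T * uy) l\<bar>)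
        \<le> (\<Sum>l\<leftarrow>L. \<bar>T\<bar> * \<bar>wgt l * (uy - slope l * ux)\<bar> + wgt l * \<bar>icpt l\<bar>)"
      by (rule sum_list_mono)
    also have "\<dots> = \<bar>T\<bar> * ?W + ?E"
      by (simp add: sum_list_addf sum_list_const_mult)
    finally show ?thesis using B[of "(T * ux, T * uy)"]
      by (simp add: dev_def algebra_simps)
  qed
  have "T * (\<alpha> * ux + \<beta> * uy) \<le> T * ?W + (?E - B)"
    and "T * - (\<alpha> * ux + \<beta> * uy) \<le> T * ?W + (?E - B)" if "0 \<le> T" for T
    using key[of T] key[of "- T"] that by (simp_all add: algebra_simps)
  from linear_le_imp_slope_le[OF this(1)] linear_le_imp_slope_le[OF this(2)]
  show ?thesis by linarith
qed

text \<open>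
  The breakpoints of the restriction of \<open>dev\<close> to the line \<open>z + t * u\<close>. Lines parallel to
  \<open>u\<close> get the key 0 (division by 0), but also the weight 0.
\<close>

definition breaks :: "line list \<Rightarrow> real \<times> real \<Rightarrow> real \<times> real \<Rightarrow> (real \<times> real) list" where
  "breaks L z u = map (\<lambda>l. (- (resid z l / (snd u - slope l * fst u)),
     \<bar>wgt l * (snd u - slope l * fst u)\<bar>)) L"

text \<open>Only lines that miss \<open>q\<close> contribute, as \<open>sgn 0 = 0\<close>. Those
  through \<open>q\<close> are collected in \<open>grad1\<close>, each with the sign that its
  residual takes just after \<open>q\<close> in direction \<open>u\<close>.\<close>

definition grad0 :: "line list \<Rightarrow> real \<Rightarrow> real \<Rightarrow> real \<times> real \<Rightarrow> real \<times> real" where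
  "grad0 L \<alpha> \<beta> q = (\<alpha> - (\<Sum>l\<leftarrow>L. sgn (resid q l) * wgt l * slope l),
     \<beta> + (\<Sum>l\<leftarrow>L. sgn (resid q l) * wgt l))"

definition grad1 :: "line list \<Rightarrow> real \<times> real \<Rightarrow> real \<times> real \<Rightarrow> real \<times> real" where
  "grad1 L u q =
     (- (\<Sum>l\<leftarrow>L. if resid q l = 0 then sgn (snd u - slope l * fst u) * wgt l * slope l else 0),
      \<Sum>l\<leftarrow>L. if resid q l = 0 then sgn (snd u - slope l * fst u) * wgt l else 0)"

definition grad :: "line list \<Rightarrow> real \<Rightarrow> real \<Rightarrow> real \<times> real \<Rightarrow> real \<times> real \<Rightarrow> real \<times> real" where
  "grad L \<alpha> \<beta> u q = (let g = grad0 L \<alpha> \<beta> q; h = grad1 L u q;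
     \<sigma> = - ((fst g * fst u + snd g * snd u) / (fst h * fst u + snd h * snd u))
   in (fst g + \<sigma> * fst h, snd g + \<sigma> * snd h))"

text \<open>
  On the lines through \<open>q\<close> one common multiplier in \<open>[-1, 1]\<close> turns the directional slope
  into 0: this is what makes a subgradient orthogonal to the queried line computable in one pass.
\<close>

lemma grad_props:
  assumes w: "nonneg_wgts L"
    and t: "splits (breaks L z u) ((weight_sum (breaks L z u) - (\<alpha> * fst u + \<beta> * snd u)) / 2) t"
    and q: "q = (fst z + t * fst u, snd z + t * snd u)"
  shows "fst (grad L \<alpha> \<beta> u q) * fst u + snd (grad L \<alpha> \<beta> u q) * snd u = 0"
    and "dev L \<alpha> \<beta> q + fst (grad L \<alpha> \<beta> u q) * (fst y - fst q) + snd (grad L \<alpha> \<beta> u q) * (snd y - snd q)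
      \<le> dev L \<alpha> \<beta> y"
proof -
  define A where "A = (\<lambda>l :: line. snd u - slope l * fst u)"
  define W where "W = (\<lambda>l :: line. \<bar>wgt l * A l\<bar>)"
  define K where "K = (\<lambda>l. - (resid z l / A l))"
  define \<gamma> where "\<gamma> = \<alpha> * fst u + \<beta> * snd u"
  define g where "g = grad0 L \<alpha> \<beta> q"
  define h where "h = grad1 L u q"
  have br: "breaks L z u = map (\<lambda>l. (K l, W l)) L"
    by (simp add: breaks_def A_def W_def K_def)
  have e: "resid q l = A l * (t - K l)" if "A l \<noteq> 0" for l
    using that by (simp add: q resid_def A_def K_def field_simps)
  define Z where "Z = (\<Sum>l\<leftarrow>L. if resid q l = 0 then W l else 0)"
  define P where "P = (\<Sum>l\<leftarrow>L. sgn (resid q l) * wgt l * A l)"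
  have signs: "sgn (resid q l) * wgt l * A l + (if resid q l = 0 then W l else 0) =
      2 * (if K l \<le> t then W l else 0) - W l \<and>
    sgn (resid q l) * wgt l * A l - (if resid q l = 0 then W l else 0) =
      2 * (if K l < t then W l else 0) - W l" if "l \<in> set L" for l
  proof -
    have W: "W l = wgt l * \<bar>A l\<bar>" using w that by (simp add: W_def abs_mult)
    have A: "sgn (A l) * (wgt l * A l) = wgt l * \<bar>A l\<bar>" by (simp add: sgn_if abs_if)
    consider "A l = 0" | "A l \<noteq> 0" "K l = t" | "A l \<noteq> 0" "K l < t" | "A l \<noteq> 0" "t < K l" by linarith
    then show ?thesis
    proof cases
      case 1
      then show ?thesis by (simp add: W_def)
    qed (use A in \<open>simp_all add: e W sgn_mult mult.assoc\<close>)
  qed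
  \<comment> \<open>\<open>P + \<gamma> + Z\<close> and \<open>P + \<gamma> - Z\<close> are the
    one-sided derivatives along \<open>u\<close> at parameter \<open>t\<close>; the two rank
    inequalities say that 0 lies between them.\<close>
  have "P + Z = (\<Sum>l\<leftarrow>L. 2 * (if K l \<le> t then W l else 0) - W l)"
    unfolding P_def Z_def sum_list_addf[symmetric]
    by (rule arg_cong[of _ _ sum_list], rule map_cong) (use signs in auto)
  also have "\<dots> = 2 * atmost (breaks L z u) t - weight_sum (breaks L z u)"
    by (simp add: br atmost_def weight_sum_def sum_list_subtractf sum_list_const_mult o_def cong: if_cong)
  finally have PZ1: "0 \<le> P + \<gamma> + Z" using t by (simp add: splits_def \<gamma>_def)
  have "P - Z = (\<Sum>l\<leftarrow>L. 2 * (if K l < t then W l else 0) - W l)"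
    unfolding P_def Z_def sum_list_subtractf[symmetric]
    by (rule arg_cong[of _ _ sum_list], rule map_cong) (use signs in auto)
  also have "\<dots> = 2 * below (breaks L z u) t - weight_sum (breaks L z u)"
    by (simp add: br below_def weight_sum_def sum_list_subtractf sum_list_const_mult o_def cong: if_cong)
  finally have PZ2: "P + \<gamma> - Z \<le> 0" using t by (simp add: splits_def \<gamma>_def)
  have gu: "fst g * fst u + snd g * snd u = P + \<gamma>"
  proof -
    have "P = (\<Sum>l\<leftarrow>L. sgn (resid q l) * wgt l * snd u - sgn (resid q l) * wgt l * slope l * fst u)"
      by (simp add: P_def A_def algebra_simps)
    also have "\<dots> = (\<Sum>l\<leftarrow>L. sgn (resid q l) * wgt l) * snd u -
        (\<Sum>l\<leftarrow>L. sgn (resid q l) * wgt l * slope l) * fst u"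
      by (simp only: sum_list_subtractf sum_list_mult_const)
    finally show ?thesis by (simp add: g_def grad0_def \<gamma>_def algebra_simps)
  qed
  have hu: "fst h * fst u + snd h * snd u = Z"
  proof -
    have "Z = (\<Sum>l\<leftarrow>L. (if resid q l = 0 then sgn (A l) * wgt l else 0) * snd u -
        (if resid q l = 0 then sgn (A l) * wgt l * slope l else 0) * fst u)"
      unfolding Z_def
    proof (rule arg_cong[of _ _ sum_list], rule map_cong)
      fix l assume "l \<in> set L"
      then have "W l = sgn (A l) * wgt l * A l"
        using w by (auto simp: W_def abs_mult sgn_if)
      then show "(if resid q l = 0 then W l else 0) =
        (if resid q l = 0 then sgn (A l) * wgt l else 0) * snd u -
        (if resid q l = 0 then sgn (A l) * wgt l * slope l else 0) * fst u"
        by (simp add: A_def algebra_simps)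
    qed simp
    also have "\<dots> = fst h * fst u + snd h * snd u"
      unfolding sum_list_subtractf sum_list_mult_const by (simp add: h_def grad1_def A_def cong: if_cong)
    finally show ?thesis by simp
  qed
  define \<sigma> where "\<sigma> = - ((P + \<gamma>) / Z)"
  have gr: "grad L \<alpha> \<beta> u q = (fst g + \<sigma> * fst h, snd g + \<sigma> * snd h)"
    unfolding grad_def Let_def g_def[symmetric] h_def[symmetric] gu hu \<sigma>_def ..
  \<comment> \<open>If \<open>Z = 0\<close>, both one-sided derivatives coincide and hence vanish,
    so the default \<open>x / 0 = 0\<close> is the right multiplier.\<close>
  have \<sigma>Z: "\<sigma> * Z = - (P + \<gamma>)"
    using PZ1 PZ2 by (cases "Z = 0") (auto simp: \<sigma>_def)
  have \<sigma>1: "\<bar>\<sigma>\<bar> \<le> 1"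
  proof -
    have "0 \<le> Z" "\<bar>P + \<gamma>\<bar> \<le> Z" using PZ1 PZ2 by linarith+
    then show ?thesis by (auto simp: \<sigma>_def divide_le_eq_1)
  qed
  have "(fst g + \<sigma> * fst h) * fst u + (snd g + \<sigma> * snd h) * snd u =
    (fst g * fst u + snd g * snd u) + \<sigma> * (fst h * fst u + snd h * snd u)" by (simp add: algebra_simps)
  then show "fst (grad L \<alpha> \<beta> u q) * fst u + snd (grad L \<alpha> \<beta> u q) * snd u = 0"
    unfolding gr fst_conv snd_conv gu hu using \<sigma>Z by simp
  \<comment> \<open>\<open>S l\<close> is a subgradient of the absolute value at
    \<open>resid q l\<close>: its modulus is at most 1, and it is the sign of every nonzero
    residual.\<close>
  define S where "S = (\<lambda>l. sgn (resid q l) + \<sigma> * (if resid q l = 0 then sgn (A l) else 0))"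
  define \<delta> where "\<delta> = (\<lambda>l :: line. (snd y - snd q) - slope l * (fst y - fst q))"
  have "wgt l * \<bar>resid q l\<bar> + S l * wgt l * \<delta> l \<le> wgt l * \<bar>resid y l\<bar>" if "l \<in> set L" for l
  proof -
    have ry: "resid y l = resid q l + \<delta> l" by (simp add: resid_def \<delta>_def algebra_simps)
    have "\<bar>S l\<bar> \<le> 1" using \<sigma>1 by (auto simp: S_def sgn_if)
    then have "S l * resid y l \<le> \<bar>resid y l\<bar>"
      using mult_right_mono[of "\<bar>S l\<bar>" 1 "\<bar>resid y l\<bar>"] abs_ge_self[of "S l * resid y l"]
      by (simp add: abs_mult)
    moreover have "S l * resid q l = \<bar>resid q l\<bar>" by (auto simp: S_def sgn_if)
    ultimately have "\<bar>resid q l\<bar> + S l * \<delta> l \<le> \<bar>resid y l\<bar>" by (simp add: ry algebra_simps)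
    from mult_left_mono[OF this, of "wgt l"] show ?thesis
      using w that by (simp add: algebra_simps)
  qed
  then have "(\<Sum>l\<leftarrow>L. wgt l * \<bar>resid q l\<bar> + S l * wgt l * \<delta> l) \<le> (\<Sum>l\<leftarrow>L. wgt l * \<bar>resid y l\<bar>)"
    by (rule sum_list_mono)
  then have "(\<Sum>l\<leftarrow>L. wgt l * \<bar>resid q l\<bar>) + (\<Sum>l\<leftarrow>L. S l * wgt l * \<delta> l) \<le> (\<Sum>l\<leftarrow>L. wgt l * \<bar>resid y l\<bar>)"
    by (simp add: sum_list_addf)
  moreover have "(\<Sum>l\<leftarrow>L. S l * wgt l * \<delta> l) + \<alpha> * (fst y - fst q) + \<beta> * (snd y - snd q) =
    (fst g + \<sigma> * fst h) * (fst y - fst q) + (snd g + \<sigma> * snd h) * (snd y - snd q)"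
  proof -
    have S: "S l * wgt l * \<delta> l =
       (sgn (resid q l) * wgt l) * (snd y - snd q) - (sgn (resid q l) * wgt l * slope l) * (fst y - fst q)
       + \<sigma> * ((if resid q l = 0 then sgn (A l) * wgt l else 0) * (snd y - snd q) -
        (if resid q l = 0 then sgn (A l) * wgt l * slope l else 0) * (fst y - fst q))" for l
      by (simp add: S_def \<delta>_def algebra_simps)
    show ?thesis
      unfolding S sum_list_addf sum_list_subtractf sum_list_const_mult sum_list_mult_const
      by (simp add: g_def h_def grad0_def grad1_def A_def algebra_simps cong: if_cong)
  qed
  ultimately show "dev L \<alpha> \<beta> q + fst (grad L \<alpha> \<beta> u q) * (fst y - fst q) +
      snd (grad L \<alpha> \<beta> u q) * (snd y - snd q) \<le> dev L \<alpha> \<beta> y"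
    unfolding dev_def gr fst_conv snd_conv right_diff_distrib by linarith
qed

section \<open>Replacing absolute values by linear terms on a quadrant\<close>

subsection \<open>One pruning step\<close>

text \<open>A coordinate that ends nonpositive vanishes at parameter \<open>a / (a - b)\<close>,
  while any other stays positive up to 1. At the smaller parameter one coordinate is 0 and the other
  is still nonnegative.\<close>

lemma first_exit:
  fixes a1 a2 b1 b2 :: real
  assumes "0 < a1" "0 < a2" "b1 \<le> 0 \<or> b2 \<le> 0"
  obtains \<theta> where "0 \<le> \<theta>" "\<theta> \<le> 1" "0 \<le> (1 - \<theta>) * a1 + \<theta> * b1" "0 \<le> (1 - \<theta>) * a2 + \<theta> * b2"
    "(1 - \<theta>) * a1 + \<theta> * b1 = 0 \<or> (1 - \<theta>) * a2 + \<theta> * b2 = 0"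
proof -
  define h where "h = (\<lambda>a b :: real. if b \<le> 0 then a / (a - b) else 1)"
  have h: "0 \<le> h a b \<and> h a b \<le> 1 \<and> (\<forall>\<theta>\<ge>0. \<theta> \<le> h a b \<longrightarrow> 0 \<le> (1 - \<theta>) * a + \<theta> * b) \<and>
      (b \<le> 0 \<longrightarrow> (1 - h a b) * a + h a b * b = 0)" if "0 < a" for a b
  proof (cases "b \<le> 0")
    case True
    have "h a b * (a - b) = a" using that True by (simp add: h_def)
    moreover have "\<theta> * (a - b) \<le> h a b * (a - b)" if "\<theta> \<le> h a b" for \<theta>
      using that True \<open>0 < a\<close> by (intro mult_right_mono) auto
    moreover have "0 \<le> h a b" "h a b \<le> 1" using that True by (auto simp: h_def divide_le_eq_1)
    ultimately show ?thesis by (fastforce simp: algebra_simps)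
  next
    case False
    then have "0 \<le> (1 - \<theta>) * a + \<theta> * b" if "0 \<le> \<theta>" "\<theta> \<le> 1" for \<theta>
      using that \<open>0 < a\<close> by simp
    then show ?thesis using False by (simp add: h_def)
  qed
  note h1 = h[of a1 b1, OF assms(1)] and h2 = h[of a2 b2, OF assms(2)]
  show ?thesis
  proof (rule that[of "min (h a1 b1) (h a2 b2)"])
    show "(1 - min (h a1 b1) (h a2 b2)) * a1 + min (h a1 b1) (h a2 b2) * b1 = 0 \<or>
        (1 - min (h a1 b1) (h a2 b2)) * a2 + min (h a1 b1) (h a2 b2) * b2 = 0"
    proof (cases "h a1 b1 \<le> h a2 b2")
      case True
      show ?thesis
      proof (cases "b1 \<le> 0")
        case b1: False
        then have "h a1 b1 = 1" by (simp add: h_def)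
        then have "min (h a1 b1) (h a2 b2) = h a2 b2" using True h2 by linarith
        then show ?thesis using h2 b1 assms(3) by simp
      qed (use True h1 in \<open>simp add: min_def\<close>)
    next
      case False
      then have "h a2 b2 \<noteq> 1" using h1 by linarith
      then have "b2 \<le> 0" by (auto simp: h_def split: if_splits)
      then show ?thesis using False h2 by (auto simp: min_def)
    qed
  qed (simp_all add: h1 h2 min.coboundedI1)
qed

text \<open>
  Outside the quadrant \<open>f1 > 0 \<and> f2 > 0\<close> the deviation is at least its value at \<open>b\<close>. A point that
  improves on \<open>b\<close> for the pruned problem therefore lies in the quadrant, as otherwise the segment to
  it would leave the quadrant in a point that improves on \<open>b\<close> for the original problem.
\<close>

locale prune_step =
  fixes L L' :: "line list" and \<alpha> \<beta> \<alpha>' \<beta>' \<kappa> :: real and f1 f2 :: "real \<times> real \<Rightarrow> real" and b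
  assumes w: "nonneg_wgts L'"
    and affine1: "f1 (seg y z \<theta>) = (1 - \<theta>) * f1 y + \<theta> * f1 z"
    and affine2: "f2 (seg y z \<theta>) = (1 - \<theta>) * f2 y + \<theta> * f2 z"
    and outside1: "f1 z \<le> 0 \<Longrightarrow> dev L \<alpha> \<beta> b \<le> dev L \<alpha> \<beta> z"
    and outside2: "f2 z \<le> 0 \<Longrightarrow> dev L \<alpha> \<beta> b \<le> dev L \<alpha> \<beta> z"
    and le: "dev L' \<alpha>' \<beta>' z + \<kappa> \<le> dev L \<alpha> \<beta> z"
    and eq: "0 \<le> f1 z \<Longrightarrow> 0 \<le> f2 z \<Longrightarrow> dev L \<alpha> \<beta> z = dev L' \<alpha>' \<beta>' z + \<kappa>"
begin

lemma improving_inside: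
  assumes z: "dev L \<alpha> \<beta> z < dev L \<alpha> \<beta> b" and y: "dev L' \<alpha>' \<beta>' y + \<kappa> < dev L \<alpha> \<beta> b"
  shows "0 < f1 y \<and> 0 < f2 y"
proof (rule ccontr)
  assume "\<not> (0 < f1 y \<and> 0 < f2 y)"
  moreover have "0 < f1 z" "0 < f2 z" using z outside1[of z] outside2[of z] by force+
  ultimately obtain \<theta> where \<theta>: "0 \<le> \<theta>" "\<theta> \<le> 1" "0 \<le> f1 (seg z y \<theta>)" "0 \<le> f2 (seg z y \<theta>)"
    "f1 (seg z y \<theta>) = 0 \<or> f2 (seg z y \<theta>) = 0"
    using first_exit[of "f1 z" "f2 z" "f1 y" "f2 y"] by (metis affine1 affine2 not_less)
  have "dev L \<alpha> \<beta> b \<le> dev L \<alpha> \<beta> (seg z y \<theta>)"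
    using \<theta>(5) outside1[of "seg z y \<theta>"] outside2[of "seg z y \<theta>"] by auto
  also have "\<dots> = dev L' \<alpha>' \<beta>' (seg z y \<theta>) + \<kappa>" using eq \<theta> by blast
  also have "\<dots> \<le> (1 - \<theta>) * dev L' \<alpha>' \<beta>' z + \<theta> * dev L' \<alpha>' \<beta>' y + \<kappa>"
    using dev_convex[OF w \<theta>(1,2)] by simp
  also have "\<dots> = (1 - \<theta>) * (dev L' \<alpha>' \<beta>' z + \<kappa>) + \<theta> * (dev L' \<alpha>' \<beta>' y + \<kappa>)"
    by (simp add: algebra_simps)
  also have "\<dots> < dev L \<alpha> \<beta> b"
    using convex_bound_lt[of "dev L' \<alpha>' \<beta>' z + \<kappa>" "dev L \<alpha> \<beta> b" "dev L' \<alpha>' \<beta>' y + \<kappa>" "1 - \<theta>" \<theta>]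
      le[of z] z y \<theta> by simp
  finally show False by simp
qed

text \<open>Inside the quadrant the objectives differ by \<open>\<kappa>\<close>, so
  \<open>B\<close> applies; elsewhere nothing lies below the value at \<open>b\<close>. The better
  point \<open>z\<close> matters: in \<open>\<bar>y - x\<bar> + \<bar>y + x\<bar>\<close> with
  \<open>b\<close> at the origin, pruning the second line on the quadrant of positive
  \<open>x\<close> and \<open>y\<close> leaves \<open>\<bar>y - x\<bar> + y + x\<close>, which is
  unbounded.\<close>

lemma bounded_step:
  assumes B: "\<And>z. B \<le> dev L \<alpha> \<beta> z" and z: "dev L \<alpha> \<beta> z < dev L \<alpha> \<beta> b"
  shows "\<exists>B'. \<forall>y. B' \<le> dev L' \<alpha>' \<beta>' y"
proof (intro exI allI)
  fix y
  show "min B (dev L \<alpha> \<beta> b) - \<kappa> \<le> dev L' \<alpha>' \<beta>' y"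
  proof (cases "dev L' \<alpha>' \<beta>' y + \<kappa> < dev L \<alpha> \<beta> b")
    case True
    then show ?thesis using improving_inside[OF z True] eq[of y] B[of y] by auto
  qed auto
qed

text \<open>If \<open>b\<close> can be beaten at all, the pruned problem is bounded, so
  \<open>r\<close> minimises it and by \<open>improving_inside\<close> lies in the quadrant, where
  both objectives agree up to \<open>\<kappa>\<close>.\<close>

lemma best_optimal:
  assumes B: "\<And>z. B \<le> dev L \<alpha> \<beta> z"
    and r: "\<And>B'. (\<forall>y. B' \<le> dev L' \<alpha>' \<beta>' y) \<Longrightarrow> \<forall>y. dev L' \<alpha>' \<beta>' r \<le> dev L' \<alpha>' \<beta>' y"
    and a: "a = (if dev L \<alpha> \<beta> r < dev L \<alpha> \<beta> b then r else b)"
  shows "dev L \<alpha> \<beta> a \<le> dev L \<alpha> \<beta> z"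
proof (rule ccontr)
  assume c: "\<not> ?thesis"
  then have "dev L \<alpha> \<beta> z < dev L \<alpha> \<beta> b" by (auto simp: a split: if_splits)
  from bounded_step[OF B this] r have opt: "\<forall>y. dev L' \<alpha>' \<beta>' r \<le> dev L' \<alpha>' \<beta>' y" by blast
  then have 1: "dev L' \<alpha>' \<beta>' r + \<kappa> \<le> dev L \<alpha> \<beta> z" using le[of z] by (meson add_right_mono order_trans)
  then have "0 < f1 r \<and> 0 < f2 r"
    using improving_inside[of z r] \<open>dev L \<alpha> \<beta> z < dev L \<alpha> \<beta> b\<close> by simp
  then have "dev L \<alpha> \<beta> r \<le> dev L \<alpha> \<beta> z" using 1 eq[of r] by simp
  then show False using c \<open>dev L \<alpha> \<beta> z < dev L \<alpha> \<beta> b\<close> by (auto simp: a split: if_splits)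
qed

end

text \<open>The signs select the quadrant \<open>sx * (x - x0) > 0\<close>,
  \<open>sy * (y - h - s * (x - x0)) > 0\<close>. Its apex \<open>(x0, h)\<close> lies weakly on
  side \<open>sy\<close> of the line, and on side \<open>sx\<close> of \<open>x0\<close> the
  boundary ray of slope \<open>s\<close> does not come closer to the line. So the residual keeps the
  sign \<open>sy\<close> on the whole closed quadrant.\<close>

definition prunable :: "real \<Rightarrow> real \<Rightarrow> real \<Rightarrow> real \<Rightarrow> real \<Rightarrow> line \<Rightarrow> bool" where
  "prunable sx sy s x0 h l \<longleftrightarrow> 0 \<le> sy * resid (x0, h) l \<and> sx * sy * (slope l - s) \<le> 0"

lemma sum_list_partition:
  "(\<Sum>x\<leftarrow>L. f x) = (\<Sum>x\<leftarrow>filter (\<lambda>x. \<not> P x) L. f x) + (\<Sum>x\<leftarrow>filter P L. f x :: real)"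
  by (induction L) auto

text \<open>\<open>sy * resid z l\<close> never exceeds the absolute value and, for pruned lines,
  equals it on the closed quadrant. The intercepts of these lines add only a constant, which does
  not move minimisers and is never computed by the program.\<close>

lemma prune_step_lines:
  assumes w: "nonneg_wgts L" and sx: "sx = 1 \<or> sx = - 1" and sy: "sy = 1 \<or> sy = - 1"
    and p: "p = prunable sx sy s x0 h"
    and q1: "\<And>z. sx * (fst z - x0) \<le> 0 \<Longrightarrow> dev L \<alpha> \<beta> b \<le> dev L \<alpha> \<beta> z"
    and q2: "\<And>z. sy * ((snd z - h) - s * (fst z - x0)) \<le> 0 \<Longrightarrow> dev L \<alpha> \<beta> b \<le> dev L \<alpha> \<beta> z"
  shows "prune_step L (filter (\<lambda>l. \<not> p l) L) \<alpha> \<beta>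
    (\<alpha> - (\<Sum>l\<leftarrow>filter p L. sy * wgt l * slope l)) (\<beta> + (\<Sum>l\<leftarrow>filter p L. sy * wgt l))
    (- (\<Sum>l\<leftarrow>filter p L. sy * wgt l * icpt l))
    (\<lambda>z. sx * (fst z - x0)) (\<lambda>z. sy * ((snd z - h) - s * (fst z - x0))) b"
proof
  let ?L' = "filter (\<lambda>l. \<not> p l) L" and ?\<alpha>' = "\<alpha> - (\<Sum>l\<leftarrow>filter p L. sy * wgt l * slope l)"
    and ?\<beta>' = "\<beta> + (\<Sum>l\<leftarrow>filter p L. sy * wgt l)"
    and ?\<kappa> = "- (\<Sum>l\<leftarrow>filter p L. sy * wgt l * icpt l)"
  have dev': "dev ?L' ?\<alpha>' ?\<beta>' z + ?\<kappa> = (\<Sum>l\<leftarrow>?L'. wgt l * \<bar>resid z l\<bar>) +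
      (\<Sum>l\<leftarrow>filter p L. wgt l * (sy * resid z l)) + \<alpha> * fst z + \<beta> * snd z" for z
  proof -
    have "(\<Sum>l\<leftarrow>filter p L. wgt l * (sy * resid z l)) =
      (\<Sum>l\<leftarrow>filter p L. sy * wgt l * snd z - sy * wgt l * slope l * fst z - sy * wgt l * icpt l)"
      by (simp add: resid_def algebra_simps)
    also have "\<dots> = (\<Sum>l\<leftarrow>filter p L. sy * wgt l) * snd z -
        (\<Sum>l\<leftarrow>filter p L. sy * wgt l * slope l) * fst z - (\<Sum>l\<leftarrow>filter p L. sy * wgt l * icpt l)"
      by (simp only: sum_list_subtractf sum_list_mult_const)
    finally show ?thesis by (simp add: dev_def algebra_simps)
  qed
  have dev: "dev L \<alpha> \<beta> z = (\<Sum>l\<leftarrow>?L'. wgt l * \<bar>resid z l\<bar>) +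
      (\<Sum>l\<leftarrow>filter p L. wgt l * \<bar>resid z l\<bar>) + \<alpha> * fst z + \<beta> * snd z" for z
    unfolding dev_def by (subst sum_list_partition[of _ L p]) simp
  show "dev ?L' ?\<alpha>' ?\<beta>' z + ?\<kappa> \<le> dev L \<alpha> \<beta> z" for z
  proof -
    have "wgt l * (sy * resid z l) \<le> wgt l * \<bar>resid z l\<bar>" if "l \<in> set (filter p L)" for l
      using that w sy by (intro mult_left_mono) auto
    then have "(\<Sum>l\<leftarrow>filter p L. wgt l * (sy * resid z l)) \<le> (\<Sum>l\<leftarrow>filter p L. wgt l * \<bar>resid z l\<bar>)"
      by (rule sum_list_mono)
    then show ?thesis unfolding dev' dev by simp
  qed
  show "dev L \<alpha> \<beta> z = dev ?L' ?\<alpha>' ?\<beta>' z + ?\<kappa>"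
    if R: "0 \<le> sx * (fst z - x0)" "0 \<le> sy * ((snd z - h) - s * (fst z - x0))" for z
  proof -
    have "sy * resid z l = \<bar>resid z l\<bar>" if "p l" for l
    proof -
      have "sx * sx = 1" using sx by auto
      \<comment> \<open>The inserted \<open>sx * sx\<close> pairs the slope condition of
        \<open>prunable\<close> with the side condition on \<open>x\<close>, so that each of the
        three contributions is nonnegative.\<close>
      have "sy * resid z l = sy * resid (x0, h) l + sy * ((snd z - h) - s * (fst z - x0)) -
          (sx * sx) * (sy * (slope l - s)) * (fst z - x0)"
        unfolding \<open>sx * sx = 1\<close> by (simp add: resid_def algebra_simps)
      also have "\<dots> = sy * resid (x0, h) l + sy * ((snd z - h) - s * (fst z - x0)) -
          (sx * sy * (slope l - s)) * (sx * (fst z - x0))"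
        by (simp add: algebra_simps)
      finally have "0 \<le> sy * resid z l"
        using mult_nonpos_nonneg[OF _ R(1), of "sx * sy * (slope l - s)"] R(2) that
        by (simp add: p prunable_def)
      then show ?thesis using sy by auto
    qed
    then have "map (\<lambda>l. wgt l * (sy * resid z l)) (filter p L) = map (\<lambda>l. wgt l * \<bar>resid z l\<bar>) (filter p L)"
      by (intro map_cong) auto
    then show ?thesis unfolding dev' dev by (simp only:)
  qed
qed (use w q1 q2 in \<open>auto simp: seg_def algebra_simps\<close>)

section \<open>Pairs of lines, their crossings and the fraction pruned\<close>

subsection \<open>Pairs of lines\<close>

text \<open>Lines of slope \<open>s\<close> satisfy the slope condition of \<open>prunable\<close>
  for all signs, so each is its own partner. Ties thus cost no pairs, and at least half as many
  pairs as lines remain although the zip cuts off the longer side.\<close>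

definition pairing :: "real \<Rightarrow> line list \<Rightarrow> (line \<times> line) list" where
  "pairing s L = zip (filter (\<lambda>l. slope l < s) L) (filter (\<lambda>l. s < slope l) L) @
     map (\<lambda>l. (l, l)) (filter (\<lambda>l. slope l = s) L)"

definition height :: "real \<Rightarrow> line \<Rightarrow> real" where
  "height x l = slope l * x + icpt l"

text \<open>A self-pair gets \<open>0 / 0 = 0\<close>, as good as any other abscissa because its two
  heights agree everywhere.\<close>

definition cross :: "line \<times> line \<Rightarrow> real" where
  "cross = (\<lambda>(k, l). (icpt k - icpt l) / (slope l - slope k))"

lemma pairing_slopes:
  assumes "(k, l) \<in> set (pairing s L)"
  shows "slope k \<le> s" "s \<le> slope l"
  using assms by (auto simp: pairing_def dest: set_zip_leftD set_zip_rightD)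

lemma cross_height:
  assumes "(k, l) \<in> set (pairing s L)"
  shows "cross (k, l) \<le> x \<Longrightarrow> height x k \<le> height x l"
    and "x \<le> cross (k, l) \<Longrightarrow> height x l \<le> height x k"
proof -
  have "k = l \<or> 0 < slope l - slope k"
  proof -
    consider "(k, l) \<in> set (zip (filter (\<lambda>l. slope l < s) L) (filter (\<lambda>l. s < slope l) L))" | "k = l"
      using assms by (auto simp: pairing_def)
    then show ?thesis
    proof cases
      case 1
      from set_zip_leftD[OF 1] set_zip_rightD[OF 1] show ?thesis by simp
    qed simp
  qed
  then show "cross (k, l) \<le> x \<Longrightarrow> height x k \<le> height x l"
    and "x \<le> cross (k, l) \<Longrightarrow> height x l \<le> height x k"
    by (auto simp: cross_def height_def field_simps)
qed

lemma length_filter_take: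
  "n \<le> length xs \<Longrightarrow> length (filter P (take n xs)) \<le> length (filter P xs)"
  by (metis append_take_drop_id filter_append le_add1 length_append)

lemma pairing_count:
  "length (filter (\<lambda>x. P (fst x)) (pairing s L)) \<le> length (filter P L)"
  "length (filter (\<lambda>x. P (snd x)) (pairing s L)) \<le> length (filter P L)"
proof -
  let ?A = "filter (\<lambda>l. slope l < s) L" and ?B = "filter (\<lambda>l. s < slope l) L"
  let ?T = "filter (\<lambda>l. slope l = s) L" and ?n = "min (length (filter (\<lambda>l. slope l < s) L)) (length (filter (\<lambda>l. s < slope l) L))"
  have 1: "length (filter P ?A) + length (filter P ?B) + length (filter P ?T) = length (filter P L)"
    by (induction L) auto
  have "length (filter (\<lambda>x. P (fst x)) (pairing s L)) = length (filter P (map fst (pairing s L)))"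
    by (simp add: filter_map o_def)
  also have "map fst (pairing s L) = take ?n ?A @ ?T"
    by (simp add: pairing_def o_def map_fst_zip_take)
  finally show "length (filter (\<lambda>x. P (fst x)) (pairing s L)) \<le> length (filter P L)"
    using 1 length_filter_take[of ?n ?A P] by simp
  have "length (filter (\<lambda>x. P (snd x)) (pairing s L)) = length (filter P (map snd (pairing s L)))"
    by (simp add: filter_map o_def)
  also have "map snd (pairing s L) = take ?n ?B @ ?T"
    by (simp add: pairing_def o_def map_snd_zip_take)
  finally show "length (filter (\<lambda>x. P (snd x)) (pairing s L)) \<le> length (filter P L)"
    using 1 length_filter_take[of ?n ?B P] by simp
qed

lemma length_filter_mono:
  "(\<And>x. x \<in> set L \<Longrightarrow> P x \<Longrightarrow> Q x) \<Longrightarrow> length (filter P L) \<le> length (filter Q L)"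
  by (induction L) auto

lemma length_filter_conj:
  "length (filter P L) + length (filter Q L) \<le> length (filter (\<lambda>x. P x \<and> Q x) L) + length L"
  by (induction L) auto

lemma pairing_length:
  assumes s: "splits (map (\<lambda>l. (slope l, 1)) L) (length L / 2) s"
  shows "length L \<le> 2 * length (pairing s L)"
proof -
  have "length (filter (\<lambda>l. slope l < s) L) + length (filter (\<lambda>l. s < slope l) L) +
      length (filter (\<lambda>l. slope l = s) L) = length L" by (induction L) auto
  moreover have "length (filter (\<lambda>l. slope l \<le> s) L) =
      length (filter (\<lambda>l. slope l < s) L) + length (filter (\<lambda>l. slope l = s) L)" by (induction L) auto
  moreover have "length (pairing s L) =
      min (length (filter (\<lambda>l. slope l < s) L)) (length (filter (\<lambda>l. s < slope l) L)) +
      length (filter (\<lambda>l. slope l = s) L)" by (simp add: pairing_def)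
  ultimately show ?thesis using splits_unit[OF s] by linarith
qed

text \<open>Let \<open>sx = 1\<close>. If \<open>sy = 1\<close>, the first lines of height at most
  \<open>h\<close> go, one in at least a quarter of the pairs. If \<open>sy = - 1\<close>, at least
  half of the pairs cross at or left of \<open>x0\<close>, so that their second line is the upper
  one there, and at most a quarter have their first line below \<open>h\<close>; in the remaining
  quarter the second line has height at least \<open>h\<close> and goes. Rank one quarter balances
  the two cases. For \<open>sx = - 1\<close> the lines of a pair swap roles.\<close>

lemma prunes_one_eighth:
  assumes s: "splits (map (\<lambda>l. (slope l, 1)) L) (length L / 2) s"
    and x0: "splits (map (\<lambda>x. (cross x, 1)) (pairing s L)) (length (pairing s L) / 2) x0"
    and sx: "sx = 1 \<or> sx = - 1" and sy: "sy = 1 \<or> sy = - 1"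
    and h: "splits (map (\<lambda>x. (height x0 (if 0 < sx then fst x else snd x), 1)) (pairing s L))
      (length (pairing s L) / 4) h"
  shows "8 * length (filter (\<lambda>l. \<not> prunable sx sy s x0 h l) L) \<le> 7 * length L"
proof -
  let ?N = "length (pairing s L)"
  let ?p = "prunable sx sy s x0 h"
  let ?z = "\<lambda>x. height x0 (if 0 < sx then fst x else snd x)"
  note N = pairing_length[OF s] and x0 = splits_unit[OF x0] and h = splits_unit[OF h]
  define good where "good = (\<lambda>x. if 0 < sx then cross x \<le> x0 else x0 \<le> cross x)"
  have good: "?N \<le> 2 * length (filter good (pairing s L))"
  proof (cases "0 < sx")
    case True
    then show ?thesis using x0(2) by (simp add: good_def)
  next
    case False
    then have "length (filter good (pairing s L)) = length (filter (\<lambda>x. \<not> cross x < x0) (pairing s L))"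
      by (simp add: good_def not_less)
    then show ?thesis
      using x0(1) filter_less_add_filter_not[of "\<lambda>x. cross x < x0" "pairing s L"] by linarith
  qed
  have "?N \<le> 4 * length (filter ?p L)"
  proof (cases "0 < sy")
    case True
    have "length (filter (\<lambda>x. ?z x \<le> h) (pairing s L))
      \<le> length (filter (\<lambda>x. ?p (if 0 < sx then fst x else snd x)) (pairing s L))"
    proof (rule length_filter_mono)
      fix x assume x: "x \<in> set (pairing s L)" "?z x \<le> h"
      from x(1) have "slope (fst x) \<le> s" "s \<le> slope (snd x)"
        using pairing_slopes[of "fst x" "snd x" s L] by auto
      then show "?p (if 0 < sx then fst x else snd x)"
        using x sx sy True by (auto simp: prunable_def resid_def height_def split: if_splits)
    qed
    also have "\<dots> \<le> length (filter ?p L)"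
      using pairing_count[of ?p s L] by (cases "0 < sx") simp_all
    finally show ?thesis using h(2) by linarith
  next
    case False
    have "length (filter (\<lambda>x. good x \<and> \<not> ?z x < h) (pairing s L))
      \<le> length (filter (\<lambda>x. ?p (if 0 < sx then snd x else fst x)) (pairing s L))"
    proof (rule length_filter_mono)
      fix x assume x: "x \<in> set (pairing s L)" "good x \<and> \<not> ?z x < h"
      from x(1) have "slope (fst x) \<le> s" "s \<le> slope (snd x)"
        using pairing_slopes[of "fst x" "snd x" s L] by auto
      moreover have "h \<le> height x0 (if 0 < sx then snd x else fst x)"
        using x cross_height[of "fst x" "snd x" s L x0] by (auto simp: good_def split: if_splits)
      ultimately show "?p (if 0 < sx then snd x else fst x)"
        using sx sy False by (auto simp: prunable_def resid_def height_def)
    qed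
    also have "\<dots> \<le> length (filter ?p L)"
      using pairing_count[of ?p s L] by (cases "0 < sx") simp_all
    finally show ?thesis
      using h(1) good filter_less_add_filter_not[of "\<lambda>x. ?z x < h" "pairing s L"]
        length_filter_conj[of good "pairing s L" "\<lambda>x. \<not> ?z x < h"] by linarith
  qed
  then show ?thesis
    using N filter_less_add_filter_not[of ?p L] by linarith
qed

section \<open>Linear time selection with ninthers as pivots\<close>

subsection \<open>The selection program\<close>

abbreviation (input) "iSLo \<equiv> (2::nat)"
abbreviation (input) "iSHi \<equiv> (3::nat)"
abbreviation (input) "iSEnd \<equiv> (4::nat)"
abbreviation (input) "iS \<equiv> (5::nat)"
abbreviation (input) "iSNine \<equiv> (6::nat)"
abbreviation (input) "iSDepth \<equiv> (7::nat)"

abbreviation (input) "rThr \<equiv> (2::nat)"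
abbreviation (input) "rRes \<equiv> (3::nat)"
abbreviation (input) "rPiv \<equiv> (4::nat)"
abbreviation (input) "rKey \<equiv> (5::nat)"
abbreviation (input) "rWgt \<equiv> (6::nat)"
abbreviation (input) "rLess \<equiv> (7::nat)"
abbreviation (input) "rLe \<equiv> (8::nat)"
abbreviation (input) "rOne \<equiv> (9::nat)"
abbreviation (input) "rHalf \<equiv> (23::nat)"

abbreviation (input) "aKey \<equiv> (3::nat)"
abbreviation (input) "aWgt \<equiv> (4::nat)"
abbreviation (input) "aThr \<equiv> (5::nat)"
abbreviation (input) "aSLo \<equiv> (0::nat)"
abbreviation (input) "aSHi \<equiv> (1::nat)"

definition med3_code :: "nat \<Rightarrow> nat \<Rightarrow> nat \<Rightarrow> nat \<Rightarrow> com" where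
  "med3_code a b c m =
     Cond (RLess b a)
       (Cond (RLess c b) (Do (RMove m b)) (Cond (RLess c a) (Do (RMove m c)) (Do (RMove m a))))
       (Cond (RLess c a) (Do (RMove m a)) (Cond (RLess c b) (Do (RMove m c)) (Do (RMove m b))))"

lemma run_med3 [simp]: "run (med3_code a b c m) s =
    s\<lparr>rreg := (rreg s)(m := med3 (rreg s a) (rreg s b) (rreg s c))\<rparr>"
  by (simp add: med3_code_def med3_def)

lemma med3_code_simps [simp]:
  "simple (med3_code a b c m)" "cost (med3_code a b c m) = 4" "writes T (med3_code a b c m) = {RReg m}"
  by (simp_all add: med3_code_def)

text \<open>\<open>iSNine\<close> points at the last element of the next group, so one comparison
  decides whether nine elements are left; an incomplete group is ignored. Half the number of groups
  is accumulated as a real because indices cannot be converted to reals.\<close>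

definition med_body :: com where
  "med_body = seq
     [block [RLoad 10 aKey iS, IInc iS, RLoad 11 aKey iS, IInc iS, RLoad 12 aKey iS, IInc iS,
        RLoad 13 aKey iS, IInc iS, RLoad 14 aKey iS, IInc iS, RLoad 15 aKey iS, IInc iS,
        RLoad 16 aKey iS, IInc iS, RLoad 17 aKey iS, IInc iS, RLoad 18 aKey iS, IInc iS],
      med3_code 10 11 12 19, med3_code 13 14 15 20, med3_code 16 17 18 21, med3_code 19 20 21 22,
      block [RStore aKey iSEnd 22, RStore aWgt iSEnd rOne, IInc iSEnd, RAdd rLess rLess rHalf,
        IInc iSNine, IInc iSNine, IInc iSNine, IInc iSNine, IInc iSNine, IInc iSNine, IInc iSNine,
        IInc iSNine, IInc iSNine]]"

definition med_init :: com where
  "med_init = block [IMove iS iSLo, IMove iSEnd iSHi, RSet rOne 1, RSet rLess 0, RSet rHalf 2,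
     RDiv rHalf rOne rHalf, IMove iSNine iS,
     IInc iSNine, IInc iSNine, IInc iSNine, IInc iSNine, IInc iSNine, IInc iSNine, IInc iSNine,
     IInc iSNine]"

text \<open>\<open>rLess\<close> serves as the threshold for the recursive call: half the number of groups.\<close>

definition push_sel :: com where
  "push_sel = block [IStore aSLo iSDepth iSLo, IStore aSHi iSDepth iSHi, RStore aThr iSDepth rThr,
     IInc iSDepth, IMove iSLo iSHi, IMove iSHi iSEnd, RMove rThr rLess]"

definition pop_sel :: com where
  "pop_sel = block [IDec iSDepth, ILoad iSLo aSLo iSDepth, ILoad iSHi aSHi iSDepth,
     RLoad rThr aThr iSDepth, RMove rPiv rRes]"

definition less_init :: com where
  "less_init = block [IMove iSEnd iSHi, RSet rLess 0, RSet rLe 0]"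

definition less_body :: com where
  "less_body = seq [Do (RLoad rKey aKey iS), Do (RLoad rWgt aWgt iS),
     Cond (RLess rKey rPiv)
       (block [RStore aKey iSEnd rKey, RStore aWgt iSEnd rWgt, IInc iSEnd, RAdd rLess rLess rWgt,
          RAdd rLe rLe rWgt])
       (Cond (RLess rPiv rKey) Skip (Do (RAdd rLe rLe rWgt)))]"

definition greater_body :: com where
  "greater_body = seq [Do (RLoad rKey aKey iS), Do (RLoad rWgt aWgt iS),
     Cond (RLess rPiv rKey)
       (block [RStore aKey iSEnd rKey, RStore aWgt iSEnd rWgt, IInc iSEnd]) Skip]"

definition sel_pivot :: com where
  "sel_pivot = seq [med_init, While (ILess iSNine iSHi) med_body,
     Cond (ILess iSHi iSEnd)
       (seq [push_sel, Call 1, pop_sel])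
       (Do (RLoad rPiv aKey iSLo))]"

text \<open>These calls come last in \<open>sel_code\<close>, so nothing is saved for them; only the
  pivot computation uses the stack.\<close>

definition sel_branch :: com where
  "sel_branch = Cond (RLess rThr rLess)
     (seq [block [IMove iSLo iSHi, IMove iSHi iSEnd], Call 1])
     (Cond (RLess rLe rThr)
       (seq [Do (IMove iSEnd iSHi), for_range iS iSLo iSHi greater_body,
          block [RSub rThr rThr rLe, IMove iSLo iSHi, IMove iSHi iSEnd], Call 1])
       (Do (RMove rRes rPiv)))"

definition sel_code :: com where
  "sel_code = Cond (ILess iSLo iSHi)
     (seq [sel_pivot, less_init, for_range iS iSLo iSHi less_body, sel_branch]) Skip"

definition items :: "state \<Rightarrow> nat \<Rightarrow> nat \<Rightarrow> (real \<times> real) list" where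
  "items s a b = map (\<lambda>i. (rarr s aKey i, rarr s aWgt i)) [a..<b]"

abbreviation (input) active_items :: "state \<Rightarrow> (real \<times> real) list" where
  "active_items s \<equiv> items s (ireg s iSLo) (ireg s iSHi)"

abbreviation (input) active_size :: "state \<Rightarrow> nat" where
  "active_size s \<equiv> ireg s iSHi - ireg s iSLo"

lemma items_upt_Suc: "a \<le> b \<Longrightarrow> items s a (Suc b) = items s a b @ [(rarr s aKey b, rarr s aWgt b)]"
  by (simp add: items_def)

lemma items_cong:
  "(\<And>i. a \<le> i \<Longrightarrow> i < b \<Longrightarrow> rarr s aKey i = rarr s' aKey i \<and> rarr s aWgt i = rarr s' aWgt i) \<Longrightarrow>
    items s a b = items s' a b"
  by (auto simp: items_def)

lemma length_items [simp]: "length (items s a b) = b - a"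
  by (simp add: items_def)

text \<open>Segments lie one behind another: a call writes copies only from its \<open>iSHi\<close>
  on, and its callees work further to the right. Cells below \<open>iSHi\<close> are therefore safe
  for every pending call.\<close>

definition same_below :: "nat \<Rightarrow> state \<Rightarrow> state \<Rightarrow> bool" where
  "same_below h s s' \<longleftrightarrow> (\<forall>i<h. rarr s' aKey i = rarr s aKey i \<and> rarr s' aWgt i = rarr s aWgt i)"

definition sel_stack_below :: "nat \<Rightarrow> state \<Rightarrow> state \<Rightarrow> bool" where
  "sel_stack_below d s s' \<longleftrightarrow> (\<forall>i<d. iarr s' aSLo i = iarr s aSLo i \<and> iarr s' aSHi i = iarr s aSHi i \<and>
     rarr s' aThr i = rarr s aThr i)"

definition sel_writes :: "loc set" where
  "sel_writes = IReg ` {2..7} \<union> RReg ` {2..23} \<union> IArr ` {0, 1} \<union> RArr ` {3..5}"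

text \<open>Only selection gets a proper footprint. The others may write anything, which makes the
  closure premise of \<open>exec_frame\<close> trivial for them.\<close>

definition callees :: "nat \<Rightarrow> loc set" where
  "callees i = (if i = 1 then sel_writes else UNIV)"

lemma writes_sel_code: "writes callees sel_code \<subseteq> sel_writes"
  by (auto simp: sel_code_def sel_pivot_def sel_branch_def med_init_def med_body_def push_sel_def
      pop_sel_def less_init_def less_body_def greater_body_def for_range_def callees_def sel_writes_def)

lemma exec_less_loop:
  assumes le: "ireg s iSLo \<le> ireg s iSHi" and e: "ireg s iSEnd = ireg s iSHi"
    and z: "rreg s rLess = 0" "rreg s rLe = 0"
  obtains k s' where "exec P (for_range iS iSLo iSHi less_body) s k s'"
    "k \<le> (active_size s) * 20 + 2"
    "frame (insert (IReg iS) (writes T less_body)) s s'"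
    "same_below (ireg s iSHi) s s'"
    "ireg s iSHi \<le> ireg s' iSEnd"
    "items s' (ireg s iSHi) (ireg s' iSEnd) =
       filter (\<lambda>x. fst x < rreg s rPiv) (active_items s)"
    "rreg s' rLess = below (active_items s) (rreg s rPiv)"
    "rreg s' rLe = atmost (active_items s) (rreg s rPiv)"
proof -
  let ?h = "ireg s iSHi" and ?l = "ireg s iSLo" and ?p = "rreg s rPiv"
  define I where "I = (\<lambda>j s'. same_below ?h s s' \<and> ?h \<le> ireg s' iSEnd \<and>
    items s' ?h (ireg s' iSEnd) = filter (\<lambda>x. fst x < ?p) (items s ?l j) \<and>
    rreg s' rLess = below (items s ?l j) ?p \<and> rreg s' rLe = atmost (items s ?l j) ?p)"
  obtain k s' where *: "exec P (for_range iS iSLo iSHi less_body) s k s'"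
    "k \<le> (?h - ?l) * (18 + 2) + 2" "I ?h s'"
    "frame (insert (IReg iS) (writes T less_body)) s s'"
  proof (rule exec_for_range[of less_body iS T iSHi s iSLo 18 I P])
    show "I ?l (with_index iS ?l s)"
      using e z by (simp add: I_def same_below_def items_def below_def atmost_def)
  next
    fix j s'
    assume I: "I j s'" and fr: "frame (insert (IReg iS) (writes T less_body)) s s'"
      and i: "ireg s' iS = j" and j: "?l \<le> j" "j < ?h"
    have p: "rreg s' rPiv = ?p" using fr by (simp add: frame_def less_body_def)
    have kw: "rarr s' aKey j = rarr s aKey j" "rarr s' aWgt j = rarr s aWgt j"
      using I j by (auto simp: I_def same_below_def)
    let ?k = "rarr s aKey j" and ?w = "rarr s aWgt j" and ?e = "ireg s' iSEnd"
    have up: "items s ?l (Suc j) = items s ?l j @ [(?k, ?w)]" using j by (simp add: items_upt_Suc)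
    let ?s = "with_index iS (Suc j) (run less_body s')"
    consider "?k < ?p" | "?k = ?p" | "?p < ?k" by linarith
    then show "I (Suc j) ?s"
    proof cases
      case 1
      have "items ?s ?h ?e = items s' ?h ?e"
        by (rule items_cong) (use 1 in \<open>simp add: less_body_def p kw i\<close>)
      then have "items ?s ?h (Suc ?e) = items s' ?h ?e @ [(?k, ?w)]"
        using 1 I by (simp add: I_def items_upt_Suc less_body_def p kw i)
      then show ?thesis
        using 1 I by (simp add: I_def less_body_def p kw i same_below_def up below_def atmost_def)
    next
      case 2
      have "items ?s ?h ?e = items s' ?h ?e"
        by (rule items_cong) (use 2 in \<open>simp add: less_body_def p kw i\<close>)
      then show ?thesis
        using 2 I by (simp add: I_def less_body_def p kw i same_below_def up below_def atmost_def)
    next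
      case 3
      have "items ?s ?h ?e = items s' ?h ?e"
        by (rule items_cong) (use 3 in \<open>simp add: less_body_def p kw i\<close>)
      then show ?thesis
        using 3 I by (simp add: I_def less_body_def p kw i same_below_def up below_def atmost_def)
    qed
  qed (use le in \<open>simp_all add: less_body_def\<close>)
  with * that show ?thesis by (auto simp: I_def)
qed

lemma exec_greater_loop:
  assumes le: "ireg s iSLo \<le> ireg s iSHi" and e: "ireg s iSEnd = ireg s iSHi"
  obtains k s' where "exec P (for_range iS iSLo iSHi greater_body) s k s'"
    "k \<le> (active_size s) * 20 + 2"
    "frame (insert (IReg iS) (writes T greater_body)) s s'"
    "same_below (ireg s iSHi) s s'"
    "ireg s iSHi \<le> ireg s' iSEnd"
    "items s' (ireg s iSHi) (ireg s' iSEnd) =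
       filter (\<lambda>x. rreg s rPiv < fst x) (active_items s)"
proof -
  let ?h = "ireg s iSHi" and ?l = "ireg s iSLo" and ?p = "rreg s rPiv"
  define I where "I = (\<lambda>j s'. same_below ?h s s' \<and> ?h \<le> ireg s' iSEnd \<and>
    items s' ?h (ireg s' iSEnd) = filter (\<lambda>x. ?p < fst x) (items s ?l j))"
  obtain k s' where *: "exec P (for_range iS iSLo iSHi greater_body) s k s'"
    "k \<le> (?h - ?l) * (18 + 2) + 2" "I ?h s'"
    "frame (insert (IReg iS) (writes T greater_body)) s s'"
  proof (rule exec_for_range[of greater_body iS T iSHi s iSLo 18 I P])
    show "I ?l (with_index iS ?l s)"
      using e by (simp add: I_def same_below_def items_def)
  next
    fix j s'
    assume I: "I j s'" and fr: "frame (insert (IReg iS) (writes T greater_body)) s s'"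
      and i: "ireg s' iS = j" and j: "?l \<le> j" "j < ?h"
    have p: "rreg s' rPiv = ?p" using fr by (simp add: frame_def greater_body_def)
    have kw: "rarr s' aKey j = rarr s aKey j" "rarr s' aWgt j = rarr s aWgt j"
      using I j by (auto simp: I_def same_below_def)
    let ?k = "rarr s aKey j" and ?w = "rarr s aWgt j" and ?e = "ireg s' iSEnd"
    have up: "items s ?l (Suc j) = items s ?l j @ [(?k, ?w)]" using j by (simp add: items_upt_Suc)
    let ?s = "with_index iS (Suc j) (run greater_body s')"
    have it: "items ?s ?h ?e = items s' ?h ?e"
      by (rule items_cong) (simp add: greater_body_def p kw i)
    show "I (Suc j) ?s"
    proof (cases "?p < ?k")
      case True
      then have "items ?s ?h (Suc ?e) = items s' ?h ?e @ [(?k, ?w)]"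
        using it I by (simp add: I_def items_upt_Suc greater_body_def p kw i)
      then show ?thesis
        using True I by (simp add: I_def greater_body_def p kw i same_below_def up)
    next
      case False
      then show ?thesis
        using it I by (simp add: I_def greater_body_def p kw i same_below_def up)
    qed
  qed (use le in \<open>simp_all add: greater_body_def\<close>)
  with * that show ?thesis by (auto simp: I_def)
qed

lemma exec_med_loop:
  assumes le: "ireg s0 iSLo \<le> ireg s0 iSHi"
  obtains k s' g where "exec P (While (ILess iSNine iSHi) med_body) (run med_init s0) k s'"
    "k \<le> (active_size s0) * 50 + 1"
    "9 * g \<le> active_size s0" "active_size s0 < 9 * g + 9"
    "same_below (ireg s0 iSHi) (run med_init s0) s'" "ireg s' iSEnd = ireg s0 iSHi + g"
    "rreg s' rLess = real g / 2"
    "items s' (ireg s0 iSHi) (ireg s0 iSHi + g) =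
       map (\<lambda>j. (ninther (rarr s0 aKey) (ireg s0 iSLo + 9 * j), 1)) [0..<g]"
proof -
  define s n h l where defs: "s = run med_init s0" "n = active_size s0"
    "h = ireg s0 iSHi" "l = ireg s0 iSLo"
  note s_def = defs(1) and n_def = defs(2) and h_def = defs(3) and l_def = defs(4)
  define g where "g = n div 9"
  define f where "f = rarr s0 aKey"
  have g: "9 * g \<le> n" "n < 9 * g + 9" by (simp_all add: g_def) 
  define I where "I = (\<lambda>j s'. same_below h s s' \<and> ireg s' iSEnd = h + j \<and>
    ireg s' iS = l + 9 * j \<and> ireg s' iSNine = l + 9 * j + 8 \<and> ireg s' iSHi = h \<and>
    rreg s' rOne = 1 \<and> rreg s' rHalf = 1 / 2 \<and> rreg s' rLess = real j / 2 \<and>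
    items s' h (h + j) = map (\<lambda>j. (ninther f (l + 9 * j), 1)) [0..<j])"
  obtain k s' where *: "exec P (While (ILess iSNine iSHi) med_body) s k s'"
    "k \<le> g * (cost med_body + 1) + 1" "I g s'"
  proof (rule exec_while[of I s g _ P _ "cost med_body"])
    show "I 0 s"
      by (simp add: I_def same_below_def items_def s_def med_init_def h_def l_def)
  next
    fix j s' assume "I j s'" "j \<le> g"
    then show "holds (ILess iSNine iSHi) s' \<longleftrightarrow> j < g"
      using g le by (auto simp: I_def n_def h_def l_def)
  next
    fix j s' assume I: "I j s'" and j: "j < g"
    have simple: "simple med_body" by (simp add: med_body_def)
    obtain k where k: "exec P med_body s' k (run med_body s')" "k \<le> cost med_body"
      using exec_simple[OF simple] by blast
    define a where "a = l + 9 * j"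
    have "a + 8 < h" using j g le by (auto simp: n_def h_def l_def a_def)
    then have f: "rarr s' aKey (a + i) = f (a + i)" if "i \<le> 8" for i
      using I that by (auto simp: I_def same_below_def f_def s_def med_init_def)
    have "ireg s' iS = a" "ireg s' iSEnd = h + j" using I by (auto simp: I_def a_def)
    then have nin: "rarr (run med_body s') aKey = (rarr s' aKey)(h + j := ninther f a)"
      using f[of 0] f[of 1] f[of 2] f[of 3] f[of 4] f[of 5] f[of 6] f[of 7] f[of 8]
      by (simp add: med_body_def ninther_def) (simp add: eval_nat_numeral)
    have wgt: "rarr (run med_body s') aWgt = (rarr s' aWgt)(h + j := 1)"
      using I by (simp add: I_def med_body_def)
    have "items (run med_body s') h (h + j) = items s' h (h + j)"
      by (rule items_cong) (simp add: nin wgt)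
    then have "items (run med_body s') h (h + Suc j) =
        map (\<lambda>j. (ninther f (l + 9 * j), 1)) [0..<Suc j]"
      using I by (simp add: items_upt_Suc nin wgt I_def a_def)
    moreover have "same_below h s (run med_body s')"
      using I by (auto simp: I_def same_below_def nin wgt)
    ultimately have "I (Suc j) (run med_body s')"
      using I by (simp add: I_def) (simp add: med_body_def add_divide_distrib)
    then show "\<exists>k s''. exec P med_body s' k s'' \<and> k \<le> cost med_body \<and> I (Suc j) s''"
      using k by blast
  qed
  \<comment> \<open>A round is charged to the nine elements it consumes.\<close>
  have "cost med_body + 1 \<le> 50 * 9" by (simp add: med_body_def)
  then have "g * (cost med_body + 1) \<le> g * (50 * 9)" by (rule mult_le_mono2)
  also have "\<dots> \<le> n * 50" using g by simp
  finally have "k \<le> n * 50 + 1" using *(2) by simp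
  with that[folded defs(1), folded defs(2), folded defs(3,4)] *(1,3) g show ?thesis by (auto simp: I_def f_def)
qed


locale sel_program =
  fixes P :: program
  assumes length_P: "1 < length P" and P_1: "P ! 1 = sel_code"
begin

lemma exec_frame_P: "exec P c s k s' \<Longrightarrow> frame (writes callees c) s s'"
proof (rule exec_frame)
  fix i assume "i < length P"
  show "writes callees (P ! i) \<subseteq> callees i"
    using writes_sel_code P_1 by (cases "i = 1") (simp_all add: callees_def)
qed

text \<open>Time and preserved cells are claimed without any condition on the threshold, since a
  query of an unbounded problem may ask for a rank out of range; only the statement on ranks then
  becomes void.\<close>

definition sel_post :: "state \<Rightarrow> nat \<Rightarrow> state \<Rightarrow> bool" where
  "sel_post s k s' \<longleftrightarrow> k \<le> 2000 * (active_size s) + 10 \<and>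
     same_below (ireg s iSHi) s s' \<and> sel_stack_below (ireg s iSDepth) s s' \<and>
     ireg s' iSDepth = ireg s iSDepth \<and>
     (ireg s iSLo < ireg s iSHi \<longrightarrow> 0 \<le> rreg s rThr \<longrightarrow>
       rreg s rThr \<le> weight_sum (active_items s) \<longrightarrow>
       splits (active_items s) (rreg s rThr) (rreg s' rRes))"

text \<open>The induction hypothesis of \<open>exec_sel\<close> is passed in as \<open>IH\<close>.
  The ninthers form a new segment directly behind the current one, and \<open>2010 * g\<close>
  covers the recursive call on them.\<close>

lemma exec_sel_pivot:
  assumes lt: "ireg s iSLo < ireg s iSHi"
    and IH: "\<And>s'. active_size s' < active_size s \<Longrightarrow>
      \<exists>k s''. exec P (Call 1) s' k s'' \<and> sel_post s' k s''"
  obtains k s' g where "exec P sel_pivot s k s'"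
    "k \<le> 50 * (active_size s) + 2010 * g + 80"
    "active_size s < 9 * g + 9"
    "rreg s' rPiv \<in> fst ` set (active_items s)"
    "0 < g \<longrightarrow> length (filter (\<lambda>x. fst x < rreg s' rPiv) (active_items s)) + 2 * g
      \<le> active_size s"
    "0 < g \<longrightarrow> length (filter (\<lambda>x. rreg s' rPiv < fst x) (active_items s)) + 2 * g
      \<le> active_size s"
    "same_below (ireg s iSHi) s s'" "sel_stack_below (ireg s iSDepth) s s'"
    "ireg s' iSDepth = ireg s iSDepth" "ireg s' iSLo = ireg s iSLo" "ireg s' iSHi = ireg s iSHi"
    "rreg s' rThr = rreg s rThr"
proof -
  let ?h = "ireg s iSHi" and ?l = "ireg s iSLo" and ?d = "ireg s iSDepth"
  define s1 where "s1 = run med_init s"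
  have "simple med_init" "cost med_init \<le> 20" by (simp_all add: med_init_def)
  then obtain k1 where 1: "exec P med_init s k1 s1" "k1 \<le> 20" unfolding s1_def by (rule exec_simple_le)
  obtain k2 s2 g where 2: "exec P (While (ILess iSNine iSHi) med_body) s1 k2 s2"
    "k2 \<le> (?h - ?l) * 50 + 1" and g: "9 * g \<le> ?h - ?l" "?h - ?l < 9 * g + 9"
    and s2: "same_below ?h s1 s2" "ireg s2 iSEnd = ?h + g" "rreg s2 rLess = real g / 2"
    "items s2 ?h (?h + g) = map (\<lambda>j. (ninther (rarr s aKey) (?l + 9 * j), 1)) [0..<g]"
    unfolding s1_def by (rule exec_med_loop[OF less_imp_le[OF lt]])
  have s2f: "ireg s2 iSHi = ?h" "ireg s2 iSLo = ?l" "ireg s2 iSDepth = ?d" "rreg s2 rThr = rreg s rThr"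
    "iarr s2 = iarr s" "rarr s2 aThr = rarr s aThr"
    using exec_frame_P[OF 2(1)] by (auto simp: frame_def med_body_def s1_def med_init_def)
  have s2b: "same_below ?h s s2" using s2(1) by (simp add: same_below_def s1_def med_init_def)
  have it: "length (filter Q (items s ?l ?h)) = length (filter (\<lambda>i. Q (rarr s aKey i, rarr s aWgt i)) [?l..<?h])" for Q
    by (simp add: items_def filter_map o_def)
  show ?thesis
  \<comment> \<open>With fewer than nine elements there is no group, and the first key serves as
    pivot.\<close>
  proof (cases "g = 0")
    case True
    define s3 where "s3 = step (RLoad rPiv aKey iSLo) s2"
    have "exec P (Do (RLoad rPiv aKey iSLo)) s2 1 s3" unfolding s3_def by (rule exec.Do)
    then have "exec P (Cond (ILess iSHi iSEnd) (seq [push_sel, Call 1, pop_sel])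
        (Do (RLoad rPiv aKey iSLo))) s2 (1 + 1) s3"
      using True s2 s2f by (intro exec.CondFalse) auto
    from exec.Seq[OF 1(1) exec.Seq[OF 2(1) this]] have "exec P sel_pivot s (k1 + (k2 + (1 + 1))) s3"
      by (simp add: sel_pivot_def)
    moreover have "rreg s3 rPiv = rarr s aKey ?l"
      using s2b s2f lt by (simp add: s3_def same_below_def)
    then have "rreg s3 rPiv \<in> fst ` set (items s ?l ?h)"
      using lt by (auto simp: items_def image_image)
    ultimately show ?thesis
      using 1 2 g True s2b s2f by (intro that[of _ s3 g])
        (auto simp: s3_def same_below_def sel_stack_below_def)
  next
    case False
    define s3 where "s3 = run push_sel s2"
    have "simple push_sel" "cost push_sel \<le> 10" by (simp_all add: push_sel_def)
    then obtain k3 where 3: "exec P push_sel s2 k3 s3" "k3 \<le> 10" unfolding s3_def by (rule exec_simple_le)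
    have s3: "ireg s3 iSLo = ?h" "ireg s3 iSHi = ?h + g" "ireg s3 iSDepth = Suc ?d"
      "iarr s3 aSLo ?d = ?l" "iarr s3 aSHi ?d = ?h" "rarr s3 aThr ?d = rreg s rThr"
      "rreg s3 rThr = real g / 2" "sel_stack_below ?d s s3"
      "rarr s3 aKey = rarr s2 aKey" "rarr s3 aWgt = rarr s2 aWgt"
      using s2 s2f by (auto simp: s3_def push_sel_def sel_stack_below_def)
    obtain k4 s4 where 4: "exec P (Call 1) s3 k4 s4" "sel_post s3 k4 s4"
      using IH[of s3] s3 g False by auto
    have s4: "same_below (?h + g) s3 s4" "sel_stack_below (Suc ?d) s3 s4" "ireg s4 iSDepth = Suc ?d"
      using 4(2) s3 by (auto simp: sel_post_def)
    have "items s3 ?h (?h + g) = items s2 ?h (?h + g)" by (rule items_cong) (simp add: s3)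
    then have its: "items s3 ?h (?h + g) = map (\<lambda>j. (ninther (rarr s aKey) (?l + 9 * j), 1)) [0..<g]"
      using s2 by simp
    have "weight_sum (items s3 ?h (?h + g)) = real g" unfolding its by (subst weight_sum_eq_length) auto
    then have sp: "splits (map (\<lambda>j. (ninther (rarr s aKey) (?l + 9 * j), 1)) [0..<g]) (real g / 2) (rreg s4 rRes)"
      using 4(2) s3 False its by (simp add: sel_post_def)
    define s5 where "s5 = run pop_sel s4"
    have "simple pop_sel" "cost pop_sel \<le> 10" by (simp_all add: pop_sel_def)
    then obtain k5 where 5: "exec P pop_sel s4 k5 s5" "k5 \<le> 10" unfolding s5_def by (rule exec_simple_le)
    have s5: "ireg s5 iSLo = ?l" "ireg s5 iSHi = ?h" "ireg s5 iSDepth = ?d" "rreg s5 rThr = rreg s rThr"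
      "rreg s5 rPiv = rreg s4 rRes" "rarr s5 = rarr s4" "iarr s5 = iarr s4"
      using s4 s3 by (auto simp: s5_def pop_sel_def sel_stack_below_def)
    from exec.Seq[OF 3(1) exec.Seq[OF 4(1) 5(1)]]
    have "exec P (Cond (ILess iSHi iSEnd) (seq [push_sel, Call 1, pop_sel])
        (Do (RLoad rPiv aKey iSLo))) s2 (k3 + (k4 + k5) + 1) s5"
      using False s2 s2f by (intro exec.CondTrue) auto
    from exec.Seq[OF 1(1) exec.Seq[OF 2(1) this]]
    have "exec P sel_pivot s (k1 + (k2 + (k3 + (k4 + k5) + 1))) s5"
      by (simp add: sel_pivot_def)
    moreover have "k4 \<le> 2000 * g + 10" using 4(2) s3 by (simp add: sel_post_def)
    then have "k1 + (k2 + (k3 + (k4 + k5) + 1)) \<le> 50 * (?h - ?l) + 2010 * g + 80"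
      using 1 2 3 5 by simp
    moreover have "same_below ?h s s5"
      using s2b s3 s4 s5 by (auto simp: same_below_def)
    moreover have "sel_stack_below ?d s s5"
      using s3 s4 s5 by (auto simp: sel_stack_below_def)
    moreover have lg: "?l + 9 * g \<le> ?h" using g lt by simp
    note pivot_quality[OF this sp]
    moreover have "rreg s5 rPiv \<in> fst ` set (items s ?l ?h)"
    proof -
      obtain j where "j < g" "rreg s5 rPiv = ninther (rarr s aKey) (?l + 9 * j)"
        using sp s5 by (auto simp: splits_def)
      moreover have sub: "{?l + 9 * j..<?l + 9 * j + 9} \<subseteq> {?l..<?h}" using lg \<open>j < g\<close> by auto
      ultimately have "rreg s5 rPiv \<in> rarr s aKey ` {?l..<?h}"
        using subsetD[OF image_mono[OF sub] ninther_in[of "rarr s aKey" "?l + 9 * j"]] by simp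
      then show ?thesis by (simp add: items_def image_image)
    qed
    ultimately show ?thesis
      using that[of _ s5 g] g s5 False by (simp add: it)
  qed
qed

lemma exec_sel: "\<exists>k s'. exec P (Call 1) s k s' \<and> sel_post s k s'"
proof (induction "active_size s" arbitrary: s rule: less_induct)
  case less
  let ?h = "ireg s iSHi" and ?l = "ireg s iSLo" and ?d = "ireg s iSDepth"
  let ?n = "?h - ?l" and ?L = "items s ?l ?h" and ?\<theta> = "rreg s rThr"
  show ?case
  proof (cases "?l < ?h")
    case False
    have "exec P sel_code s (1 + 1) s"
      unfolding sel_code_def using False by (intro exec.CondFalse exec.Skip) auto
    then have "exec P (Call 1) s (1 + 1 + 1) s"
      using exec.Call[of 1 P s "1 + 1" s] length_P P_1 by simp
    then show ?thesis using False
      by (intro exI conjI) (auto simp: sel_post_def same_below_def sel_stack_below_def)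
  next
    case True
    obtain k1 s1 g where 1: "exec P sel_pivot s k1 s1" "k1 \<le> 50 * ?n + 2010 * g + 80"
      and g: "?n < 9 * g + 9" "rreg s1 rPiv \<in> fst ` set ?L"
      "0 < g \<longrightarrow> length (filter (\<lambda>x. fst x < rreg s1 rPiv) ?L) + 2 * g \<le> ?n"
      "0 < g \<longrightarrow> length (filter (\<lambda>x. rreg s1 rPiv < fst x) ?L) + 2 * g \<le> ?n"
      and s1: "same_below ?h s s1" "sel_stack_below ?d s s1"
      "ireg s1 iSDepth = ?d" "ireg s1 iSLo = ?l" "ireg s1 iSHi = ?h" "rreg s1 rThr = ?\<theta>"
      by (rule exec_sel_pivot[OF True less.hyps])
    define p where "p = rreg s1 rPiv"
    \<comment> \<open>The pivot is one of the keys and belongs to neither part; this gives strict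
      progress even if \<open>g = 0\<close>.\<close>
    have shrink: "length (filter (\<lambda>x. fst x < p) ?L) + 2 * g \<le> ?n \<and> length (filter (\<lambda>x. fst x < p) ?L) < ?n"
      "length (filter (\<lambda>x. p < fst x) ?L) + 2 * g \<le> ?n \<and> length (filter (\<lambda>x. p < fst x) ?L) < ?n"
    proof -
      obtain x where "x \<in> set ?L" "fst x = p" using g(2) by (auto simp: p_def)
      then have "length (filter (\<lambda>x. fst x < p) ?L) < length ?L"
        "length (filter (\<lambda>x. p < fst x) ?L) < length ?L"
        using length_filter_less[of x ?L "\<lambda>x. fst x < p"] length_filter_less[of x ?L "\<lambda>x. p < fst x"]
        by auto
      then show "length (filter (\<lambda>x. fst x < p) ?L) + 2 * g \<le> ?n \<and> length (filter (\<lambda>x. fst x < p) ?L) < ?n"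
        "length (filter (\<lambda>x. p < fst x) ?L) + 2 * g \<le> ?n \<and> length (filter (\<lambda>x. p < fst x) ?L) < ?n"
        using g by (cases "g = 0"; simp add: p_def)+
    qed
    \<comment> \<open>If \<open>g > 0\<close>, dropping \<open>2 * g\<close> elements frees
      \<open>4000 * g\<close> steps: about half of them pay for the pivot call, the rest for the
      linear work, as \<open>?n < 9 * g + 9\<close>. If \<open>g = 0\<close>, there are at most
      eight elements, and dropping one frees 2000 steps.\<close>
    have time: "50 * ?n + 2010 * g + 80 + 20 * ?n + 20 * ?n + 20 + (2000 * m + 10) \<le> 2000 * ?n + 10 - 4"
      if m: "m + 2 * g \<le> ?n \<and> m < ?n" for m
      using that g(1) by (cases "g = 0") linarith+
    define s2 where "s2 = run less_init s1"
    have "simple less_init" "cost less_init \<le> 3" by (simp_all add: less_init_def)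
    then obtain k2 where 2: "exec P less_init s1 k2 s2" "k2 \<le> 3" unfolding s2_def by (rule exec_simple_le)
    have s2: "ireg s2 iSLo = ?l" "ireg s2 iSHi = ?h" "ireg s2 iSEnd = ?h" "ireg s2 iSDepth = ?d"
      "rreg s2 rPiv = p" "rreg s2 rLess = 0" "rreg s2 rLe = 0" "rreg s2 rThr = ?\<theta>"
      "rarr s2 = rarr s1" "iarr s2 = iarr s1"
      using s1 by (auto simp: s2_def less_init_def p_def)
    have L2: "items s2 ?l ?h = ?L"
      by (rule items_cong) (use s2 s1 in \<open>auto simp: same_below_def\<close>)
    obtain k3 s3 where 3: "exec P (for_range iS iSLo iSHi less_body) s2 k3 s3" "k3 \<le> ?n * 20 + 2"
      and fr: "frame (insert (IReg iS) (writes callees less_body)) s2 s3"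
      and s3: "same_below ?h s2 s3" "?h \<le> ireg s3 iSEnd"
      "items s3 ?h (ireg s3 iSEnd) = filter (\<lambda>x. fst x < p) ?L"
      "rreg s3 rLess = below ?L p" "rreg s3 rLe = atmost ?L p"
      by (rule exec_less_loop[of s2 P callees, unfolded s2(1-8) L2, OF less_imp_le[OF True] refl refl refl])
    have s3f: "ireg s3 iSLo = ?l" "ireg s3 iSHi = ?h" "ireg s3 iSDepth = ?d" "rreg s3 rPiv = p"
      "rreg s3 rThr = ?\<theta>" "iarr s3 = iarr s1" "rarr s3 aThr = rarr s1 aThr"
      using fr s2 by (auto simp: frame_def less_body_def)
    have s3b: "same_below ?h s s3" "sel_stack_below ?d s s3"
      using s1 s2 s3 s3f by (auto simp: same_below_def sel_stack_below_def)
    have finish: ?thesis if b: "exec P sel_branch s3 k s'" "k \<le> 20 * ?n + 10 + 2000 * m + 10"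
        "m + 2 * g \<le> ?n \<and> m < ?n"
        and "same_below ?h s s'" "sel_stack_below ?d s s'" "ireg s' iSDepth = ?d"
        "0 \<le> ?\<theta> \<Longrightarrow> ?\<theta> \<le> weight_sum ?L \<Longrightarrow> splits ?L ?\<theta> (rreg s' rRes)" for k s' m
    proof -
      from exec.Seq[OF 1(1) exec.Seq[OF 2(1) exec.Seq[OF 3(1) b(1)]]]
      have "exec P sel_code s (k1 + (k2 + (k3 + k)) + 1) s'"
        unfolding sel_code_def using True by (intro exec.CondTrue) auto
      then have e: "exec P (Call 1) s (k1 + (k2 + (k3 + k)) + 1 + 1) s'"
        using exec.Call[of 1 P s] length_P P_1 by simp
      have "k1 + (k2 + (k3 + k)) + 1 + 1 \<le> 2000 * ?n + 10"
        using time[OF b(3)] 1 2 3 b(2) by linarith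
      then have "sel_post s (k1 + (k2 + (k3 + k)) + 1 + 1) s'"
        using that(4-7) unfolding sel_post_def by blast
      with e show ?thesis by blast
    qed
    consider "?\<theta> < below ?L p" | "\<not> ?\<theta> < below ?L p" "atmost ?L p < ?\<theta>" |
      "\<not> ?\<theta> < below ?L p" "\<not> atmost ?L p < ?\<theta>" by blast
    then show ?thesis
    proof cases
      case 1
      let ?blk = "block [IMove iSLo iSHi, IMove iSHi iSEnd]"
      define s4 where "s4 = run ?blk s3"
      have "simple ?blk" "cost ?blk \<le> 2" by simp_all
      then obtain k4 where 4: "exec P ?blk s3 k4 s4" "k4 \<le> 2"
        unfolding s4_def by (rule exec_simple_le)
      have s4: "ireg s4 iSLo = ?h" "ireg s4 iSHi = ireg s3 iSEnd" "ireg s4 iSDepth = ?d"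
        "rreg s4 = rreg s3" "rarr s4 = rarr s3" "iarr s4 = iarr s3"
        using s3f by (auto simp: s4_def)
      define m where "m = ireg s3 iSEnd - ?h"
      have m: "m = length (filter (\<lambda>x. fst x < p) ?L)"
        using arg_cong[OF s3(3), of length] by (simp add: m_def)
      have small: "active_size s4 < ?n" using s4 shrink m g(1) True by (simp add: m_def)
      obtain k5 s5 where 5: "exec P (Call 1) s4 k5 s5" "sel_post s4 k5 s5"
        using less.hyps[OF small] by blast
      have s5: "k5 \<le> 2000 * m + 10" "same_below (ireg s3 iSEnd) s3 s5" "sel_stack_below ?d s3 s5"
        "ireg s5 iSDepth = ?d"
        using 5(2) s4 by (auto simp: sel_post_def m_def same_below_def sel_stack_below_def)
      have it: "items s4 ?h (ireg s3 iSEnd) = filter (\<lambda>x. fst x < p) ?L"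
        using s3(3) s4 by (simp add: items_def)
      have "exec P sel_branch s3 (k4 + k5 + 1) s5"
        unfolding sel_branch_def using 1 s3 s3f exec.Seq[OF 4(1) 5(1)]
        by (intro exec.CondTrue) auto
      then show ?thesis
      proof (rule finish[where m = m])
        show "k4 + k5 + 1 \<le> 20 * ?n + 10 + 2000 * m + 10" using s5 4 by simp
        show "m + 2 * g \<le> ?n \<and> m < ?n" using shrink m by simp
        show "same_below ?h s s5" "sel_stack_below ?d s s5" "ireg s5 iSDepth = ?d"
          using s3(2) s3b s5 by (auto simp: same_below_def sel_stack_below_def)
        show "splits ?L ?\<theta> (rreg s5 rRes)" if "0 \<le> ?\<theta>" "?\<theta> \<le> weight_sum ?L"
        proof -
          have "0 < m"
          proof (rule ccontr)
            assume "\<not> 0 < m"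
            then have "filter (\<lambda>x. fst x < p) ?L = []" using m by (simp del: length_items)
            then have "weight_sum (filter (\<lambda>x. fst x < p) ?L) = 0" by (simp only: weight_sum_def) simp
            then have "below ?L p = 0" by (simp only: weight_sum_less)
            then show False using \<open>?\<theta> < below ?L p\<close> that(1) by linarith
          qed
          then have "?h < ireg s3 iSEnd" by (simp add: m_def)
          moreover have "?h < ireg s3 iSEnd \<longrightarrow> 0 \<le> ?\<theta> \<longrightarrow> ?\<theta> \<le> below ?L p \<longrightarrow>
              splits (filter (\<lambda>x. fst x < p) ?L) ?\<theta> (rreg s5 rRes)"
            using 5(2) unfolding sel_post_def s4 s3f it weight_sum_less by blast
          ultimately have "splits (filter (\<lambda>x. fst x < p) ?L) ?\<theta> (rreg s5 rRes)"
            using \<open>?\<theta> < below ?L p\<close> that(1) by simp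
          then show ?thesis by (rule splits_less)
        qed
      qed
    next
      case 2
      define s4 where "s4 = step (IMove iSEnd iSHi) s3"
      have 4: "exec P (Do (IMove iSEnd iSHi)) s3 1 s4" unfolding s4_def by (rule exec.Do)
      have s4: "ireg s4 iSLo = ?l" "ireg s4 iSHi = ?h" "ireg s4 iSEnd = ?h" "ireg s4 iSDepth = ?d"
        "rreg s4 = rreg s3" "rarr s4 = rarr s3" "iarr s4 = iarr s3"
        using s3f by (auto simp: s4_def)
      have L4: "items s4 ?l ?h = ?L"
        by (rule items_cong) (use s4 s3b in \<open>auto simp: same_below_def\<close>)
      obtain k5 s5 where 5: "exec P (for_range iS iSLo iSHi greater_body) s4 k5 s5" "k5 \<le> ?n * 20 + 2"
        and fr5: "frame (insert (IReg iS) (writes callees greater_body)) s4 s5"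
        and s5: "same_below ?h s4 s5" "?h \<le> ireg s5 iSEnd"
        "items s5 ?h (ireg s5 iSEnd) = filter (\<lambda>x. p < fst x) ?L"
        by (rule exec_greater_loop[of s4 P callees, unfolded s4 s3f(4) L4, OF less_imp_le[OF True] refl])
      have s5f: "ireg s5 iSLo = ?l" "ireg s5 iSHi = ?h" "ireg s5 iSDepth = ?d" "rreg s5 rLe = atmost ?L p"
        "rreg s5 rThr = ?\<theta>" "iarr s5 = iarr s3" "rarr s5 aThr = rarr s3 aThr"
        using fr5 s4 s3f s3 by (auto simp: frame_def greater_body_def)
      let ?blk = "block [RSub rThr rThr rLe, IMove iSLo iSHi, IMove iSHi iSEnd]"
      define s6 where "s6 = run ?blk s5"
      have "simple ?blk" "cost ?blk \<le> 3" by simp_all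
      then obtain k6 where 6: "exec P ?blk s5 k6 s6" "k6 \<le> 3"
        unfolding s6_def by (rule exec_simple_le)
      have s6: "ireg s6 iSLo = ?h" "ireg s6 iSHi = ireg s5 iSEnd" "ireg s6 iSDepth = ?d"
        "rreg s6 rThr = ?\<theta> - atmost ?L p" "rarr s6 = rarr s5" "iarr s6 = iarr s5"
        using s5f by (auto simp: s6_def)
      define m where "m = ireg s5 iSEnd - ?h"
      have m: "m = length (filter (\<lambda>x. p < fst x) ?L)"
        using arg_cong[OF s5(3), of length] by (simp add: m_def)
      have small: "active_size s6 < ?n" using s6 shrink m g(1) True by (simp add: m_def)
      obtain k7 s7 where 7: "exec P (Call 1) s6 k7 s7" "sel_post s6 k7 s7"
        using less.hyps[OF small] by blast
      have s7: "k7 \<le> 2000 * m + 10" "same_below (ireg s5 iSEnd) s5 s7" "sel_stack_below ?d s5 s7"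
        "ireg s7 iSDepth = ?d"
        using 7(2) s6 by (auto simp: sel_post_def m_def same_below_def sel_stack_below_def)
      have it: "items s6 ?h (ireg s5 iSEnd) = filter (\<lambda>x. p < fst x) ?L"
        using s5(3) s6 by (simp add: items_def)
      have "exec P sel_branch s3 (1 + (k5 + (k6 + k7)) + 1 + 1) s7"
        unfolding sel_branch_def
        using 2 s3 s3f exec.Seq[OF 4 exec.Seq[OF 5(1) exec.Seq[OF 6(1) 7(1)]]]
        by (intro exec.CondFalse exec.CondTrue) auto
      then show ?thesis
      proof (rule finish[where m = m])
        show "1 + (k5 + (k6 + k7)) + 1 + 1 \<le> 20 * ?n + 10 + 2000 * m + 10"
          using s7 5 6 by simp
        show "m + 2 * g \<le> ?n \<and> m < ?n" using shrink m by simp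
        show "same_below ?h s s7" "sel_stack_below ?d s s7" "ireg s7 iSDepth = ?d"
          using s3b s4 s5 s5f s7 by (auto simp: same_below_def sel_stack_below_def)
        show "splits ?L ?\<theta> (rreg s7 rRes)" if "0 \<le> ?\<theta>" "?\<theta> \<le> weight_sum ?L"
        proof -
          have "0 < m"
          proof (rule ccontr)
            assume "\<not> 0 < m"
            then have "filter (\<lambda>x. p < fst x) ?L = []" using m by (simp del: length_items)
            then have "weight_sum (filter (\<lambda>x. p < fst x) ?L) = 0" by (simp only: weight_sum_def) simp
            then have "weight_sum ?L = atmost ?L p" using weight_sum_greater[of ?L p] by simp
            then show False using \<open>atmost ?L p < ?\<theta>\<close> that(2) by linarith
          qed
          then have "?h < ireg s5 iSEnd" by (simp add: m_def)
          moreover have "?h < ireg s5 iSEnd \<longrightarrow> 0 \<le> ?\<theta> - atmost ?L p \<longrightarrow>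
              ?\<theta> - atmost ?L p \<le> weight_sum (filter (\<lambda>x. p < fst x) ?L) \<longrightarrow>
              splits (filter (\<lambda>x. p < fst x) ?L) (?\<theta> - atmost ?L p) (rreg s7 rRes)"
            using 7(2) unfolding sel_post_def s6 it by blast
          ultimately have "splits (filter (\<lambda>x. p < fst x) ?L) (?\<theta> - atmost ?L p) (rreg s7 rRes)"
            using \<open>atmost ?L p < ?\<theta>\<close> that(2) weight_sum_greater[of ?L p] by simp
          then show ?thesis by (rule splits_greater)
        qed
      qed
    next
      case 3
      define s4 where "s4 = step (RMove rRes rPiv) s3"
      have 4: "exec P (Do (RMove rRes rPiv)) s3 1 s4" unfolding s4_def by (rule exec.Do)
      have "exec P sel_branch s3 (1 + 1 + 1) s4"
        unfolding sel_branch_def using 3 s3 s3f 4 by (intro exec.CondFalse) auto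
      then show ?thesis
      proof (rule finish[where m = 0])
        show "0 + 2 * g \<le> ?n \<and> 0 < ?n" using shrink by linarith
        show "splits ?L ?\<theta> (rreg s4 rRes)" if "0 \<le> ?\<theta>" "?\<theta> \<le> weight_sum ?L"
        proof -
          show ?thesis using 3 s3f g(2) by (simp add: splits_def s4_def p_def)
        qed
      qed (use s3b s3f in \<open>auto simp: s4_def same_below_def sel_stack_below_def\<close>)
    qed
  qed
qed

end

section \<open>Selection from keys and weights computed on the fly\<close>

subsection \<open>Selecting from computed keys\<close>

text \<open>
  From here on most registers appear as bare numbers. Index registers: 8 and 9 delimit the lines of
  the current level, 10 is the loop index, 11 the end of the surviving lines, 12 to 14 count pairs, 15 is
  the recursion depth, 16 holds 0. Real registers: 24 total weight; 25 to 28 base point and direction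
  of the queried line; 29, 30 the linear part \<open>\<alpha>, \<beta>\<close> of the objective; 31, 32 minimiser and 33, 34
  subgradient found by a query; 35, 36 part of the subgradient due to lines through the minimiser;
  38 to 44 temporaries; 45 median slope; 46, 47 signs and 56, 57 apex of the quadrant; 48 to 50 a point
  and its objective value, 51 to 53 the same for the best query point; 54, 55 result. Real arrays:
  6 to 8 lines, 9 to 12 pairs, 13 to 17 recursion stack. Index arrays 2, 3: recursion stack.
\<close>

abbreviation (input) "iLo \<equiv> (8::nat)"
abbreviation (input) "iHi \<equiv> (9::nat)"
abbreviation (input) "iL \<equiv> (10::nat)"
abbreviation (input) "iZ \<equiv> (16::nat)"
abbreviation (input) "rTot \<equiv> (24::nat)"

abbreviation (input) level_size :: "state \<Rightarrow> nat" where
  "level_size s \<equiv> ireg s iHi - ireg s iLo"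

definition fill_body :: "com \<Rightarrow> com" where
  "fill_body c = Seq c (block [RStore aKey iSHi rKey, RStore aWgt iSHi rWgt, IInc iSHi, RAdd rTot rTot rWgt])"

text \<open>\<open>c\<close> leaves key and weight of entry \<open>iL\<close> in \<open>rKey\<close>
  and \<open>rWgt\<close>; \<open>c'\<close> computes the threshold from the total weight in
  \<open>rTot\<close>. Every selection fills the scratch arrays from index 0, which is safe because
  none is pending when another one starts.\<close>

definition select :: "nat \<Rightarrow> nat \<Rightarrow> com \<Rightarrow> com \<Rightarrow> com" where
  "select l h c c' = seq [block [ISet iSHi 0, RSet rTot 0], for_range iL l h (fill_body c),
     Do (ISet iSLo 0), c', Call 1]"

definition temp :: "loc set" where
  "temp = RReg ` ({2, 5, 6} \<union> {38..44})"

definition fill_writes :: "loc set" where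
  "fill_writes = {IReg iSHi, IReg iL, RArr aKey, RArr aWgt, RReg rTot} \<union> temp"

definition select_writes :: "loc set" where
  "select_writes = fill_writes \<union> sel_writes"

context sel_program
begin

text \<open>Filling costs 38 steps per entry, selection 2000. The premises \<open>key\<close> and
  \<open>thr\<close> speak of \<open>run\<close>, so that instances follow by simplification from
  the frame.\<close>

lemma exec_select:
  assumes c: "simple c" "cost c \<le> 30" "writes callees c \<subseteq> temp"
    and c': "simple c'" "cost c' \<le> 30" "writes callees c' \<subseteq> temp"
    and l: "l \<notin> {iSLo, iSHi, iL}" and h: "h \<notin> {iSLo, iSHi, iL}"
    and le: "ireg s l \<le> ireg s h"
    and key: "\<And>j s'. frame fill_writes s s' \<Longrightarrow> ireg s' iL = j \<Longrightarrow> ireg s l \<le> j \<Longrightarrow> j < ireg s h \<Longrightarrow>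
      rreg (run c s') rKey = fst (f j) \<and> rreg (run c s') rWgt = snd (f j)"
    and thr: "\<And>s'. frame (insert (IReg iSLo) fill_writes) s s' \<Longrightarrow>
      rreg s' rTot = weight_sum (map f [ireg s l..<ireg s h]) \<Longrightarrow> rreg (run c' s') rThr = \<theta>"
  obtains k s' where "exec P (select l h c c') s k s'"
    "k \<le> (ireg s h - ireg s l) * 2040 + 60" "frame select_writes s s'"
    "ireg s l < ireg s h \<Longrightarrow> 0 \<le> \<theta> \<Longrightarrow> \<theta> \<le> weight_sum (map f [ireg s l..<ireg s h]) \<Longrightarrow>
       splits (map f [ireg s l..<ireg s h]) \<theta> (rreg s' rRes)"
proof -
  let ?a = "ireg s l" and ?b = "ireg s h"
  have lh: "l \<noteq> 2" "l \<noteq> 3" "l \<noteq> 10" "h \<noteq> 2" "h \<noteq> 3" "h \<noteq> 10" using l h by auto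
  let ?c1 = "block [ISet iSHi 0, RSet rTot 0]"
  define s1 where "s1 = run ?c1 s"
  have "simple ?c1" "cost ?c1 \<le> 2" by simp_all
  then obtain k1 where 1: "exec P ?c1 s k1 s1" "k1 \<le> 2" unfolding s1_def by (rule exec_simple_le)
  have s1: "ireg s1 l = ?a" "ireg s1 h = ?b" using lh by (simp_all add: s1_def)
  have f1: "frame fill_writes s s1" by (auto simp: s1_def frame_def fill_writes_def)
  define I where "I = (\<lambda>j s'. ireg s' iSHi = j - ?a \<and> rreg s' rTot = weight_sum (map f [?a..<j]) \<and>
    items s' 0 (j - ?a) = map f [?a..<j])"
  have w: "insert (IReg iL) (writes callees (fill_body c)) \<subseteq> fill_writes"
    using c(3) by (auto simp: fill_body_def fill_writes_def temp_def)
  obtain k2 s2 where 2: "exec P (for_range iL l h (fill_body c)) s1 k2 s2" "k2 \<le> (?b - ?a) * (36 + 2) + 2"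
    "I ?b s2" "frame (insert (IReg iL) (writes callees (fill_body c))) s1 s2"
  proof (rule exec_for_range[of "fill_body c" iL callees h s1 l 36 I P, unfolded s1])
    show "I ?a (with_index iL ?a s1)"
      by (simp add: I_def s1_def items_def weight_sum_def)
    show "IReg iL \<notin> writes callees (fill_body c)" "IReg h \<notin> writes callees (fill_body c)"
      using c(3) lh by (auto simp: fill_body_def temp_def)
  next
    fix j s'
    assume I: "I j s'" and fr: "frame (insert (IReg iL) (writes callees (fill_body c))) s1 s'"
      and i: "ireg s' iL = j" and j: "?a \<le> j" "j < ?b"
    have "frame fill_writes s s'" using f1 fr w by (blast intro: frame_trans frame_mono)
    from key[OF this i j]
    have k: "rreg (run c s') rKey = fst (f j)" "rreg (run c s') rWgt = snd (f j)" by auto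
    have fc: "frame (writes callees c) s' (run c s')" using c(1) by (rule frame_run)
    have "IReg x \<notin> writes callees c" "RArr x \<notin> writes callees c" "RReg rTot \<notin> writes callees c" for x
      using c(3) by (auto simp: temp_def)
    then have r: "ireg (run c s') = ireg s'" "rarr (run c s') = rarr s'" "rreg (run c s') rTot = rreg s' rTot"
      using fc by (auto simp: frame_def)
    let ?s = "with_index iL (Suc j) (run (fill_body c) s')"
    have "items ?s 0 (j - ?a) = items s' 0 (j - ?a)"
      by (rule items_cong) (use I in \<open>simp add: fill_body_def r I_def\<close>)
    then have "items ?s 0 (Suc (j - ?a)) = map f [?a..<Suc j]"
      using I j by (simp add: items_upt_Suc I_def) (simp add: fill_body_def r k)
    then show "I (Suc j) ?s"
      using I j by (simp add: I_def Suc_diff_le) (simp add: fill_body_def r k weight_sum_def)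
  qed (use c lh le in \<open>simp_all add: fill_body_def\<close>)
  have f2: "frame fill_writes s s2" using f1 2(4) w by (blast intro: frame_trans frame_mono)
  define s3 where "s3 = step (ISet iSLo 0) s2"
  have 3: "exec P (Do (ISet iSLo 0)) s2 1 s3" unfolding s3_def by (rule exec.Do)
  have f3: "frame (insert (IReg iSLo) fill_writes) s s3" using f2 by (auto simp: frame_def s3_def)
  define s4 where "s4 = run c' s3"
  from c'(1,2) obtain k4 where 4: "exec P c' s3 k4 s4" "k4 \<le> 30" unfolding s4_def by (rule exec_simple_le)
  have fc: "frame (writes callees c') s3 s4" unfolding s4_def using c'(1) by (rule frame_run)
  have nw: "IReg x \<notin> writes callees c'" "RArr x \<notin> writes callees c'" for x
    using c'(3) by (auto simp: temp_def)
  have r4: "ireg s4 = ireg s3" "rarr s4 = rarr s3" using fc nw by (auto simp: frame_def)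
  have s4: "rreg s4 rThr = \<theta>" "ireg s4 iSLo = 0" "ireg s4 iSHi = ?b - ?a"
    "items s4 0 (?b - ?a) = map f [?a..<?b]"
    using thr[OF f3] 2(3) r4 by (auto simp: s3_def s4_def I_def items_def)
  obtain k5 s5 where 5: "exec P (Call 1) s4 k5 s5" "sel_post s4 k5 s5" using exec_sel by blast
  have "exec P (select l h c c') s (k1 + (k2 + (1 + (k4 + k5)))) s5"
    using exec.Seq[OF 1(1) exec.Seq[OF 2(1) exec.Seq[OF 3 exec.Seq[OF 4(1) 5(1)]]]]
    by (simp add: select_def)
  moreover have "k1 + (k2 + (1 + (k4 + k5))) \<le> (?b - ?a) * 2040 + 60"
    using 1 2 4 5(2) s4 by (simp add: sel_post_def)
  moreover have "frame select_writes s s5"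
  proof -
    have "frame sel_writes s4 s5" using exec_frame_P[OF 5(1)] by (simp add: callees_def)
    moreover have "frame (insert (IReg iSLo) fill_writes) s3 s4"
      using fc c'(3) by (auto elim!: frame_mono simp: fill_writes_def)
    ultimately have "frame (insert (IReg iSLo) fill_writes \<union> sel_writes) s s5"
      using f3 by (blast intro: frame_trans frame_Un)
    then show ?thesis by (rule frame_mono) (auto simp: select_writes_def sel_writes_def)
  qed
  moreover have "splits (map f [?a..<?b]) \<theta> (rreg s5 rRes)"
    if "?a < ?b" "0 \<le> \<theta>" "\<theta> \<le> weight_sum (map f [?a..<?b])"
    using 5(2) that unfolding sel_post_def s4 by simp
  ultimately show ?thesis using that by blast
qed

end

section \<open>The weighted median along a line, with an orthogonal subgradient\<close>

subsection \<open>Minimising along a line\<close>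

definition lines :: "state \<Rightarrow> nat \<Rightarrow> nat \<Rightarrow> line list" where
  "lines s a b = map (\<lambda>i. (rarr s 6 i, rarr s 7 i, rarr s 8 i)) [a..<b]"

abbreviation (input) level_lines :: "state \<Rightarrow> line list" where
  "level_lines s \<equiv> lines s (ireg s iLo) (ireg s iHi)"

lemma lines_upt_Suc: "a \<le> b \<Longrightarrow>
    lines s a (Suc b) = lines s a b @ [(rarr s 6 b, rarr s 7 b, rarr s 8 b)]"
  by (simp add: lines_def)

lemma lines_cong:
  "(\<And>i. a \<le> i \<Longrightarrow> i < b \<Longrightarrow> rarr s 6 i = rarr s' 6 i \<and> rarr s 7 i = rarr s' 7 i \<and> rarr s 8 i = rarr s' 8 i) \<Longrightarrow>
    lines s a b = lines s' a b"
  by (auto simp: lines_def)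

lemma length_lines [simp]: "length (lines s a b) = b - a"
  by (simp add: lines_def)

definition load_line :: com where
  "load_line = block [RLoad 38 6 iL, RLoad 39 7 iL, RLoad 40 8 iL]"

definition query_key :: com where
  "query_key = seq [load_line,
     block [RMul 41 38 27, RSub 41 28 41, RMul 42 38 25, RSub 42 26 42, RSub 42 42 39,
       RSet 43 0, RDiv rKey 42 41, RSub rKey 43 rKey, RMul rWgt 40 41],
     Cond (RLess rWgt 43) (Do (RSub rWgt 43 rWgt)) Skip]"

definition query_thr :: com where
  "query_thr = block [RMul 38 29 27, RMul 39 30 28, RAdd 38 38 39, RSub 38 rTot 38, RSet 39 2, RDiv rThr 38 39]"

definition query_init :: com where
  "query_init = block [RMul 31 rRes 27, RAdd 31 25 31, RMul 32 rRes 28, RAdd 32 26 32,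
     RMove 33 29, RMove 34 30, RSet 35 0, RSet 36 0, RSet 43 0]"

definition grad_body :: com where
  "grad_body = seq [load_line,
     block [RMul 41 38 27, RSub 41 28 41, RMul 42 38 31, RSub 42 32 42, RSub 42 42 39, RMul 44 40 38],
     Cond (RLess 43 42) (block [RSub 33 33 44, RAdd 34 34 40])
      (Cond (RLess 42 43) (block [RAdd 33 33 44, RSub 34 34 40])
        (Cond (RLess 43 41) (block [RSub 35 35 44, RAdd 36 36 40])
          (Cond (RLess 41 43) (block [RAdd 35 35 44, RSub 36 36 40]) Skip)))]"

definition grad_final :: com where
  "grad_final = block [RMul 38 33 27, RMul 39 34 28, RAdd 38 38 39, RMul 39 35 27, RMul 40 36 28,
     RAdd 39 39 40, RDiv 38 38 39, RSub 38 43 38, RMul 39 38 35, RAdd 33 33 39, RMul 39 38 36,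
     RAdd 34 34 39]"

definition query :: com where
  "query = seq [select iLo iHi query_key query_thr, query_init, for_range iL iLo iHi grad_body, grad_final]"

definition query_writes :: "loc set" where
  "query_writes = select_writes \<union> RReg ` {31..36}"

lemma exec_grad_loop:
  fixes s :: state
  assumes le: "ireg s iLo \<le> ireg s iHi" and z: "rreg s 35 = 0" "rreg s 36 = 0" "rreg s 43 = 0"
    and g: "rreg s 33 = rreg s 29" "rreg s 34 = rreg s 30"
  defines "L \<equiv> level_lines s" and "u \<equiv> (rreg s 27, rreg s 28)"
    and "q \<equiv> (rreg s 31, rreg s 32)"
  obtains k s' where "exec P (for_range iL iLo iHi grad_body) s k s'"
    "k \<le> (level_size s) * 20 + 2"
    "frame (insert (IReg iL) (writes T grad_body)) s s'"
    "(rreg s' 33, rreg s' 34) = grad0 L (rreg s 29) (rreg s 30) q"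
    "(rreg s' 35, rreg s' 36) = grad1 L u q"
proof -
  let ?h = "ireg s iHi" and ?l = "ireg s iLo"
  define I where "I = (\<lambda>j (s' :: state). (rreg s' 33, rreg s' 34) = grad0 (lines s ?l j) (rreg s 29) (rreg s 30) q \<and>
    (rreg s' 35, rreg s' 36) = grad1 (lines s ?l j) u q)"
  obtain k s' where *: "exec P (for_range iL iLo iHi grad_body) s k s'"
    "k \<le> (?h - ?l) * (18 + 2) + 2" "I ?h s'" "frame (insert (IReg iL) (writes T grad_body)) s s'"
  proof (rule exec_for_range[of grad_body iL T iHi s iLo 18 I P])
    show "I ?l (with_index iL ?l s)"
      by (simp add: I_def lines_def grad0_def grad1_def z g)
  next
    fix j s'
    assume I: "I j s'" and fr: "frame (insert (IReg iL) (writes T grad_body)) s s'"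
      and i: "ireg s' iL = j" and j: "?l \<le> j" "j < ?h"
    have r: "rreg s' 27 = rreg s 27" "rreg s' 28 = rreg s 28" "rreg s' 31 = rreg s 31"
      "rreg s' 32 = rreg s 32" "rreg s' 43 = 0" "rarr s' = rarr s"
      using fr z by (auto simp: frame_def grad_body_def load_line_def)
    let ?ln = "(rarr s 6 j, rarr s 7 j, rarr s 8 j)"
    have up: "lines s ?l (Suc j) = lines s ?l j @ [?ln]" using j by (simp add: lines_upt_Suc)
    define e where "e = resid q ?ln"
    define A where "A = snd u - slope ?ln * fst u"
    have e: "rreg s 32 - rarr s 6 j * rreg s 31 - rarr s 7 j = e"
      by (simp add: e_def resid_def q_def)
    have A: "rreg s 28 - rarr s 6 j * rreg s 27 = A" by (simp add: A_def u_def)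
    consider "0 < e" | "e < 0" | "e = 0" "0 < A" | "e = 0" "A < 0" | "e = 0" "A = 0" by linarith
    then show "I (Suc j) (with_index iL (Suc j) (run grad_body s'))"
      by cases (use I in \<open>simp_all add: I_def up grad0_def grad1_def e_def[symmetric] A_def[symmetric]
        del: fst_conv snd_conv,
        simp_all add: grad_body_def load_line_def r i e A\<close>)
  qed (use le in \<open>simp_all add: grad_body_def load_line_def\<close>)
  with that show ?thesis by (auto simp: I_def L_def)
qed


text \<open>A subgradient \<open>g\<close> orthogonal to \<open>u\<close> makes \<open>q\<close>
  minimal on the line and bounds the objective from below by its value at \<open>q\<close> on the
  whole side into which \<open>g\<close> points. Being on the line is unconditional, the rest
  presupposes boundedness.\<close>

definition query_post :: "line list \<Rightarrow> real \<Rightarrow> real \<Rightarrow> real \<times> real \<Rightarrow> real \<times> real \<Rightarrow> real \<times> real \<Rightarrow> real \<times> real \<Rightarrow> bool" where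
  "query_post L \<alpha> \<beta> z u q g \<longleftrightarrow> (\<exists>t. q = (fst z + t * fst u, snd z + t * snd u)) \<and>
     (L \<noteq> [] \<longrightarrow> (nonneg_wgts L) \<longrightarrow> (bounded_dev L \<alpha> \<beta>) \<longrightarrow>
       fst g * fst u + snd g * snd u = 0 \<and>
       (\<forall>y. dev L \<alpha> \<beta> q + fst g * (fst y - fst q) + snd g * (snd y - snd q) \<le> dev L \<alpha> \<beta> y))"

lemma query_postI:
  assumes q: "q = (fst z + t * fst u, snd z + t * snd u)"
    and t: "L \<noteq> [] \<Longrightarrow> 0 \<le> \<theta> \<Longrightarrow> \<theta> \<le> weight_sum (breaks L z u) \<Longrightarrow> splits (breaks L z u) \<theta> t"
    and \<theta>: "\<theta> = (weight_sum (breaks L z u) - (\<alpha> * fst u + \<beta> * snd u)) / 2"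
  shows "query_post L \<alpha> \<beta> z u q (grad L \<alpha> \<beta> u q)"
  unfolding query_post_def
proof (intro conjI impI allI)
  assume *: "L \<noteq> []" "nonneg_wgts L" "bounded_dev L \<alpha> \<beta>"
  then obtain B where "\<And>y. B \<le> dev L \<alpha> \<beta> y" by auto
  \<comment> \<open>Boundedness enters here: it keeps the median threshold in the range for which
    selection is specified.\<close>
  from bounded_imp_directional[OF *(2) this, of "fst u" "snd u"]
  have "\<bar>\<alpha> * fst u + \<beta> * snd u\<bar> \<le> weight_sum (breaks L z u)"
    by (simp add: weight_sum_def breaks_def o_def)
  then have "0 \<le> \<theta> \<and> \<theta> \<le> weight_sum (breaks L z u)" 
  proof -
    have "0 \<le> (W - g) / 2 \<and> (W - g) / 2 \<le> W" if "\<bar>g\<bar> \<le> W" for g W :: real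
      using that by auto
    then show ?thesis unfolding \<theta> using \<open>_ \<le> weight_sum (breaks L z u)\<close> by blast
  qed
  then have "splits (breaks L z u) \<theta> t" using t[OF *(1)] by blast
  note p = grad_props[OF *(2) this[unfolded \<theta>] q]
  show "fst (grad L \<alpha> \<beta> u q) * fst u + snd (grad L \<alpha> \<beta> u q) * snd u = 0" by (rule p(1))
  show "dev L \<alpha> \<beta> q + fst (grad L \<alpha> \<beta> u q) * (fst y - fst q) + snd (grad L \<alpha> \<beta> u q) * (snd y - snd q)
      \<le> dev L \<alpha> \<beta> y" for y by (rule p(2))
qed (use q in blast)

context sel_program
begin

lemma exec_query:
  assumes le: "ireg s iLo \<le> ireg s iHi"
  obtains k s' where "exec P query s k s'"
    "k \<le> (level_size s) * 2060 + 100" "frame query_writes s s'"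
    "query_post (level_lines s) (rreg s 29) (rreg s 30) (rreg s 25, rreg s 26)
      (rreg s 27, rreg s 28) (rreg s' 31, rreg s' 32) (rreg s' 33, rreg s' 34)"
proof -
  let ?a = "ireg s iLo" and ?b = "ireg s iHi"
  define L where "L = lines s ?a ?b"
  define z u where "z = (rreg s 25, rreg s 26)" and "u = (rreg s 27, rreg s 28)"
  define ln where "ln = (\<lambda>i. (rarr s 6 i, rarr s 7 i, rarr s 8 i) :: line)"
  define f where "f = (\<lambda>i. (- (resid z (ln i) / (snd u - slope (ln i) * fst u)),
     \<bar>wgt (ln i) * (snd u - slope (ln i) * fst u)\<bar>))"
  have br: "map f [?a..<?b] = breaks L z u"
    by (simp add: L_def breaks_def lines_def f_def ln_def)
  define \<theta> where "\<theta> = (weight_sum (breaks L z u) - (rreg s 29 * fst u + rreg s 30 * snd u)) / 2"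
  obtain k1 s1 where 1: "exec P (select iLo iHi query_key query_thr) s k1 s1"
    "k1 \<le> (?b - ?a) * 2040 + 60" "frame select_writes s s1"
    "?a < ?b \<Longrightarrow> 0 \<le> \<theta> \<Longrightarrow> \<theta> \<le> weight_sum (map f [?a..<?b]) \<Longrightarrow> splits (map f [?a..<?b]) \<theta> (rreg s1 rRes)"
  proof (rule exec_select[of query_key query_thr iLo iHi s f \<theta>])
    fix j s' assume fr: "frame fill_writes s s'" and i: "ireg s' iL = j"
    have r: "rreg s' 25 = rreg s 25" "rreg s' 26 = rreg s 26" "rreg s' 27 = rreg s 27" "rreg s' 28 = rreg s 28"
      "rarr s' 6 = rarr s 6" "rarr s' 7 = rarr s 7" "rarr s' 8 = rarr s 8"
      using fr by (auto simp: frame_def fill_writes_def temp_def)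
    show "rreg (run query_key s') rKey = fst (f j) \<and> rreg (run query_key s') rWgt = snd (f j)"
      by (simp add: query_key_def load_line_def r i f_def ln_def z_def u_def resid_def)
  next
    fix s' assume fr: "frame (insert (IReg iSLo) fill_writes) s s'"
      and t: "rreg s' rTot = weight_sum (map f [?a..<?b])"
    have r: "rreg s' 27 = rreg s 27" "rreg s' 28 = rreg s 28" "rreg s' 29 = rreg s 29" "rreg s' 30 = rreg s 30"
      using fr by (auto simp: frame_def fill_writes_def temp_def)
    show "rreg (run query_thr s') rThr = \<theta>"
      by (simp add: query_thr_def r t br \<theta>_def u_def)
  qed (use le in \<open>auto simp: query_key_def query_thr_def load_line_def temp_def\<close>)
  have r1: "ireg s1 iLo = ?a" "ireg s1 iHi = ?b" "rreg s1 25 = rreg s 25" "rreg s1 26 = rreg s 26"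
    "rreg s1 27 = rreg s 27" "rreg s1 28 = rreg s 28" "rreg s1 29 = rreg s 29" "rreg s1 30 = rreg s 30"
    "rarr s1 6 = rarr s 6" "rarr s1 7 = rarr s 7" "rarr s1 8 = rarr s 8"
    using 1(3) by (auto simp: frame_def select_writes_def sel_writes_def fill_writes_def temp_def)
  define s2 where "s2 = run query_init s1"
  have c2: "simple query_init" "cost query_init \<le> 9" by (simp_all add: query_init_def)
  then obtain k2 where 2: "exec P query_init s1 k2 s2" "k2 \<le> 9" unfolding s2_def by (rule exec_simple_le)
  have f2: "frame query_writes s1 s2" unfolding s2_def
    by (rule frame_mono[OF frame_run[OF c2(1), of callees]])
      (auto simp: query_init_def query_writes_def select_writes_def fill_writes_def temp_def)
  define q where "q = (rreg s2 31, rreg s2 32)"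
  have q: "q = (fst z + rreg s1 rRes * fst u, snd z + rreg s1 rRes * snd u)"
    by (simp add: q_def s2_def query_init_def r1 z_def u_def)
  have r2: "ireg s2 iLo = ?a" "ireg s2 iHi = ?b" "rreg s2 27 = rreg s 27" "rreg s2 28 = rreg s 28"
    "rreg s2 29 = rreg s 29" "rreg s2 30 = rreg s 30" "rreg s2 33 = rreg s2 29" "rreg s2 34 = rreg s2 30"
    "rreg s2 35 = 0" "rreg s2 36 = 0" "rreg s2 43 = 0"
    by (simp_all add: s2_def query_init_def r1)
  have L2: "lines s2 ?a ?b = L"
    unfolding L_def by (rule lines_cong) (simp add: s2_def query_init_def r1)
  have le2: "ireg s2 iLo \<le> ireg s2 iHi" using le r2 by simp
  obtain k3 s3 where 3: "exec P (for_range iL iLo iHi grad_body) s2 k3 s3" "k3 \<le> (?b - ?a) * 20 + 2"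
    "frame (insert (IReg iL) (writes callees grad_body)) s2 s3"
    "(rreg s3 33, rreg s3 34) = grad0 L (rreg s 29) (rreg s 30) q"
    "(rreg s3 35, rreg s3 36) = grad1 L u q"
    by (rule exec_grad_loop[of s2 P callees, OF le2 r2(9-11) r2(7,8), unfolded r2(1-6) L2,
      folded u_def q_def])
  have f3: "frame query_writes s2 s3"
    by (rule frame_mono[OF 3(3)])
      (auto simp: grad_body_def load_line_def query_writes_def select_writes_def fill_writes_def temp_def)
  have r3: "rreg s3 27 = fst u" "rreg s3 28 = snd u" "rreg s3 43 = 0" "rreg s3 31 = fst q" "rreg s3 32 = snd q"
    using 3(3) r2 by (auto simp: frame_def grad_body_def load_line_def u_def q_def)
  define s4 where "s4 = run grad_final s3"
  have c4: "simple grad_final" "cost grad_final \<le> 12" by (simp_all add: grad_final_def)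
  then obtain k4 where 4: "exec P grad_final s3 k4 s4" "k4 \<le> 12" unfolding s4_def by (rule exec_simple_le)
  have f4: "frame query_writes s3 s4" unfolding s4_def
    by (rule frame_mono[OF frame_run[OF c4(1), of callees]])
      (auto simp: grad_final_def query_writes_def select_writes_def fill_writes_def temp_def)
  have r4: "(rreg s4 31, rreg s4 32) = q" by (simp add: s4_def grad_final_def r3)
  have "fst (grad0 L (rreg s 29) (rreg s 30) q) = rreg s3 33" "snd (grad0 L (rreg s 29) (rreg s 30) q) = rreg s3 34"
    "fst (grad1 L u q) = rreg s3 35" "snd (grad1 L u q) = rreg s3 36"
    using 3(4,5) by (metis fst_conv snd_conv)+
  then have g: "(rreg s4 33, rreg s4 34) = grad L (rreg s 29) (rreg s 30) u q"
    by (simp add: grad_def Let_def s4_def grad_final_def r3)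
  have "L \<noteq> [] \<Longrightarrow> ?a < ?b" by (auto simp: L_def lines_def)
  then have "query_post L (rreg s 29) (rreg s 30) z u q (grad L (rreg s 29) (rreg s 30) u q)"
    using 1(4) by (intro query_postI[OF q _ \<theta>_def]) (simp add: br)
  then have "query_post L (rreg s 29) (rreg s 30) z u (rreg s4 31, rreg s4 32) (rreg s4 33, rreg s4 34)"
    unfolding r4 g .
  moreover have "exec P query s (k1 + (k2 + (k3 + k4))) s4"
    using exec.Seq[OF 1(1) exec.Seq[OF 2(1) exec.Seq[OF 3(1) 4(1)]]] by (simp add: query_def)
  moreover have "k1 + (k2 + (k3 + k4)) \<le> (?b - ?a) * 2060 + 100" using 1 2 3 4 by simp
  moreover have "frame query_writes s s4"
    by (rule frame_trans[OF frame_trans[OF frame_mono[OF 1(3)] f2] frame_trans[OF f3 f4]])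
      (simp add: query_writes_def)
  ultimately show ?thesis using that unfolding L_def z_def u_def by blast
qed

end

section \<open>The value of the objective at a point\<close>

subsection \<open>Evaluation\<close>

definition eval_init :: com where
  "eval_init = block [RMul 50 29 48, RMul 38 30 49, RAdd 50 50 38, RSet 43 0]"

definition eval_body :: com where
  "eval_body = seq [load_line, block [RMul 42 38 48, RSub 42 49 42, RSub 42 42 39],
     Cond (RLess 42 43) (Do (RSub 42 43 42)) Skip, block [RMul 42 40 42, RAdd 50 50 42]]"

definition eval_code :: com where
  "eval_code = seq [eval_init, for_range iL iLo iHi eval_body]"

definition eval_writes :: "loc set" where
  "eval_writes = insert (RReg 50) (insert (IReg iL) temp)"

lemma exec_eval:
  fixes s :: state
  assumes le: "ireg s iLo \<le> ireg s iHi"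
  obtains k s' where "exec P eval_code s k s'"
    "k \<le> (level_size s) * 20 + 10" "frame eval_writes s s'"
    "rreg s' 50 = dev (level_lines s) (rreg s 29) (rreg s 30) (rreg s 48, rreg s 49)"
proof -
  let ?h = "ireg s iHi" and ?l = "ireg s iLo" and ?v = "(rreg s 48, rreg s 49)"
  define s1 where "s1 = run eval_init s"
  have c1: "simple eval_init" "cost eval_init \<le> 4" by (simp_all add: eval_init_def)
  then obtain k1 where 1: "exec P eval_init s k1 s1" "k1 \<le> 4" unfolding s1_def by (rule exec_simple_le)
  define I where "I = (\<lambda>j (s' :: state). rreg s' 50 = dev (lines s ?l j) (rreg s 29) (rreg s 30) ?v)"
  have s1: "ireg s1 = ireg s" "rarr s1 = rarr s" "rreg s1 48 = rreg s 48" "rreg s1 49 = rreg s 49"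
    "rreg s1 43 = 0" by (simp_all add: s1_def eval_init_def)
  obtain k2 s2 where 2: "exec P (for_range iL iLo iHi eval_body) s1 k2 s2"
    "k2 \<le> (?h - ?l) * (18 + 2) + 2" "I ?h s2" "frame (insert (IReg iL) (writes callees eval_body)) s1 s2"
  proof (rule exec_for_range[of eval_body iL callees iHi s1 iLo 18 I P, unfolded s1(1)])
    show "I ?l (s1\<lparr>ireg := (ireg s)(iL := ?l)\<rparr>)"
      by (simp add: I_def s1_def eval_init_def lines_def dev_def)
  next
    fix j s'
    assume I: "I j s'" and fr: "frame (insert (IReg iL) (writes callees eval_body)) s1 s'"
      and i: "ireg s' iL = j" and j: "?l \<le> j" "j < ?h"
    have r: "rreg s' 48 = rreg s 48" "rreg s' 49 = rreg s 49" "rreg s' 43 = 0" "rarr s' = rarr s"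
      using fr s1 by (auto simp: frame_def eval_body_def load_line_def)
    have up: "lines s ?l (Suc j) = lines s ?l j @ [(rarr s 6 j, rarr s 7 j, rarr s 8 j)]"
      using j by (simp add: lines_upt_Suc)
    have "rreg (with_index iL (Suc j) (run eval_body s')) 50 =
      rreg s' 50 + rarr s 8 j * \<bar>resid ?v (rarr s 6 j, rarr s 7 j, rarr s 8 j)\<bar>"
      by (simp add: eval_body_def load_line_def r i resid_def)
    then show "I (Suc j) (with_index iL (Suc j) (run eval_body s'))"
      using I by (simp add: I_def up dev_def)
  qed (use le in \<open>simp_all add: eval_body_def load_line_def\<close>)
  have "frame eval_writes s s1" unfolding s1_def
    by (rule frame_mono[OF frame_run[OF c1(1), of callees]])
      (auto simp: eval_init_def eval_writes_def temp_def)
  moreover have "frame eval_writes s1 s2"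
    by (rule frame_mono[OF 2(4)]) (auto simp: eval_body_def load_line_def eval_writes_def temp_def)
  ultimately have "frame eval_writes s s2" by (rule frame_trans)
  moreover have "exec P eval_code s (k1 + k2) s2"
    using exec.Seq[OF 1(1) 2(1)] by (simp add: eval_code_def)
  moreover have "k1 + k2 \<le> (?h - ?l) * 20 + 10" using 1 2 by simp
  ultimately show ?thesis using that 2(3) by (auto simp: I_def)
qed

section \<open>Building the pairs; the sides excluded by a query\<close>

subsection \<open>Pairing\<close>

abbreviation (input) "iE \<equiv> (11::nat)"
abbreviation (input) "iA \<equiv> (12::nat)"
abbreviation (input) "iB \<equiv> (13::nat)"
abbreviation (input) "iN \<equiv> (14::nat)"
abbreviation (input) "iD \<equiv> (15::nat)"

definition split_body :: com where
  "split_body = seq [load_line,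
     Cond (RLess 38 45) (block [RStore 9 iA 38, RStore 10 iA 39, IInc iA])
       (Cond (RLess 45 38) (block [RStore 11 iB 38, RStore 12 iB 39, IInc iB]) Skip)]"

definition tie_body :: com where
  "tie_body = seq [load_line,
     Cond (RLess 38 45) Skip (Cond (RLess 45 38) Skip
       (block [RStore 9 iN 38, RStore 10 iN 39, RStore 11 iN 38, RStore 12 iN 39, IInc iN]))]"

text \<open>Flat and steep lines are written side by side and cut to the shorter length; the
  self-pairs are then appended from there on, overwriting lines without partner. \<open>iZ\<close>
  is set to 0 as the lower bound of later passes over the pairs.\<close>

definition pair_code :: com where
  "pair_code = seq [block [ISet iA 0, ISet iB 0, ISet iZ 0], for_range iL iLo iHi split_body,
     Cond (ILess iA iB) (Do (IMove iN iA)) (Do (IMove iN iB)), for_range iL iLo iHi tie_body]"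

definition pair_writes :: "loc set" where
  "pair_writes = IReg ` {10, 12, 13, 14, 16} \<union> RArr ` {9..12} \<union> temp"

definition mc :: "line \<Rightarrow> real \<times> real" where
  "mc l = (slope l, icpt l)"

definition points :: "nat \<Rightarrow> nat \<Rightarrow> state \<Rightarrow> nat \<Rightarrow> (real \<times> real) list" where
  "points x y s n = map (\<lambda>i. (rarr s x i, rarr s y i)) [0..<n]"

lemma points_Suc: "points x y s (Suc n) = points x y s n @ [(rarr s x n, rarr s y n)]"
  by (simp add: points_def)

lemma points_cong:
  "(\<And>i. i < n \<Longrightarrow> rarr s x i = rarr s' x i \<and> rarr s y i = rarr s' y i) \<Longrightarrow>
    points x y s n = points x y s' n"
  by (auto simp: points_def)

lemma length_points [simp]: "length (points x y s n) = n"
  by (simp add: points_def)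

lemma take_points: "n \<le> m \<Longrightarrow> take n (points x y s m) = points x y s n"
  by (simp add: points_def take_map)

lemma pairing_mc:
  "map fst (map (map_prod mc mc) (pairing s L)) =
     take (min (length (filter (\<lambda>l. slope l < s) L)) (length (filter (\<lambda>l. s < slope l) L)))
       (map mc (filter (\<lambda>l. slope l < s) L)) @ map mc (filter (\<lambda>l. slope l = s) L)" (is ?A)
  "map snd (map (map_prod mc mc) (pairing s L)) =
     take (min (length (filter (\<lambda>l. slope l < s) L)) (length (filter (\<lambda>l. s < slope l) L)))
       (map mc (filter (\<lambda>l. s < slope l) L)) @ map mc (filter (\<lambda>l. slope l = s) L)" (is ?B)
proof -
  have f: "map fst (map (map_prod mc mc) xs) = map mc (map fst xs)"
    and g: "map snd (map (map_prod mc mc) xs) = map mc (map snd xs)" for xs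
    by simp_all
  show ?A
    unfolding f by (simp add: pairing_def map_fst_zip_take take_map o_def)
  show ?B
    unfolding g by (simp add: pairing_def map_snd_zip_take take_map o_def)
qed

lemma exec_split_loop:
  fixes s :: state
  assumes le: "ireg s iLo \<le> ireg s iHi" and z: "ireg s iA = 0" "ireg s iB = 0"
  defines "L \<equiv> level_lines s" and "m \<equiv> rreg s 45"
  obtains k s' where "exec P (for_range iL iLo iHi split_body) s k s'"
    "k \<le> (level_size s) * 20 + 2"
    "frame (insert (IReg iL) (writes T split_body)) s s'"
    "points 9 10 s' (ireg s' iA) = map mc (filter (\<lambda>l. slope l < m) L)"
    "points 11 12 s' (ireg s' iB) = map mc (filter (\<lambda>l. m < slope l) L)"
proof -
  let ?h = "ireg s iHi" and ?l = "ireg s iLo"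
  define I where "I = (\<lambda>j s'.
    points 9 10 s' (ireg s' iA) = map mc (filter (\<lambda>l. slope l < m) (lines s ?l j)) \<and>
    points 11 12 s' (ireg s' iB) = map mc (filter (\<lambda>l. m < slope l) (lines s ?l j)))"
  obtain k s' where *: "exec P (for_range iL iLo iHi split_body) s k s'"
    "k \<le> (?h - ?l) * (18 + 2) + 2" "I ?h s'" "frame (insert (IReg iL) (writes T split_body)) s s'"
  proof (rule exec_for_range[of split_body iL T iHi s iLo 18 I P])
    show "I ?l (with_index iL ?l s)"
      by (simp add: I_def lines_def points_def z)
  next
    fix j s'
    assume I: "I j s'" and fr: "frame (insert (IReg iL) (writes T split_body)) s s'"
      and i: "ireg s' iL = j" and j: "?l \<le> j" "j < ?h"
    have r: "rreg s' 45 = m" "rarr s' 6 = rarr s 6" "rarr s' 7 = rarr s 7" "rarr s' 8 = rarr s 8"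
      using fr by (auto simp: frame_def split_body_def load_line_def m_def)
    have up: "lines s ?l (Suc j) = lines s ?l j @ [(rarr s 6 j, rarr s 7 j, rarr s 8 j)]"
      using j by (simp add: lines_upt_Suc)
    let ?s = "with_index iL (Suc j) (run split_body s')"
    have pa: "points 9 10 ?s (ireg s' iA) = points 9 10 s' (ireg s' iA)"
      and pb: "points 11 12 ?s (ireg s' iB) = points 11 12 s' (ireg s' iB)"
      by (rule points_cong; simp add: split_body_def load_line_def i)+
    consider "rarr s 6 j < m" | "rarr s 6 j = m" | "m < rarr s 6 j" by linarith
    then show "I (Suc j) ?s"
    proof cases
      case 1
      then have e: "ireg ?s iA = Suc (ireg s' iA)" "ireg ?s iB = ireg s' iB"
        "rarr ?s 9 (ireg s' iA) = rarr s 6 j" "rarr ?s 10 (ireg s' iA) = rarr s 7 j"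
        by (simp_all add: split_body_def load_line_def i r)
      show ?thesis using 1 I unfolding I_def e points_Suc pa pb by (simp add: up mc_def e)
    next
      case 2
      then have e: "ireg ?s iA = ireg s' iA" "ireg ?s iB = ireg s' iB"
        by (simp_all add: split_body_def load_line_def i r)
      show ?thesis using 2 I unfolding I_def e pa pb by (simp add: up)
    next
      case 3
      then have e: "ireg ?s iA = ireg s' iA" "ireg ?s iB = Suc (ireg s' iB)"
        "rarr ?s 11 (ireg s' iB) = rarr s 6 j" "rarr ?s 12 (ireg s' iB) = rarr s 7 j"
        by (simp_all add: split_body_def load_line_def i r)
      show ?thesis using 3 I unfolding I_def e points_Suc pa pb by (simp add: up mc_def e)
    qed
  qed (use le in \<open>simp_all add: split_body_def load_line_def\<close>)
  with that show ?thesis by (auto simp: I_def L_def)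
qed

lemma exec_tie_loop:
  fixes s :: state
  assumes le: "ireg s iLo \<le> ireg s iHi"
  defines "L \<equiv> level_lines s" and "m \<equiv> rreg s 45"
  obtains k s' where "exec P (for_range iL iLo iHi tie_body) s k s'"
    "k \<le> (level_size s) * 20 + 2"
    "frame (insert (IReg iL) (writes T tie_body)) s s'"
    "points 9 10 s' (ireg s' iN) = points 9 10 s (ireg s iN) @ map mc (filter (\<lambda>l. slope l = m) L)"
    "points 11 12 s' (ireg s' iN) = points 11 12 s (ireg s iN) @ map mc (filter (\<lambda>l. slope l = m) L)"
proof -
  let ?h = "ireg s iHi" and ?l = "ireg s iLo"
  define I where "I = (\<lambda>j s'.
    points 9 10 s' (ireg s' iN) = points 9 10 s (ireg s iN) @ map mc (filter (\<lambda>l. slope l = m) (lines s ?l j)) \<and>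
    points 11 12 s' (ireg s' iN) = points 11 12 s (ireg s iN) @ map mc (filter (\<lambda>l. slope l = m) (lines s ?l j)))"
  obtain k s' where *: "exec P (for_range iL iLo iHi tie_body) s k s'"
    "k \<le> (?h - ?l) * (18 + 2) + 2" "I ?h s'" "frame (insert (IReg iL) (writes T tie_body)) s s'"
  proof (rule exec_for_range[of tie_body iL T iHi s iLo 18 I P])
    show "I ?l (with_index iL ?l s)"
      by (simp add: I_def lines_def points_def)
  next
    fix j s'
    assume I: "I j s'" and fr: "frame (insert (IReg iL) (writes T tie_body)) s s'"
      and i: "ireg s' iL = j" and j: "?l \<le> j" "j < ?h"
    have r: "rreg s' 45 = m" "rarr s' 6 = rarr s 6" "rarr s' 7 = rarr s 7" "rarr s' 8 = rarr s 8"
      using fr by (auto simp: frame_def tie_body_def load_line_def m_def)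
    have up: "lines s ?l (Suc j) = lines s ?l j @ [(rarr s 6 j, rarr s 7 j, rarr s 8 j)]"
      using j by (simp add: lines_upt_Suc)
    let ?s = "with_index iL (Suc j) (run tie_body s')"
    have pa: "points 9 10 ?s (ireg s' iN) = points 9 10 s' (ireg s' iN)"
      and pb: "points 11 12 ?s (ireg s' iN) = points 11 12 s' (ireg s' iN)"
      by (rule points_cong; simp add: tie_body_def load_line_def i)+
    show "I (Suc j) ?s"
    proof (cases "rarr s 6 j = m")
      case True
      then have e: "ireg ?s iN = Suc (ireg s' iN)"
        "rarr ?s 9 (ireg s' iN) = rarr s 6 j" "rarr ?s 10 (ireg s' iN) = rarr s 7 j"
        "rarr ?s 11 (ireg s' iN) = rarr s 6 j" "rarr ?s 12 (ireg s' iN) = rarr s 7 j"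
        by (simp_all add: tie_body_def load_line_def i r)
      show ?thesis using True I unfolding I_def e points_Suc pa pb by (simp add: up mc_def e)
    next
      case False
      then have e: "ireg ?s iN = ireg s' iN"
        by (auto simp: tie_body_def load_line_def i r)
      show ?thesis using False I unfolding I_def e pa pb by (simp add: up)
    qed
  qed (use le in \<open>simp_all add: tie_body_def load_line_def\<close>)
  with that show ?thesis by (auto simp: I_def L_def)
qed

context sel_program
begin

lemma exec_pair:
  assumes le: "ireg s iLo \<le> ireg s iHi"
  obtains k s' where "exec P pair_code s k s'" "k \<le> (level_size s) * 40 + 10"
    "frame pair_writes s s'" "ireg s' iZ = 0"
    "ireg s' iN = length (pairing (rreg s 45) (level_lines s))"
    "\<forall>i < ireg s' iN. ((rarr s' 9 i, rarr s' 10 i), (rarr s' 11 i, rarr s' 12 i)) =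
      map_prod mc mc (pairing (rreg s 45) (level_lines s) ! i)"
proof -
  let ?h = "ireg s iHi" and ?l = "ireg s iLo" and ?m = "rreg s 45"
  define L where "L = lines s ?l ?h"
  let ?A = "filter (\<lambda>l. slope l < ?m) L" and ?B = "filter (\<lambda>l. ?m < slope l) L"
  let ?T = "filter (\<lambda>l. slope l = ?m) L"
  let ?c1 = "block [ISet iA 0, ISet iB 0, ISet iZ 0]"
  define s1 where "s1 = run ?c1 s"
  have c1: "simple ?c1" "cost ?c1 \<le> 3" by simp_all
  then obtain k1 where 1: "exec P ?c1 s k1 s1" "k1 \<le> 3" unfolding s1_def by (rule exec_simple_le)
  have s1: "ireg s1 iLo = ?l" "ireg s1 iHi = ?h" "ireg s1 iA = 0" "ireg s1 iB = 0" "ireg s1 iZ = 0"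
    "rreg s1 45 = ?m" by (simp_all add: s1_def)
  have f1: "frame pair_writes s s1" by (simp add: s1_def frame_def pair_writes_def)
  have L1: "lines s1 ?l ?h = L" by (simp add: L_def s1_def lines_def)
  have le1: "ireg s1 iLo \<le> ireg s1 iHi" using le s1 by simp
  obtain k2 s2 where 2: "exec P (for_range iL iLo iHi split_body) s1 k2 s2" "k2 \<le> (?h - ?l) * 20 + 2"
    "frame (insert (IReg iL) (writes callees split_body)) s1 s2"
    and p2: "points 9 10 s2 (ireg s2 iA) = map mc ?A" "points 11 12 s2 (ireg s2 iB) = map mc ?B"
    by (rule exec_split_loop[OF le1 s1(3,4), of P callees, unfolded s1(1,2,6) L1])
  have f2: "frame pair_writes s1 s2"
    by (rule frame_mono[OF 2(3)]) (auto simp: split_body_def load_line_def pair_writes_def temp_def)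
  have s2: "ireg s2 iLo = ?l" "ireg s2 iHi = ?h" "ireg s2 iZ = 0" "rreg s2 45 = ?m"
    "rarr s2 6 = rarr s 6" "rarr s2 7 = rarr s 7" "rarr s2 8 = rarr s 8"
    using 2(3) s1 by (auto simp: frame_def split_body_def load_line_def s1_def)
  have len: "ireg s2 iA = length ?A" "ireg s2 iB = length ?B"
    using p2[THEN arg_cong, of length] by simp_all
  let ?c3 = "Cond (ILess iA iB) (Do (IMove iN iA)) (Do (IMove iN iB))"
  let ?n = "min (length ?A) (length ?B)"
  define s3 where "s3 = run ?c3 s2"
  have c3: "simple ?c3" "cost ?c3 \<le> 2" by simp_all
  then obtain k3 where 3: "exec P ?c3 s2 k3 s3" "k3 \<le> 2" unfolding s3_def by (rule exec_simple_le)
  have s3: "ireg s3 iN = ?n" "ireg s3 iLo = ?l" "ireg s3 iHi = ?h" "ireg s3 iZ = 0" "rreg s3 45 = ?m"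
    "rarr s3 = rarr s2" by (auto simp: s3_def s2 len)
  have f3: "frame pair_writes s2 s3" by (simp add: s3_def frame_def pair_writes_def)
  have p3: "points 9 10 s3 ?n = take ?n (map mc ?A)" "points 11 12 s3 ?n = take ?n (map mc ?B)"
    unfolding p2[symmetric] len by (simp_all add: take_points) (simp_all add: points_def s3)
  have L3: "lines s3 ?l ?h = L" by (simp add: L_def lines_def s3 s2)
  have le3: "ireg s3 iLo \<le> ireg s3 iHi" using le s3 by simp
  obtain k4 s4 where 4: "exec P (for_range iL iLo iHi tie_body) s3 k4 s4" "k4 \<le> (?h - ?l) * 20 + 2"
    "frame (insert (IReg iL) (writes callees tie_body)) s3 s4"
    and p4: "points 9 10 s4 (ireg s4 iN) = take ?n (map mc ?A) @ map mc ?T"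
      "points 11 12 s4 (ireg s4 iN) = take ?n (map mc ?B) @ map mc ?T"
    by (rule exec_tie_loop[OF le3, of P callees, unfolded s3(1-3,5) L3 p3])
  have f4: "frame pair_writes s3 s4"
    by (rule frame_mono[OF 4(3)]) (auto simp: tie_body_def load_line_def pair_writes_def temp_def)
  have iz: "ireg s4 iZ = 0" using 4(3) s3 by (auto simp: frame_def tie_body_def load_line_def)
  have fst: "points 9 10 s4 (ireg s4 iN) = map fst (map (map_prod mc mc) (pairing ?m L))"
    and snd: "points 11 12 s4 (ireg s4 iN) = map snd (map (map_prod mc mc) (pairing ?m L))"
    unfolding p4 pairing_mc by (rule refl)+
  have n: "ireg s4 iN = length (pairing ?m L)" using arg_cong[OF fst, of length] by simp
  have el: "((rarr s4 9 i, rarr s4 10 i), (rarr s4 11 i, rarr s4 12 i)) = map_prod mc mc (pairing ?m L ! i)"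
    if "i < ireg s4 iN" for i
    using that n arg_cong[OF fst, of "\<lambda>l. l ! i"] arg_cong[OF snd, of "\<lambda>l. l ! i"]
    by (cases "pairing ?m L ! i") (simp add: points_def)
  have "exec P pair_code s (k1 + (k2 + (k3 + k4))) s4"
    using exec.Seq[OF 1(1) exec.Seq[OF 2(1) exec.Seq[OF 3(1) 4(1)]]] by (simp add: pair_code_def)
  moreover have "k1 + (k2 + (k3 + k4)) \<le> (?h - ?l) * 40 + 10" using 1 2 3 4 by simp
  moreover have "frame pair_writes s s4" by (rule frame_trans[OF frame_trans[OF f1 f2] frame_trans[OF f3 f4]])
  ultimately show ?thesis using that iz n el unfolding L_def by blast
qed

end

text \<open>Orthogonality to \<open>(0, 1)\<close> leaves only the first component of
  \<open>g\<close>, whose sign tells the side. If it is 0, then \<open>q\<close> is a global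
  minimiser and either sign is valid.\<close>

lemma query_side_vertical:
  assumes "query_post L \<alpha> \<beta> (x0, 0) (0, 1) q g" "L \<noteq> []" "nonneg_wgts L"
    "bounded_dev L \<alpha> \<beta>" and "(if fst g < 0 then 1 else - 1) * (fst z - x0) \<le> 0"
  shows "dev L \<alpha> \<beta> q \<le> dev L \<alpha> \<beta> z"
proof -
  have q: "fst q = x0" and g: "snd g = 0"
    and "dev L \<alpha> \<beta> q + fst g * (fst z - fst q) + snd g * (snd z - snd q) \<le> dev L \<alpha> \<beta> z"
    using assms(1-4) by (cases z; auto simp: query_post_def)+
  moreover have "0 \<le> fst g * (fst z - x0)"
    using assms(5) by (auto simp: zero_le_mult_iff split: if_splits)
  ultimately show ?thesis by simp
qed

text \<open>Orthogonality to \<open>(1, m)\<close> turns the inner product of \<open>g\<close> and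
  \<open>z - q\<close> into \<open>snd g\<close> times the vertical offset of \<open>z\<close> from
  the queried line, wherever on that line \<open>q\<close> lies.\<close>

lemma query_side_slanted:
  assumes "query_post L \<alpha> \<beta> (x0, h) (1, m) q g" "L \<noteq> []" "nonneg_wgts L"
    "bounded_dev L \<alpha> \<beta>"
    and side: "(if snd g < 0 then 1 else - 1) * ((snd z - h) - m * (fst z - x0)) \<le> 0"
  shows "dev L \<alpha> \<beta> q \<le> dev L \<alpha> \<beta> z"
proof -
  obtain t where q: "q = (x0 + t, h + t * m)" using assms(1) by (auto simp: query_post_def)
  have "fst g + snd g * m = 0"
    and *: "dev L \<alpha> \<beta> q + fst g * (fst z - fst q) + snd g * (snd z - snd q) \<le> dev L \<alpha> \<beta> z"
    using assms(1-4) by (cases z; auto simp: query_post_def)+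
  then have g: "fst g = - (snd g * m)" by linarith
  have "fst g * (fst z - fst q) + snd g * (snd z - snd q) = snd g * ((snd z - h) - m * (fst z - x0))"
    unfolding g by (simp add: q algebra_simps)
  moreover have "0 \<le> snd g * ((snd z - h) - m * (fst z - x0))"
    using side by (auto simp: zero_le_mult_iff split: if_splits)
  ultimately show ?thesis using * by linarith
qed

section \<open>Two queries that determine the quadrant\<close>

subsection \<open>Choosing what to prune\<close>

definition unit_thr :: "int \<Rightarrow> com" where
  "unit_thr m = block [RSet rThr m, RDiv rThr rTot rThr]"

definition slope_key :: com where
  "slope_key = block [RLoad rKey 6 iL, RSet rWgt 1]"

definition load_pair :: com where
  "load_pair = block [RLoad 38 9 iL, RLoad 39 10 iL, RLoad 40 11 iL, RLoad 41 12 iL, RSet rWgt 1]"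

definition cross_key :: com where
  "cross_key = seq [load_pair, block [RSub 42 39 41, RSub 44 40 38, RDiv rKey 42 44]]"

definition height_key :: com where
  "height_key = seq [load_pair, Do (RSet 43 0),
     Cond (RLess 43 46) (block [RMul rKey 38 56, RAdd rKey rKey 39])
       (block [RMul rKey 40 56, RAdd rKey rKey 41])]"

definition sign_code :: "nat \<Rightarrow> nat \<Rightarrow> com" where
  "sign_code x y = seq [block [RSet 43 0, RSet y 1], Cond (RLess x 43) Skip (Do (RSet y (-1)))]"

definition query_at :: "instr list \<Rightarrow> nat \<Rightarrow> nat \<Rightarrow> com" where
  "query_at is x y = seq [block is, query, sign_code x y, block [RMove 48 31, RMove 49 32], eval_code]"

definition set_best :: com where
  "set_best = block [RMove 51 48, RMove 52 49, RMove 53 50]"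

text \<open>The order matters: the side found by the vertical query decides which line of each pair
  supplies the height for the second query.\<close>

definition choose_code :: com where
  "choose_code = seq [select iLo iHi slope_key (unit_thr 2), Do (RMove 45 rRes), pair_code,
     select iZ iN cross_key (unit_thr 2),
     query_at [RMove 56 rRes, RMove 25 rRes, RSet 26 0, RSet 27 0, RSet 28 1] 33 46, set_best,
     select iZ iN height_key (unit_thr 4),
     query_at [RMove 57 rRes, RMove 25 56, RMove 26 rRes, RSet 27 1, RMove 28 45] 34 47,
     Cond (RLess 50 53) set_best Skip]"

definition level_writes :: "loc set" where
  "level_writes = query_writes \<union> pair_writes \<union> eval_writes \<union> RReg ` ({25..28} \<union> {45..53} \<union> {56, 57})"

lemma cost_block: "is \<noteq> [] \<Longrightarrow> cost (block is) = length is"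
  by (induction "is" rule: induct_list012) auto

context sel_program
begin

lemma exec_select_unit:
  assumes c: "simple c" "cost c \<le> 30" "writes callees c \<subseteq> temp" and m: "1 \<le> m"
    and l: "l \<notin> {iSLo, iSHi, iL}" and h: "h \<notin> {iSLo, iSHi, iL}"
    and lt: "ireg s l < ireg s h"
    and key: "\<And>j s'. frame fill_writes s s' \<Longrightarrow> ireg s' iL = j \<Longrightarrow> ireg s l \<le> j \<Longrightarrow> j < ireg s h \<Longrightarrow>
      rreg (run c s') rKey = g (xs ! (j - ireg s l)) \<and> rreg (run c s') rWgt = 1"
    and xs: "length xs = ireg s h - ireg s l"
  obtains k s' where "exec P (select l h c (unit_thr m)) s k s'"
    "k \<le> (ireg s h - ireg s l) * 2040 + 60" "frame select_writes s s'"
    "splits (map (\<lambda>x. (g x, 1)) xs) (length xs / of_int m) (rreg s' rRes)"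
proof -
  let ?a = "ireg s l" and ?b = "ireg s h"
  define f where "f = (\<lambda>j. (g (xs ! (j - ?a)), 1 :: real))"
  have mp: "map f [?a..<?b] = map (\<lambda>x. (g x, 1)) xs"
    by (rule nth_equalityI) (use xs in \<open>auto simp: f_def\<close>)
  have ws: "weight_sum (map (\<lambda>x. (g x, 1)) xs) = length xs"
    by (subst weight_sum_eq_length) auto
  obtain k s' where "exec P (select l h c (unit_thr m)) s k s'"
    "k \<le> (?b - ?a) * 2040 + 60" "frame select_writes s s'"
    "?a < ?b \<Longrightarrow> 0 \<le> length xs / of_int m \<Longrightarrow> length xs / of_int m \<le> weight_sum (map f [?a..<?b]) \<Longrightarrow>
      splits (map f [?a..<?b]) (length xs / of_int m) (rreg s' rRes)"
  proof (rule exec_select[of c "unit_thr m" l h s f "length xs / of_int m"])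
    fix j s' assume "frame fill_writes s s'" "ireg s' iL = j" "?a \<le> j" "j < ?b"
    from key[OF this] show "rreg (run c s') rKey = fst (f j) \<and> rreg (run c s') rWgt = snd (f j)"
      by (simp add: f_def)
  next
    fix s' :: state assume "rreg s' rTot = weight_sum (map f [?a..<?b])"
    then show "rreg (run (unit_thr m) s') rThr = length xs / of_int m"
      by (simp add: unit_thr_def mp ws)
  qed (use c l h lt in \<open>auto simp: unit_thr_def temp_def\<close>)
  moreover have "length xs / of_int m \<le> real (length xs)"
    using m by (simp add: divide_le_eq) (simp add: mult_le_cancel_left1)
  ultimately show ?thesis using that lt m unfolding mp ws by simp
qed

text \<open>Both queries are covered at once: \<open>xy\<close> fixes the subgradient component
  whose sign is read and the register that receives the sign.\<close>

lemma exec_query_at: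
  assumes le: "ireg s iLo \<le> ireg s iHi" and len: "length is = 5"
    and b: "s1 = run (block is) s" "simple (block is)" "writes callees (block is) \<subseteq> RReg ` ({25..28} \<union> {56, 57})"
    and xy: "(x, y) = (33, 46) \<or> (x, y) = (34, 47)"
  obtains k s' g where "exec P (query_at is x y) s k s'"
    "k \<le> (level_size s) * 2080 + 150"
    "frame (query_writes \<union> eval_writes \<union> RReg ` ({25..28} \<union> {56, 57} \<union> {48, 49, y})) s s'"
    "rreg s' 56 = rreg s1 56" "rreg s' 57 = rreg s1 57"
    "query_post (level_lines s) (rreg s 29) (rreg s 30) (rreg s1 25, rreg s1 26)
      (rreg s1 27, rreg s1 28) (rreg s' 48, rreg s' 49) g"
    "rreg s' y = (if (if x = 33 then fst g else snd g) < 0 then 1 else - 1)"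
    "rreg s' 50 = dev (level_lines s) (rreg s 29) (rreg s 30) (rreg s' 48, rreg s' 49)"
proof -
  let ?a = "ireg s iLo" and ?b = "ireg s iHi"
  define L where "L = lines s ?a ?b"
  define W where "W = query_writes \<union> eval_writes \<union> RReg ` ({25..28} \<union> {56, 57} \<union> {48, 49, y})"
  have "cost (block is) = 5"
    using len cost_block[of "is"] by (cases "is = []") simp_all
  then have "cost (block is) \<le> 5" by simp
  with b(2) obtain k1 where 1: "exec P (block is) s k1 s1" "k1 \<le> 5"
    unfolding b(1) by (rule exec_simple_le)
  have f1: "frame (RReg ` ({25..28} \<union> {56, 57})) s s1"
    unfolding b(1) by (rule frame_mono[OF frame_run[OF b(2)] b(3)])
  have r1: "ireg s1 = ireg s" "rarr s1 = rarr s" "rreg s1 29 = rreg s 29" "rreg s1 30 = rreg s 30"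
    using f1 by (auto simp: frame_def)
  have L1: "lines s1 ?a ?b = L" by (simp add: L_def lines_def r1)
  obtain k2 s2 where 2: "exec P query s1 k2 s2" "k2 \<le> (?b - ?a) * 2060 + 100" "frame query_writes s1 s2"
    "query_post L (rreg s 29) (rreg s 30) (rreg s1 25, rreg s1 26) (rreg s1 27, rreg s1 28)
      (rreg s2 31, rreg s2 32) (rreg s2 33, rreg s2 34)"
    by (rule exec_query[of s1, unfolded r1 L1, OF le])
  define g where "g = (rreg s2 33, rreg s2 34)"
  define s3 where "s3 = run (sign_code x y) s2"
  have c3: "simple (sign_code x y)" "cost (sign_code x y) \<le> 5" by (simp_all add: sign_code_def)
  then obtain k3 where 3: "exec P (sign_code x y) s2 k3 s3" "k3 \<le> 5" unfolding s3_def by (rule exec_simple_le)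
  have y: "y \<noteq> 43" "y \<noteq> 31" "y \<noteq> 32" "x \<noteq> 43" "x \<noteq> y" using xy by auto
  have gx: "(if x = 33 then fst g else snd g) = rreg s2 x" using xy by (auto simp: g_def)
  have s3: "rreg s3 y = (if rreg s2 x < 0 then 1 else - 1)"
    "rreg s3 31 = rreg s2 31" "rreg s3 32 = rreg s2 32"
    using y by (simp_all add: s3_def sign_code_def)
  have f3: "frame {RReg 43, RReg y} s2 s3" by (auto simp: s3_def sign_code_def frame_def)
  let ?c4 = "block [RMove 48 31, RMove 49 32]"
  define s4 where "s4 = run ?c4 s3"
  have c4: "simple ?c4" "cost ?c4 \<le> 2" by simp_all
  then obtain k4 where 4: "exec P ?c4 s3 k4 s4" "k4 \<le> 2" unfolding s4_def by (rule exec_simple_le)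
  have f4: "frame {RReg 48, RReg 49} s3 s4" by (auto simp: s4_def frame_def)
  have fW: "frame W s s4"
  proof (intro frame_trans[of W s s1 s4] frame_trans[of W s1 s2 s4] frame_trans[of W s2 s3 s4])
    show "frame W s s1" by (rule frame_mono[OF f1]) (auto simp: W_def)
    show "frame W s1 s2" by (rule frame_mono[OF 2(3)]) (auto simp: W_def)
    show "frame W s2 s3" by (rule frame_mono[OF f3]) (auto simp: W_def eval_writes_def temp_def)
    show "frame W s3 s4" by (rule frame_mono[OF f4]) (auto simp: W_def)
  qed
  have r4: "ireg s4 iLo = ?a" "ireg s4 iHi = ?b" "rreg s4 29 = rreg s 29" "rreg s4 30 = rreg s 30"
    "rarr s4 6 = rarr s 6" "rarr s4 7 = rarr s 7" "rarr s4 8 = rarr s 8"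
    using fW xy by (auto simp: frame_def W_def query_writes_def select_writes_def sel_writes_def
        fill_writes_def temp_def eval_writes_def)
  have q4: "(rreg s4 48, rreg s4 49) = (rreg s2 31, rreg s2 32)" "rreg s4 y = rreg s3 y"
    using s3 xy by (auto simp: s4_def)
  have p4: "rreg s4 56 = rreg s1 56" "rreg s4 57 = rreg s1 57"
  proof -
    have "rreg s2 56 = rreg s1 56" "rreg s2 57 = rreg s1 57"
      using 2(3) by (auto simp: frame_def query_writes_def select_writes_def sel_writes_def
        fill_writes_def temp_def)
    moreover have "rreg s3 56 = rreg s2 56" "rreg s3 57 = rreg s2 57" using f3 xy by (auto simp: frame_def)
    ultimately show "rreg s4 56 = rreg s1 56" "rreg s4 57 = rreg s1 57" by (simp_all add: s4_def)
  qed
  have L4: "lines s4 ?a ?b = L" by (simp add: L_def lines_def r4)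
  obtain k5 s5 where 5: "exec P eval_code s4 k5 s5" "k5 \<le> (?b - ?a) * 20 + 10" "frame eval_writes s4 s5"
    "rreg s5 50 = dev L (rreg s 29) (rreg s 30) (rreg s4 48, rreg s4 49)"
    by (rule exec_eval[of s4, unfolded r4 L4, OF le])
  have r5: "rreg s5 48 = rreg s4 48" "rreg s5 49 = rreg s4 49" "rreg s5 y = rreg s4 y"
    "rreg s5 56 = rreg s4 56" "rreg s5 57 = rreg s4 57"
    using 5(3) xy by (auto simp: frame_def eval_writes_def temp_def)
  have "exec P (query_at is x y) s (k1 + (k2 + (k3 + (k4 + k5)))) s5"
    using exec.Seq[OF 1(1) exec.Seq[OF 2(1) exec.Seq[OF 3(1) exec.Seq[OF 4(1) 5(1)]]]]
    by (simp add: query_at_def)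
  moreover have "k1 + (k2 + (k3 + (k4 + k5))) \<le> (?b - ?a) * 2080 + 150" using 1 2 3 4 5 by simp
  moreover have "frame W s s5"
    by (rule frame_trans[OF fW frame_mono[OF 5(3)]]) (auto simp: W_def)
  moreover have "query_post L (rreg s 29) (rreg s 30) (rreg s1 25, rreg s1 26) (rreg s1 27, rreg s1 28)
      (rreg s5 48, rreg s5 49) g"
    unfolding r5 q4 g_def by (rule 2(4))
  moreover have "rreg s5 y = (if (if x = 33 then fst g else snd g) < 0 then 1 else - 1)"
    unfolding r5 q4 gx by (rule s3(1))
  moreover have "rreg s5 50 = dev L (rreg s 29) (rreg s 30) (rreg s5 48, rreg s5 49)"
    unfolding r5 by (rule 5(4))
  ultimately show ?thesis
    using that[of "k1 + (k2 + (k3 + (k4 + k5)))" s5 g] r5 p4 unfolding L_def W_def by simp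
qed

end

lemmas writes_defs = query_writes_def select_writes_def sel_writes_def fill_writes_def temp_def
  eval_writes_def pair_writes_def level_writes_def

lemma frame_levelD:
  assumes "frame level_writes s s'"
  shows "ireg s' iLo = ireg s iLo" "ireg s' iHi = ireg s iHi" "ireg s' iD = ireg s iD"
    "rreg s' 29 = rreg s 29" "rreg s' 30 = rreg s 30" "lines s' a b = lines s a b"
    "a \<in> {2, 3} \<Longrightarrow> iarr s' a = iarr s a" "a \<in> {6, 7, 8, 13, 14, 15, 16, 17} \<Longrightarrow> rarr s' a = rarr s a"
  using assms by (auto simp: frame_def writes_defs lines_def)

text \<open>The pruned fraction stands outside the implication because the running time depends on
  it even when the problem is unbounded.\<close>

definition choose_post :: "line list \<Rightarrow> real \<Rightarrow> real \<Rightarrow> (nat \<Rightarrow> real) \<Rightarrow> bool" where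
  "choose_post L \<alpha> \<beta> r \<longleftrightarrow>
     (r 46 = 1 \<or> r 46 = - 1) \<and> (r 47 = 1 \<or> r 47 = - 1) \<and>
     8 * length (filter (\<lambda>l. \<not> prunable (r 46) (r 47) (r 45) (r 56) (r 57) l) L) \<le> 7 * length L \<and>
     r 53 = dev L \<alpha> \<beta> (r 51, r 52) \<and>
     ((nonneg_wgts L) \<longrightarrow> (bounded_dev L \<alpha> \<beta>) \<longrightarrow>
       (\<forall>z. r 46 * (fst z - r 56) \<le> 0 \<longrightarrow> dev L \<alpha> \<beta> (r 51, r 52) \<le> dev L \<alpha> \<beta> z) \<and>
       (\<forall>z. r 47 * ((snd z - r 57) - r 45 * (fst z - r 56)) \<le> 0 \<longrightarrow>
         dev L \<alpha> \<beta> (r 51, r 52) \<le> dev L \<alpha> \<beta> z))"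

context sel_program
begin

lemma exec_choose:
  assumes lt: "ireg s iLo < ireg s iHi"
  obtains k s' where "exec P choose_code s k s'"
    "k \<le> (level_size s) * 12000 + 700" "frame level_writes s s'"
    "choose_post (level_lines s) (rreg s 29) (rreg s 30) (rreg s')"
proof -
  let ?a = "ireg s iLo" and ?b = "ireg s iHi" and ?\<alpha> = "rreg s 29" and ?\<beta> = "rreg s 30"
  define L where "L = lines s ?a ?b"
  have L0: "L \<noteq> []" "length L = ?b - ?a" using lt by (auto simp: L_def lines_def)
  obtain k1 s1 where 1: "exec P (select iLo iHi slope_key (unit_thr 2)) s k1 s1"
    "k1 \<le> (?b - ?a) * 2040 + 60" "frame select_writes s s1"
    and sp1: "splits (map (\<lambda>l. (slope l, 1)) L) (length L / of_int 2) (rreg s1 rRes)"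
  proof (rule exec_select_unit[of slope_key 2 iLo iHi s slope L])
    fix j s' assume fr: "frame fill_writes s s'" and i: "ireg s' iL = j" and j: "?a \<le> j" "j < ?b"
    have "rarr s' 6 = rarr s 6" using fr by (auto simp: frame_def writes_defs)
    moreover have "[?a..<?b] ! (j - ?a) = j" using nth_upt[of ?a "j - ?a" ?b] j by simp
    then have "slope (L ! (j - ?a)) = rarr s 6 j" using j by (simp add: L_def lines_def)
    ultimately show "rreg (run slope_key s') rKey = slope (L ! (j - ?a)) \<and> rreg (run slope_key s') rWgt = 1"
      by (simp add: slope_key_def i)
  qed (use lt L0 in \<open>auto simp: slope_key_def temp_def\<close>)
  define m where "m = rreg s1 rRes"
  define s2 where "s2 = step (RMove 45 rRes) s1"
  have 2: "exec P (Do (RMove 45 rRes)) s1 1 s2" unfolding s2_def by (rule exec.Do)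
  have f1: "frame level_writes s s1" by (rule frame_mono[OF 1(3)]) (auto simp: writes_defs)
  have f2: "frame level_writes s s2"
    by (rule frame_trans[OF f1]) (auto simp: s2_def frame_def level_writes_def)
  note r2 = frame_levelD[OF f2]
  have m2: "rreg s2 45 = m" by (simp add: s2_def m_def)
  have le2: "ireg s2 iLo \<le> ireg s2 iHi" using lt r2 by simp
  define N where "N = length (pairing m L)"
  obtain k3 s3 where 3: "exec P pair_code s2 k3 s3" "k3 \<le> (?b - ?a) * 40 + 10" "frame pair_writes s2 s3"
    "ireg s3 iZ = 0" "ireg s3 iN = N"
    and el: "\<forall>i < ireg s3 iN. ((rarr s3 9 i, rarr s3 10 i), (rarr s3 11 i, rarr s3 12 i)) =
      map_prod mc mc (pairing m L ! i)"
    by (rule exec_pair[OF le2, unfolded r2 m2, folded L_def N_def])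
  have f3: "frame level_writes s s3"
    by (rule frame_trans[OF f2 frame_mono[OF 3(3)]]) (auto simp: level_writes_def)
  note r3 = frame_levelD[OF f3]
  have m3: "rreg s3 45 = m" using 3(3) m2 by (auto simp: frame_def writes_defs)
  \<comment> \<open>A nonempty level yields at least one pair, so the selections over pairs have
    nonempty input.\<close>
  have N: "0 < N" "N \<le> ?b - ?a"
    using pairing_length[of L m] sp1 L0 pairing_count(1)[of "\<lambda>_. True" m L]
    by (auto simp: N_def m_def)
  have el9: "rarr s3 9 i = slope (fst (pairing m L ! i))" and el10: "rarr s3 10 i = icpt (fst (pairing m L ! i))"
    and el11: "rarr s3 11 i = slope (snd (pairing m L ! i))" and el12: "rarr s3 12 i = icpt (snd (pairing m L ! i))"
    if "i < N" for i
    using el[rule_format, of i] that 3(5) by (cases "pairing m L ! i"; simp add: mc_def)+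
  have arr: "rarr s' 9 = rarr s3 9" "rarr s' 10 = rarr s3 10" "rarr s' 11 = rarr s3 11" "rarr s' 12 = rarr s3 12"
    if "frame fill_writes s3 s'" for s'
    using that by (auto simp: frame_def writes_defs)
  obtain k4 s4 where 4: "exec P (select iZ iN cross_key (unit_thr 2)) s3 k4 s4"
    "k4 \<le> (N - 0) * 2040 + 60" "frame select_writes s3 s4"
    and sp4: "splits (map (\<lambda>x. (cross x, 1)) (pairing m L)) (N / of_int 2) (rreg s4 rRes)"
  proof (rule exec_select_unit[of cross_key 2 iZ iN s3 cross "pairing m L", unfolded 3(4,5), folded N_def])
    fix j s' assume fr: "frame fill_writes s3 s'" and i: "ireg s' iL = j" and j: "j < N"
    show "rreg (run cross_key s') rKey = cross (pairing m L ! (j - 0)) \<and> rreg (run cross_key s') rWgt = 1"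
      by (simp add: cross_key_def load_pair_def i arr[OF fr] el9[OF j] el10[OF j] el11[OF j] el12[OF j]
          cross_def split_beta)
  qed (use N in \<open>auto simp: cross_key_def load_pair_def temp_def\<close>)
  define x0 where "x0 = rreg s4 rRes"
  have f4: "frame level_writes s s4"
    by (rule frame_trans[OF f3 frame_mono[OF 4(3)]]) (auto simp: writes_defs)
  note r4 = frame_levelD[OF f4]
  have r4': "ireg s4 iZ = 0" "ireg s4 iN = N" "rreg s4 45 = m" "rarr s4 9 = rarr s3 9" "rarr s4 10 = rarr s3 10"
    "rarr s4 11 = rarr s3 11" "rarr s4 12 = rarr s3 12"
    using 4(3) 3 m3 by (auto simp: frame_def writes_defs)
  have le4: "ireg s4 iLo \<le> ireg s4 iHi" using lt r4 by simp
  let ?i1 = "[RMove 56 rRes, RMove 25 rRes, RSet 26 0, RSet 27 0, RSet 28 1]"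
  define t1 where "t1 = run (block ?i1) s4"
  have t1: "rreg t1 25 = x0" "rreg t1 26 = 0" "rreg t1 27 = 0" "rreg t1 28 = 1" "rreg t1 56 = x0"
    by (simp_all add: t1_def x0_def)
  obtain k5 s5 g1 where 5: "exec P (query_at ?i1 33 46) s4 k5 s5"
    "k5 \<le> (?b - ?a) * 2080 + 150"
    "frame (query_writes \<union> eval_writes \<union> RReg ` ({25..28} \<union> {56, 57} \<union> {48, 49, 46})) s4 s5"
    "rreg s5 56 = x0" 
    and q1: "query_post L ?\<alpha> ?\<beta> (x0, 0) (0, 1) (rreg s5 48, rreg s5 49) g1"
    and sx: "rreg s5 46 = (if (if (33::nat) = 33 then fst g1 else snd g1) < 0 then 1 else - 1)"
    and v1: "rreg s5 50 = dev L ?\<alpha> ?\<beta> (rreg s5 48, rreg s5 49)"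
    by (rule exec_query_at[OF le4 _ t1_def, of 33 46, unfolded r4 t1, folded L_def]) auto
  have f5: "frame level_writes s s5"
    by (rule frame_trans[OF f4 frame_mono[OF 5(3)]]) (auto simp: level_writes_def)
  have r5': "ireg s5 iZ = 0" "ireg s5 iN = N" "rreg s5 45 = m" "rarr s5 9 = rarr s3 9" "rarr s5 10 = rarr s3 10"
    "rarr s5 11 = rarr s3 11" "rarr s5 12 = rarr s3 12"
    using 5(3) r4' by (auto simp: frame_def writes_defs)
  define s6 where "s6 = run set_best s5"
  have c6: "simple set_best" "cost set_best \<le> 3" by (simp_all add: set_best_def)
  then obtain k6 where 6: "exec P set_best s5 k6 s6" "k6 \<le> 3" unfolding s6_def by (rule exec_simple_le)
  have f6: "frame level_writes s s6"
    by (rule frame_trans[OF f5]) (auto simp: s6_def set_best_def frame_def level_writes_def)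
  have r6: "ireg s6 iZ = 0" "ireg s6 iN = N" "rreg s6 45 = m" "rreg s6 46 = rreg s5 46" "rreg s6 56 = x0"
    "rarr s6 = rarr s5" "rreg s6 51 = rreg s5 48" "rreg s6 52 = rreg s5 49" "rreg s6 53 = rreg s5 50"
    using r5' 5(4) by (simp_all add: s6_def set_best_def)
  let ?z = "\<lambda>x. height x0 (if 0 < rreg s5 46 then fst x else snd x)"
  obtain k7 s7 where 7: "exec P (select iZ iN height_key (unit_thr 4)) s6 k7 s7"
    "k7 \<le> (N - 0) * 2040 + 60" "frame select_writes s6 s7"
    and sp7: "splits (map (\<lambda>x. (?z x, 1)) (pairing m L)) (N / of_int 4) (rreg s7 rRes)"
  proof (rule exec_select_unit[of height_key 4 iZ iN s6 ?z "pairing m L", unfolded r6(1,2), folded N_def])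
    fix j s' assume fr: "frame fill_writes s6 s'" and i: "ireg s' iL = j" and j: "j < N"
    have "rreg s' 46 = rreg s5 46" "rreg s' 56 = x0" "rarr s' 9 = rarr s3 9" "rarr s' 10 = rarr s3 10"
      "rarr s' 11 = rarr s3 11" "rarr s' 12 = rarr s3 12"
      using fr r6 r5' by (auto simp: frame_def writes_defs)
    then show "rreg (run height_key s') rKey = ?z (pairing m L ! (j - 0)) \<and> rreg (run height_key s') rWgt = 1"
      by (simp add: height_key_def load_pair_def i el9[OF j] el10[OF j] el11[OF j] el12[OF j] height_def)
  qed (use N in \<open>auto simp: height_key_def load_pair_def temp_def\<close>)
  define h where "h = rreg s7 rRes"
  have f7: "frame level_writes s s7"
    by (rule frame_trans[OF f6 frame_mono[OF 7(3)]]) (auto simp: writes_defs)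
  note r7 = frame_levelD[OF f7]
  have r7': "rreg s7 45 = m" "rreg s7 46 = rreg s5 46" "rreg s7 56 = x0"
    "rreg s7 51 = rreg s5 48" "rreg s7 52 = rreg s5 49" "rreg s7 53 = rreg s5 50"
    using 7(3) r6 by (auto simp: frame_def writes_defs)
  have le7: "ireg s7 iLo \<le> ireg s7 iHi" using lt r7 by simp
  let ?i2 = "[RMove 57 rRes, RMove 25 56, RMove 26 rRes, RSet 27 1, RMove 28 45]"
  define t2 where "t2 = run (block ?i2) s7"
  have t2: "rreg t2 25 = x0" "rreg t2 26 = h" "rreg t2 27 = 1" "rreg t2 28 = m" "rreg t2 56 = x0" "rreg t2 57 = h"
    by (simp_all add: t2_def h_def r7')
  obtain k8 s8 g2 where 8: "exec P (query_at ?i2 34 47) s7 k8 s8"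
    "k8 \<le> (?b - ?a) * 2080 + 150"
    "frame (query_writes \<union> eval_writes \<union> RReg ` ({25..28} \<union> {56, 57} \<union> {48, 49, 47})) s7 s8"
    "rreg s8 56 = x0" "rreg s8 57 = h"
    and q2: "query_post L ?\<alpha> ?\<beta> (x0, h) (1, m) (rreg s8 48, rreg s8 49) g2"
    and sy: "rreg s8 47 = (if (if (34::nat) = 33 then fst g2 else snd g2) < 0 then 1 else - 1)"
    and v2: "rreg s8 50 = dev L ?\<alpha> ?\<beta> (rreg s8 48, rreg s8 49)"
    by (rule exec_query_at[OF le7 _ t2_def, of 34 47, unfolded r7 t2, folded L_def]) auto
  have f8: "frame level_writes s s8"
    by (rule frame_trans[OF f7 frame_mono[OF 8(3)]]) (auto simp: level_writes_def)
  have r8: "rreg s8 45 = m" "rreg s8 46 = rreg s5 46"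
    "rreg s8 51 = rreg s5 48" "rreg s8 52 = rreg s5 49" "rreg s8 53 = rreg s5 50"
    using 8(3) r7' by (auto simp: frame_def writes_defs)
  let ?c9 = "Cond (RLess 50 53) set_best Skip"
  define s9 where "s9 = run ?c9 s8"
  have c9: "simple ?c9" "cost ?c9 \<le> 4" by (simp_all add: set_best_def)
  then obtain k9 where 9: "exec P ?c9 s8 k9 s9" "k9 \<le> 4" unfolding s9_def by (rule exec_simple_le)
  have f9: "frame level_writes s s9"
    by (rule frame_trans[OF f8]) (auto simp: s9_def set_best_def frame_def level_writes_def)
  have r9: "rreg s9 45 = m" "rreg s9 46 = rreg s5 46" "rreg s9 47 = rreg s8 47" "rreg s9 56 = x0" "rreg s9 57 = h"
    using r8 8(4,5) by (simp_all add: s9_def set_best_def)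
  have b9: "rreg s9 53 = dev L ?\<alpha> ?\<beta> (rreg s9 51, rreg s9 52)"
    "rreg s9 53 \<le> rreg s5 50" "rreg s9 53 \<le> rreg s8 50"
    using v1 v2 r8 by (auto simp: s9_def set_best_def)
  have sx1: "rreg s5 46 = (if fst g1 < 0 then 1 else - 1)" and sy1: "rreg s8 47 = (if snd g2 < 0 then 1 else - 1)"
    using sx sy by auto
  have "8 * length (filter (\<lambda>l. \<not> prunable (rreg s5 46) (rreg s8 47) m x0 h l) L) \<le> 7 * length L"
    by (rule prunes_one_eighth)
      (use sp1 sp4 sp7 sx1 sy1 in \<open>simp_all add: m_def x0_def h_def N_def\<close>)
  moreover have "dev L ?\<alpha> ?\<beta> (rreg s9 51, rreg s9 52) \<le> dev L ?\<alpha> ?\<beta> z"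
    if "nonneg_wgts L" "bounded_dev L ?\<alpha> ?\<beta>" "rreg s5 46 * (fst z - x0) \<le> 0" for z
    using query_side_vertical[OF q1 L0(1) that(1,2), of z] that(3) b9 v1 unfolding sx1 by linarith
  moreover have "dev L ?\<alpha> ?\<beta> (rreg s9 51, rreg s9 52) \<le> dev L ?\<alpha> ?\<beta> z"
    if "nonneg_wgts L" "bounded_dev L ?\<alpha> ?\<beta>"
      "rreg s8 47 * ((snd z - h) - m * (fst z - x0)) \<le> 0" for z
    using query_side_slanted[OF q2 L0(1) that(1,2), of z] that(3) b9 v2 unfolding sy1 by linarith
  ultimately have "choose_post L ?\<alpha> ?\<beta> (rreg s9)"
    using sx1 sy1 b9(1) unfolding choose_post_def r9 by (simp split: if_splits)
  moreover have "exec P choose_code s (k1 + (1 + (k3 + (k4 + (k5 + (k6 + (k7 + (k8 + k9)))))))) s9"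
    using exec.Seq[OF 1(1) exec.Seq[OF 2 exec.Seq[OF 3(1) exec.Seq[OF 4(1) exec.Seq[OF 5(1)
      exec.Seq[OF 6(1) exec.Seq[OF 7(1) exec.Seq[OF 8(1) 9(1)]]]]]]]]
    by (simp add: choose_code_def)
  \<comment> \<open>Three selections, two queries with evaluation and the pairing:
    \<open>3 * 2040 + 2 * 2080 + 40 = 10320\<close> steps per line.\<close>
  moreover have "k1 + (1 + (k3 + (k4 + (k5 + (k6 + (k7 + (k8 + k9))))))) \<le> (?b - ?a) * 12000 + 700"
    using 1(2) 3(2) 4(2) 5(2) 6(2) 7(2) 8(2) 9(2) N(2) by linarith
  ultimately show ?thesis using that f9 unfolding L_def by blast
qed

end

section \<open>Moving pruned lines into the linear part\<close>

subsection \<open>Pruning\<close>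

definition keep_line :: com where
  "keep_line = block [RStore 6 iE 38, RStore 7 iE 39, RStore 8 iE 40, IInc iE]"

definition prune_body :: com where
  "prune_body = seq [load_line,
     block [RMul 42 38 56, RSub 42 57 42, RSub 42 42 39, RMul 42 47 42, RSub 44 38 45, RMul 41 46 47,
       RMul 44 41 44, RMul 41 47 40],
     Cond (RLess 42 43) keep_line
       (Cond (RLess 43 44) keep_line (block [RMul 42 41 38, RSub 29 29 42, RAdd 30 30 41]))]"

text \<open>Survivors are appended behind the segment instead of being compacted in place, because
  the caller still has to evaluate its own objective after the recursive call.\<close>

definition prune_code :: com where
  "prune_code = seq [block [IMove iE iHi, RSet 43 0], for_range iL iLo iHi prune_body]"

definition prune_writes :: "loc set" where
  "prune_writes = {IReg iE, IReg iL, RReg 29, RReg 30} \<union> RArr ` {6, 7, 8} \<union> temp"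

definition same_lines :: "nat \<Rightarrow> state \<Rightarrow> state \<Rightarrow> bool" where
  "same_lines h s s' \<longleftrightarrow> (\<forall>i<h. rarr s' 6 i = rarr s 6 i \<and> rarr s' 7 i = rarr s 7 i \<and> rarr s' 8 i = rarr s 8 i)"

lemma same_lines_lines: "same_lines h s s' \<Longrightarrow> b \<le> h \<Longrightarrow> lines s' a b = lines s a b"
  by (auto intro: lines_cong simp: same_lines_def)

context sel_program
begin

lemma exec_prune:
  fixes s :: state
  assumes le: "ireg s iLo \<le> ireg s iHi"
  defines "L \<equiv> level_lines s"
    and "p \<equiv> prunable (rreg s 46) (rreg s 47) (rreg s 45) (rreg s 56) (rreg s 57)"
  obtains k s' where "exec P prune_code s k s'" "k \<le> (level_size s) * 30 + 10"
    "frame prune_writes s s'" "same_lines (ireg s iHi) s s'" "ireg s iHi \<le> ireg s' iE"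
    "lines s' (ireg s iHi) (ireg s' iE) = filter (\<lambda>l. \<not> p l) L"
    "rreg s' 29 = rreg s 29 - (\<Sum>l\<leftarrow>filter p L. rreg s 47 * wgt l * slope l)"
    "rreg s' 30 = rreg s 30 + (\<Sum>l\<leftarrow>filter p L. rreg s 47 * wgt l)"
proof -
  let ?h = "ireg s iHi" and ?l = "ireg s iLo"
  let ?c1 = "block [IMove iE iHi, RSet 43 0]"
  define s1 where "s1 = run ?c1 s"
  have c1: "simple ?c1" "cost ?c1 \<le> 2" by simp_all
  then obtain k1 where 1: "exec P ?c1 s k1 s1" "k1 \<le> 2" unfolding s1_def by (rule exec_simple_le)
  have s1: "ireg s1 iLo = ?l" "ireg s1 iHi = ?h" "ireg s1 iE = ?h" "rarr s1 = rarr s" "rreg s1 43 = 0"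
    "rreg s1 29 = rreg s 29" "rreg s1 30 = rreg s 30" "rreg s1 45 = rreg s 45" "rreg s1 46 = rreg s 46"
    "rreg s1 47 = rreg s 47" "rreg s1 56 = rreg s 56" "rreg s1 57 = rreg s 57"
    by (simp_all add: s1_def)
  have f1: "frame prune_writes s s1" by (auto simp: s1_def frame_def prune_writes_def temp_def)
  define I where "I = (\<lambda>j s'. same_lines ?h s s' \<and> ?h \<le> ireg s' iE \<and>
    lines s' ?h (ireg s' iE) = filter (\<lambda>l. \<not> p l) (lines s ?l j) \<and>
    rreg s' 29 = rreg s 29 - (\<Sum>l\<leftarrow>filter p (lines s ?l j). rreg s 47 * wgt l * slope l) \<and>
    rreg s' 30 = rreg s 30 + (\<Sum>l\<leftarrow>filter p (lines s ?l j). rreg s 47 * wgt l))"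
  obtain k2 s2 where 2: "exec P (for_range iL iLo iHi prune_body) s1 k2 s2"
    "k2 \<le> (?h - ?l) * (28 + 2) + 2" "I ?h s2" "frame (insert (IReg iL) (writes callees prune_body)) s1 s2"
  proof (rule exec_for_range[of prune_body iL callees iHi s1 iLo 28 I P, unfolded s1(1,2)])
    show "I ?l (with_index iL ?l s1)"
      by (simp add: I_def s1 same_lines_def lines_def)
  next
    fix j s'
    assume I: "I j s'" and fr: "frame (insert (IReg iL) (writes callees prune_body)) s1 s'"
      and i: "ireg s' iL = j" and j: "?l \<le> j" "j < ?h"
    have r: "rreg s' 43 = 0" "rreg s' 45 = rreg s 45" "rreg s' 46 = rreg s 46"
      "rreg s' 47 = rreg s 47" "rreg s' 56 = rreg s 56" "rreg s' 57 = rreg s 57"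
      using fr s1 by (auto simp: frame_def prune_body_def load_line_def keep_line_def)
    have a: "rarr s' 6 j = rarr s 6 j" "rarr s' 7 j = rarr s 7 j" "rarr s' 8 j = rarr s 8 j"
      using I j by (auto simp: I_def same_lines_def)
    let ?ln = "(rarr s 6 j, rarr s 7 j, rarr s 8 j)"
    let ?r = "run prune_body s'"
    let ?s = "with_index iL (Suc j) (run prune_body s')"
    have up: "lines s ?l (Suc j) = lines s ?l j @ [?ln]" using j by (simp add: lines_upt_Suc)
    have pl: "p ?ln \<longleftrightarrow> \<not> rreg s 47 * (rreg s 57 - rarr s 6 j * rreg s 56 - rarr s 7 j) < 0 \<and>
        \<not> 0 < rreg s 46 * rreg s 47 * (rarr s 6 j - rreg s 45)"
      by (simp add: p_def prunable_def resid_def not_less)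
    show "I (Suc j) ?s"
    proof (cases "p ?ln")
      case True
      then have c: "\<not> rreg s 47 * (rreg s 57 - rarr s 6 j * rreg s 56 - rarr s 7 j) < 0"
        "\<not> 0 < rreg s 46 * rreg s 47 * (rarr s 6 j - rreg s 45)" unfolding pl by auto
      have e: "ireg ?r iE = ireg s' iE" "rarr ?r = rarr s'"
        "rreg ?r 29 = rreg s' 29 - rreg s 47 * rarr s 8 j * rarr s 6 j"
        "rreg ?r 30 = rreg s' 30 + rreg s 47 * rarr s 8 j"
        using c by (simp_all add: prune_body_def load_line_def i r a keep_line_def)
      have "lines ?s ?h (ireg s' iE) = lines s' ?h (ireg s' iE)" by (simp add: lines_def e)
      then show ?thesis
        using True I by (simp add: I_def e up same_lines_def)
    next
      case False
      then have e: "ireg ?r iE = Suc (ireg s' iE)" "rreg ?r 29 = rreg s' 29" "rreg ?r 30 = rreg s' 30"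
        "rarr ?r 6 = (rarr s' 6)(ireg s' iE := rarr s 6 j)" "rarr ?r 7 = (rarr s' 7)(ireg s' iE := rarr s 7 j)"
        "rarr ?r 8 = (rarr s' 8)(ireg s' iE := rarr s 8 j)"
        unfolding pl by (auto simp: prune_body_def load_line_def i r a keep_line_def)
      have "lines ?s ?h (ireg s' iE) = lines s' ?h (ireg s' iE)"
        by (rule lines_cong) (simp add: e)
      then have "lines ?s ?h (Suc (ireg s' iE)) = lines s' ?h (ireg s' iE) @ [?ln]"
        using I by (simp add: I_def lines_upt_Suc e)
      then show ?thesis
        using False I by (simp add: I_def e up same_lines_def)
    qed
  qed (use le in \<open>simp_all add: prune_body_def load_line_def keep_line_def\<close>)
  have f2: "frame prune_writes s s2"
    by (rule frame_trans[OF f1 frame_mono[OF 2(4)]])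
      (auto simp: prune_body_def load_line_def keep_line_def prune_writes_def temp_def)
  have "exec P prune_code s (k1 + k2) s2"
    using exec.Seq[OF 1(1) 2(1)] by (simp add: prune_code_def)
  moreover have "k1 + k2 \<le> (?h - ?l) * 30 + 10" using 1 2 by simp
  ultimately show ?thesis using that 2(3) f2 unfolding I_def L_def by blast
qed

end

section \<open>The prune and search recursion and its running time\<close>

subsection \<open>The recursion\<close>

text \<open>After the call, the returned point is compared with the best query point under the
  unpruned objective. So segment, linear part, that point and its value are saved; the quadrant is
  not.\<close>

definition push_solve :: com where
  "push_solve = block [IStore 2 iD iLo, IStore 3 iD iHi, RStore 13 iD 29, RStore 14 iD 30,
     RStore 15 iD 51, RStore 16 iD 52, RStore 17 iD 53, IInc iD]"

definition pop_solve :: com where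
  "pop_solve = block [IDec iD, ILoad iLo 2 iD, ILoad iHi 3 iD, RLoad 29 13 iD, RLoad 30 14 iD,
     RLoad 51 15 iD, RLoad 52 16 iD, RLoad 53 17 iD, RMove 48 54, RMove 49 55]"

definition solve_code :: com where
  "solve_code = Cond (ILess iLo iHi)
     (seq [choose_code, push_solve, prune_code, block [IMove iLo iHi, IMove iHi iE], Call 2,
        pop_solve, eval_code, Cond (RLess 50 53) Skip (block [RMove 54 51, RMove 55 52])])
     (block [RSet 54 0, RSet 55 0])"

definition solve_stack_below :: "nat \<Rightarrow> state \<Rightarrow> state \<Rightarrow> bool" where
  "solve_stack_below d s s' \<longleftrightarrow> (\<forall>i<d. (\<forall>a\<in>{2, 3}. iarr s' a i = iarr s a i) \<and>
     (\<forall>a\<in>{13, 14, 15, 16, 17}. rarr s' a i = rarr s a i))"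

definition solve_post :: "state \<Rightarrow> nat \<Rightarrow> state \<Rightarrow> bool" where
  "solve_post s k s' \<longleftrightarrow> k \<le> 104000 * (level_size s) + 10 \<and>
     same_lines (ireg s iHi) s s' \<and> solve_stack_below (ireg s iD) s s' \<and> ireg s' iD = ireg s iD \<and>
     ((nonneg_wgts (level_lines s)) \<longrightarrow>
      (bounded_dev (level_lines s) (rreg s 29) (rreg s 30)) \<longrightarrow>
      (\<forall>y. dev (level_lines s) (rreg s 29) (rreg s 30) (rreg s' 54, rreg s' 55)
         \<le> dev (level_lines s) (rreg s 29) (rreg s 30) y))"

locale solve_program = sel_program +
  assumes length_P2: "2 < length P" and P_2: "P ! 2 = solve_code"
begin

lemma exec_solve: "\<exists>k s'. exec P (Call 2) s k s' \<and> solve_post s k s'"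
proof (induction "level_size s" arbitrary: s rule: less_induct)
  case less
  let ?a = "ireg s iLo" and ?b = "ireg s iHi" and ?d = "ireg s iD"
    and ?\<alpha> = "rreg s 29" and ?\<beta> = "rreg s 30"
  define L where "L = lines s ?a ?b"
  show ?case
  proof (cases "?a < ?b")
    case False
    let ?c = "block [RSet 54 0, RSet 55 0]"
    define s1 where "s1 = run ?c s"
    have c: "simple ?c" "cost ?c \<le> 2" by simp_all
    then obtain k1 where 1: "exec P ?c s k1 s1" "k1 \<le> 2" unfolding s1_def by (rule exec_simple_le)
    have "exec P solve_code s (k1 + 1) s1"
      unfolding solve_code_def using False 1 by (intro exec.CondFalse) auto
    then have e: "exec P (Call 2) s (k1 + 1 + 1) s1"
      using exec.Call[of 2 P s "k1 + 1" s1] length_P2 P_2 by simp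
    have L: "L = []" using False by (simp add: L_def lines_def)
    have "dev L ?\<alpha> ?\<beta> (rreg s1 54, rreg s1 55) \<le> dev L ?\<alpha> ?\<beta> y" if B: "bounded_dev L ?\<alpha> ?\<beta>" for y
    proof -
      \<comment> \<open>With no lines left the objective is linear, hence bounded only if it
        vanishes; the default result \<open>(0, 0)\<close> is then optimal.\<close>
      obtain B where "\<And>y. B \<le> dev L ?\<alpha> ?\<beta> y" using B by auto
      from bounded_imp_directional[OF _ this, of 1 0] bounded_imp_directional[OF _ this, of 0 1]
      have "?\<alpha> = 0" "?\<beta> = 0" by (auto simp: L)
      then show ?thesis by (simp add: L dev_def)
    qed
    moreover have "same_lines ?b s s1" "solve_stack_below ?d s s1" "ireg s1 iD = ?d"
      by (simp_all add: s1_def same_lines_def solve_stack_below_def)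
    ultimately have "solve_post s (k1 + 1 + 1) s1"
      using 1(2) unfolding solve_post_def L_def[symmetric] by simp
    with e show ?thesis by blast
  next
    case True
    then have le: "?a \<le> ?b" by simp
    obtain k1 s1 where 1: "exec P choose_code s k1 s1" "k1 \<le> (?b - ?a) * 12000 + 700"
      "frame level_writes s s1" "choose_post L ?\<alpha> ?\<beta> (rreg s1)"
      unfolding L_def by (rule exec_choose[OF True])
    note r1 = frame_levelD[OF 1(3)]
    define s2 where "s2 = run push_solve s1"
    have c2: "simple push_solve" "cost push_solve \<le> 8" by (simp_all add: push_solve_def)
    then obtain k2 where 2: "exec P push_solve s1 k2 s2" "k2 \<le> 8" unfolding s2_def by (rule exec_simple_le)
    have s2: "ireg s2 iLo = ?a" "ireg s2 iHi = ?b" "ireg s2 iD = Suc ?d" "rreg s2 = rreg s1"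
      "iarr s2 2 = (iarr s 2)(?d := ?a)" "iarr s2 3 = (iarr s 3)(?d := ?b)"
      "rarr s2 13 = (rarr s 13)(?d := ?\<alpha>)" "rarr s2 14 = (rarr s 14)(?d := ?\<beta>)"
      "rarr s2 15 = (rarr s 15)(?d := rreg s1 51)" "rarr s2 16 = (rarr s 16)(?d := rreg s1 52)"
      "rarr s2 17 = (rarr s 17)(?d := rreg s1 53)"
      "rarr s2 6 = rarr s 6" "rarr s2 7 = rarr s 7" "rarr s2 8 = rarr s 8"
      by (simp_all add: s2_def push_solve_def r1)
    have L2: "lines s2 ?a ?b = L" by (simp add: L_def lines_def s2)
    define sx sy m x0 h where r: "sx = rreg s1 46" "sy = rreg s1 47" "m = rreg s1 45" "x0 = rreg s1 56"
      "h = rreg s1 57"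
    define p where "p = prunable sx sy m x0 h"
    define \<alpha>' \<beta>' where ab': "\<alpha>' = ?\<alpha> - (\<Sum>l\<leftarrow>filter p L. sy * wgt l * slope l)"
      "\<beta>' = ?\<beta> + (\<Sum>l\<leftarrow>filter p L. sy * wgt l)"
    have le2: "ireg s2 iLo \<le> ireg s2 iHi" using le s2 by simp
    obtain k3 s3 where 3: "exec P prune_code s2 k3 s3" "k3 \<le> (?b - ?a) * 30 + 10"
      "frame prune_writes s2 s3" "same_lines ?b s2 s3" "?b \<le> ireg s3 iE"
      "lines s3 ?b (ireg s3 iE) = filter (\<lambda>l. \<not> p l) L" "rreg s3 29 = \<alpha>'" "rreg s3 30 = \<beta>'"
      by (rule exec_prune[OF le2, unfolded s2(1,2,4) L2 r1(4,5), folded r, folded p_def, folded ab'])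
    let ?c4 = "block [IMove iLo iHi, IMove iHi iE]"
    define s4 where "s4 = run ?c4 s3"
    have c4: "simple ?c4" "cost ?c4 \<le> 2" by simp_all
    then obtain k4 where 4: "exec P ?c4 s3 k4 s4" "k4 \<le> 2" unfolding s4_def by (rule exec_simple_le)
    have r3: "ireg s3 iHi = ?b" "ireg s3 iD = Suc ?d" "iarr s3 = iarr s2"
      "rarr s3 13 = rarr s2 13" "rarr s3 14 = rarr s2 14" "rarr s3 15 = rarr s2 15" "rarr s3 16 = rarr s2 16"
      "rarr s3 17 = rarr s2 17"
      using 3(3) s2 by (auto simp: frame_def prune_writes_def temp_def)
    have s4: "ireg s4 iLo = ?b" "ireg s4 iHi = ireg s3 iE" "ireg s4 iD = Suc ?d" "rreg s4 29 = \<alpha>'" "rreg s4 30 = \<beta>'"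
      "iarr s4 = iarr s3" "rarr s4 = rarr s3"
      using 3 r3 by (simp_all add: s4_def)
    define L' where "L' = filter (\<lambda>l. \<not> p l) L"
    have L4: "lines s4 ?b (ireg s3 iE) = L'" using 3(6) by (simp add: lines_def s4 L'_def)
    have n: "ireg s3 iE - ?b = length L'" using arg_cong[OF 3(6), of length] by (simp add: L'_def)
    have n': "8 * length L' \<le> 7 * (?b - ?a)"
      using 1(4) by (simp add: choose_post_def L'_def p_def r L_def)
    then have "level_size s4 < ?b - ?a" using True n s4 by simp
    from less.hyps[OF this] obtain k5 s5 where 5: "exec P (Call 2) s4 k5 s5" "solve_post s4 k5 s5" by blast
    have s5: "k5 \<le> 104000 * length L' + 10" "same_lines (ireg s3 iE) s4 s5"
      "solve_stack_below (Suc ?d) s4 s5" "ireg s5 iD = Suc ?d"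
      "(nonneg_wgts L') \<longrightarrow> (bounded_dev L' \<alpha>' \<beta>') \<longrightarrow>
        (\<forall>y. dev L' \<alpha>' \<beta>' (rreg s5 54, rreg s5 55) \<le> dev L' \<alpha>' \<beta>' y)"
      using 5(2) unfolding solve_post_def s4 L4 n by blast+
    define s6 where "s6 = run pop_solve s5"
    have c6: "simple pop_solve" "cost pop_solve \<le> 10" by (simp_all add: pop_solve_def)
    then obtain k6 where 6: "exec P pop_solve s5 k6 s6" "k6 \<le> 10" unfolding s6_def by (rule exec_simple_le)
    have s6: "ireg s6 iLo = ?a" "ireg s6 iHi = ?b" "ireg s6 iD = ?d" "rreg s6 29 = ?\<alpha>" "rreg s6 30 = ?\<beta>"
      "rreg s6 51 = rreg s1 51" "rreg s6 52 = rreg s1 52" "rreg s6 53 = rreg s1 53"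
      "rreg s6 48 = rreg s5 54" "rreg s6 49 = rreg s5 55" "rreg s6 54 = rreg s5 54" "rreg s6 55 = rreg s5 55"
      "rarr s6 = rarr s5" "iarr s6 = iarr s5"
      using s5(3,4) s4 r3 s2 by (simp_all add: s6_def pop_solve_def solve_stack_below_def)
    have sl: "same_lines ?b s s6"
      using 3(4,5) s5(2) s2 s4 s6 by (auto simp: same_lines_def)
    have L6: "lines s6 ?a ?b = L" unfolding L_def by (rule same_lines_lines[OF sl]) simp
    have le6: "ireg s6 iLo \<le> ireg s6 iHi" using le s6 by simp
    obtain k7 s7 where 7: "exec P eval_code s6 k7 s7" "k7 \<le> (?b - ?a) * 20 + 10" "frame eval_writes s6 s7"
      "rreg s7 50 = dev L ?\<alpha> ?\<beta> (rreg s5 54, rreg s5 55)"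
      by (rule exec_eval[OF le6, unfolded s6 L6])
    have r7: "ireg s7 iD = ?d" "rarr s7 = rarr s5" "iarr s7 = iarr s5"
      "rreg s7 51 = rreg s1 51" "rreg s7 52 = rreg s1 52" "rreg s7 53 = rreg s1 53"
      "rreg s7 54 = rreg s5 54" "rreg s7 55 = rreg s5 55"
      using 7(3) s6 by (auto simp: frame_def eval_writes_def temp_def)
    let ?c8 = "Cond (RLess 50 53) Skip (block [RMove 54 51, RMove 55 52])"
    define s8 where "s8 = run ?c8 s7"
    have c8: "simple ?c8" "cost ?c8 \<le> 3" by simp_all
    then obtain k8 where 8: "exec P ?c8 s7 k8 s8" "k8 \<le> 3" unfolding s8_def by (rule exec_simple_le)
    have r8: "ireg s8 iD = ?d" "rarr s8 = rarr s5" "iarr s8 = iarr s5"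
      using r7 by (simp_all add: s8_def)
    define b where "b = (rreg s1 51, rreg s1 52)"
    have b: "rreg s1 53 = dev L ?\<alpha> ?\<beta> b" using 1(4) by (simp add: choose_post_def b_def)
    have a8: "(rreg s8 54, rreg s8 55) = (if dev L ?\<alpha> ?\<beta> (rreg s5 54, rreg s5 55) < dev L ?\<alpha> ?\<beta> b
        then (rreg s5 54, rreg s5 55) else b)"
      using 7(4) r7 b by (simp add: s8_def b_def)
    have "exec P solve_code s (k1 + (k2 + (k3 + (k4 + (k5 + (k6 + (k7 + k8)))))) + 1) s8"
      unfolding solve_code_def
      using True exec.Seq[OF 1(1) exec.Seq[OF 2(1) exec.Seq[OF 3(1) exec.Seq[OF 4(1) exec.Seq[OF 5(1)
        exec.Seq[OF 6(1) exec.Seq[OF 7(1) 8(1)]]]]]]]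
      by (intro exec.CondTrue) auto
    then have e: "exec P (Call 2) s (k1 + (k2 + (k3 + (k4 + (k5 + (k6 + (k7 + k8)))))) + 1 + 1) s8"
      using exec.Call[of 2 P s _ s8] length_P2 P_2 by simp
    \<comment> \<open>Apart from the recursive call, a level of \<open>n >= 1\<close> lines costs
      less than \<open>13000 * n\<close> steps, and
      \<open>13000 * n + 104000 * (7 * n / 8) = 104000 * n\<close>.\<close>
    have "k1 + (k2 + (k3 + (k4 + (k5 + (k6 + (k7 + k8)))))) + 1 + 1 \<le> 104000 * (?b - ?a) + 10"
      using 1(2) 2(2) 3(2) 4(2) s5(1) 6(2) 7(2) 8(2) n' True by linarith
    moreover have "same_lines ?b s s8" using sl s6 r8 by (simp add: same_lines_def)
    moreover have "solve_stack_below ?d s s8"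
      using s5(3) r8 s4 r3 s2 by (simp add: solve_stack_below_def)
    moreover have "dev L ?\<alpha> ?\<beta> (rreg s8 54, rreg s8 55) \<le> dev L ?\<alpha> ?\<beta> y"
      if w: "nonneg_wgts L" and B: "bounded_dev L ?\<alpha> ?\<beta>" for y
    proof -
      have s: "sx = 1 \<or> sx = - 1" "sy = 1 \<or> sy = - 1"
        and q1: "\<And>z. sx * (fst z - x0) \<le> 0 \<Longrightarrow> dev L ?\<alpha> ?\<beta> b \<le> dev L ?\<alpha> ?\<beta> z"
        and q2: "\<And>z. sy * ((snd z - h) - m * (fst z - x0)) \<le> 0 \<Longrightarrow> dev L ?\<alpha> ?\<beta> b \<le> dev L ?\<alpha> ?\<beta> z"
        using 1(4) w B unfolding choose_post_def r b_def by blast+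
      interpret prune_step L L' ?\<alpha> ?\<beta> \<alpha>' \<beta>' "- (\<Sum>l\<leftarrow>filter p L. sy * wgt l * icpt l)"
        "\<lambda>z. sx * (fst z - x0)" "\<lambda>z. sy * ((snd z - h) - m * (fst z - x0))" b
        unfolding L'_def ab' by (rule prune_step_lines[OF w s p_def q1 q2])
      obtain B where B: "\<And>y. B \<le> dev L ?\<alpha> ?\<beta> y" using B by blast
      have "nonneg_wgts L'" using w by (simp add: L'_def)
      then show ?thesis using s5(5) by (intro best_optimal[OF B _ a8]) blast
    qed
    ultimately have "solve_post s (k1 + (k2 + (k3 + (k4 + (k5 + (k6 + (k7 + k8)))))) + 1 + 1) s8"
      using r8(1) unfolding solve_post_def L_def[symmetric] by blast
    with e show ?thesis by blast
  qed
qed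

end

section \<open>Reduction of the tariff problem to an unconstrained one\<close>

subsection \<open>Exact penalties for the sign constraints\<close>

text \<open>Substituting \<open>p = (x + y) / 2\<close> and \<open>f = (y - x) / 2\<close> in
  \<open>p * l + f = r\<close> gives \<open>(l + 1) * y = (1 - l) * x + 2 * r\<close>. The factor
  \<open>l + 1\<close> moves into the weight, which doubles the deviation.\<close>

definition od_line :: "('d \<Rightarrow> real) \<Rightarrow> ('d \<Rightarrow> nat) \<Rightarrow> ('d \<Rightarrow> real) \<Rightarrow> 'd \<Rightarrow> line" where
  "od_line r t l d = ((1 - l d) / (l d + 1), (r d + r d) / (l d + 1), real (t d) * (l d + 1))"

text \<open>The sum is a Lipschitz constant of the deviation; the additional 1 makes every violation
  of a sign strictly unprofitable, even for empty \<open>D\<close>.\<close>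

definition penalty :: "('d \<Rightarrow> nat) \<Rightarrow> ('d \<Rightarrow> real) \<Rightarrow> 'd list \<Rightarrow> real" where
  "penalty t l ds = (\<Sum>d\<leftarrow>ds. real (t d) * (l d + 1)) + 1"

text \<open>The two extra lines are \<open>f = 0\<close> and \<open>p = 0\<close>; the latter would
  be vertical in the plane of \<open>p\<close> and \<open>f\<close>. Their absolute values and the
  term \<open>- 2 * penalty t l ds * y\<close> add up to multiples of
  \<open>\<bar>p\<bar> - p\<close> and \<open>\<bar>f\<bar> - f\<close>, which vanish exactly for
  nonnegative arguments.\<close>

definition tariff_lines :: "('d \<Rightarrow> real) \<Rightarrow> ('d \<Rightarrow> nat) \<Rightarrow> ('d \<Rightarrow> real) \<Rightarrow> 'd list \<Rightarrow> line list" where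
  "tariff_lines r t l ds =
     map (od_line r t l) ds @ [(1, 0, penalty t l ds), (- 1, 0, penalty t l ds)]"

abbreviation (input) penalised ::
    "('d \<Rightarrow> real) \<Rightarrow> ('d \<Rightarrow> nat) \<Rightarrow> ('d \<Rightarrow> real) \<Rightarrow> 'd list \<Rightarrow> real \<times> real \<Rightarrow> real" where
  "penalised r t l ds \<equiv> dev (tariff_lines r t l ds) 0 (- 2 * penalty t l ds)"

text \<open>In the coordinates \<open>(p - f, p + f)\<close> no line is vertical, since distances are nonnegative.\<close>

lemma dev_tariff_lines:
  assumes I: "tariff_instance D r t l" and ds: "distinct ds" "set ds = D"
  shows "penalised r t l ds (p - f, p + f) =
    2 * tariff_deviation D r t l (p, f) +
    2 * penalty t l ds * ((\<bar>p\<bar> - p) + (\<bar>f\<bar> - f))"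
proof -
  have "wgt (od_line r t l d) * \<bar>resid (p - f, p + f) (od_line r t l d)\<bar> =
      2 * (real (t d) * \<bar>r d - (p * l d + f)\<bar>)" if "d \<in> set ds" for d
  proof -
    have pos: "0 < l d + 1" using I that ds by (force simp: tariff_instance_def)
    have "(l d + 1) * resid (p - f, p + f) (od_line r t l d) = - (2 * (r d - (p * l d + f)))"
    proof -
      have "(l d + 1) * ((1 - l d) / (l d + 1)) = 1 - l d" "(l d + 1) * ((r d + r d) / (l d + 1)) = r d + r d"
        using pos by simp_all
      then have "(l d + 1) * resid (p - f, p + f) (od_line r t l d) =
          (l d + 1) * (p + f) - (1 - l d) * (p - f) - (r d + r d)"
        by (simp only: od_line_def resid_def fst_conv snd_conv right_diff_distrib mult.assoc[symmetric])
      then show ?thesis by (simp add: algebra_simps)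
    qed
    then have "(l d + 1) * \<bar>resid (p - f, p + f) (od_line r t l d)\<bar> = 2 * \<bar>r d - (p * l d + f)\<bar>"
      using pos by (metis abs_minus_cancel abs_mult abs_numeral abs_of_pos)
    then show ?thesis by (simp add: od_line_def)
  qed
  then have "(\<Sum>d\<leftarrow>ds. wgt (od_line r t l d) * \<bar>resid (p - f, p + f) (od_line r t l d)\<bar>) =
      (\<Sum>d\<leftarrow>ds. 2 * (real (t d) * \<bar>r d - (p * l d + f)\<bar>))"
    by (intro arg_cong[of _ _ sum_list] map_cong) auto
  also have "\<dots> = 2 * tariff_deviation D r t l (p, f)"
    using ds by (simp add: tariff_deviation_def sum_list_const_mult sum_list_distinct_conv_sum_set)
  finally show ?thesis
    by (simp add: tariff_lines_def dev_def o_def resid_def abs_mult algebra_simps)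
qed

lemma tariff_deviation_lipschitz:
  assumes I: "tariff_instance D r t l" and ds: "distinct ds" "set ds = D" and "0 \<le> a" "0 \<le> b"
  shows "tariff_deviation D r t l (p + a, f + b) \<le>
    tariff_deviation D r t l (p, f) + (penalty t l ds - 1) * (a + b)"
proof -
  have "real (t d) * \<bar>r d - ((p + a) * l d + (f + b))\<bar> \<le>
      real (t d) * \<bar>r d - (p * l d + f)\<bar> + real (t d) * (l d + 1) * (a + b)" if "d \<in> D" for d
  proof -
    have l: "0 \<le> l d" using I that by (auto simp: tariff_instance_def)
    have "\<bar>r d - ((p + a) * l d + (f + b))\<bar> \<le> \<bar>r d - (p * l d + f)\<bar> + (a * l d + b)"
      using mult_nonneg_nonneg[OF assms(4) l] assms(5) by (simp add: algebra_simps)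
    also have "a * l d + b \<le> (l d + 1) * (a + b)"
      using mult_nonneg_nonneg[OF assms(5) l] assms(4) by (simp add: algebra_simps)
    finally have "\<bar>r d - ((p + a) * l d + (f + b))\<bar> \<le> \<bar>r d - (p * l d + f)\<bar> + (l d + 1) * (a + b)"
      by simp
    from mult_left_mono[OF this, of "real (t d)"] show ?thesis by (simp add: algebra_simps)
  qed
  then have "tariff_deviation D r t l (p + a, f + b) \<le>
      (\<Sum>d\<in>D. real (t d) * \<bar>r d - (p * l d + f)\<bar> + real (t d) * (l d + 1) * (a + b))"
    unfolding tariff_deviation_def prod.case by (rule sum_mono)
  also have "\<dots> = tariff_deviation D r t l (p, f) + (\<Sum>d\<in>D. real (t d) * (l d + 1)) * (a + b)"
    by (simp add: tariff_deviation_def sum.distrib sum_distrib_right)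
  also have "(\<Sum>d\<in>D. real (t d) * (l d + 1)) = penalty t l ds - 1"
    using ds by (simp add: penalty_def sum_list_distinct_conv_sum_set)
  finally show ?thesis .
qed

lemma tariff_deviation_nonneg:
  "tariff_instance D r t l \<Longrightarrow> 0 \<le> tariff_deviation D r t l z"
  by (cases z) (auto simp: tariff_deviation_def intro!: sum_nonneg)

lemma penalty_ge_1:
  assumes "tariff_instance D r t l" "set ds = D"
  shows "1 \<le> penalty t l ds"
proof -
  have "0 \<le> (\<Sum>d\<leftarrow>ds. real (t d) * (l d + 1))"
    by (rule sum_list_nonneg) (use assms in \<open>auto simp: tariff_instance_def\<close>)
  then show ?thesis by (simp add: penalty_def)
qed

text \<open>In halved units, clipping negative coordinates to 0 raises the deviation by at most
  \<open>(?M - 1) * (a + b)\<close> and saves \<open>2 * ?M * (a + b)\<close> of penalty. A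
  minimiser therefore has \<open>a = b = 0\<close>, and for nonnegative points the penalty is
  0.\<close>

lemma penalty_optimal:
  fixes D :: "'d set"
  assumes I: "tariff_instance D r t l" and ds: "distinct ds" "set ds = D"
    and opt: "\<And>z. penalised r t l ds (p - f, p + f)
      \<le> penalised r t l ds z"
  shows "optimal_affine_tariff D r t l (p, f)"
proof -
  let ?F = "tariff_deviation D r t l" and ?M = "penalty t l ds"
  note M = penalty_ge_1[OF I ds(2)]
  have opt': "2 * ?F (p, f) + 2 * ?M * ((\<bar>p\<bar> - p) + (\<bar>f\<bar> - f)) \<le>
      2 * ?F (p', f') + 2 * ?M * ((\<bar>p'\<bar> - p') + (\<bar>f'\<bar> - f'))" for p' f'
    using opt[of "(p' - f', p' + f')"] unfolding dev_tariff_lines[OF I ds] .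
  define a b where ab: "a = max p 0 - p" "b = max f 0 - f"
  have "0 \<le> a" "0 \<le> b" and a2: "\<bar>p\<bar> - p = 2 * a" "\<bar>f\<bar> - f = 2 * b"
    and pa: "\<bar>p + a\<bar> - (p + a) = 0" "\<bar>f + b\<bar> - (f + b) = 0" by (auto simp: ab)
  have "2 * ?F (p, f) + 2 * ?M * (2 * a + 2 * b) \<le> 2 * ?F (p + a, f + b)"
    using opt'[of "p + a" "f + b"] unfolding a2 pa by simp
  also have "\<dots> \<le> 2 * (?F (p, f) + (?M - 1) * (a + b))"
    using tariff_deviation_lipschitz[OF I ds \<open>0 \<le> a\<close> \<open>0 \<le> b\<close>] by (rule mult_left_mono) simp
  finally have "(?M + 1) * (a + b) \<le> 0" by (simp add: algebra_simps)
  then have "a + b \<le> 0" using M by (simp add: mult_le_0_iff)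
  then have "a = 0" "b = 0" using \<open>0 \<le> a\<close> \<open>0 \<le> b\<close> by simp_all
  then have pf: "0 \<le> p" "0 \<le> f" by (auto simp: ab)
  moreover have "?F (p, f) \<le> ?F (p', f')" if "0 \<le> p'" "0 \<le> f'" for p' f'
    using opt'[of p' f'] that pf by simp
  ultimately show ?thesis
    by (auto simp: optimal_affine_tariff_def is_arg_min_def not_less)
qed

section \<open>The complete program and its linear time bound\<close>

subsection \<open>The complete program\<close>

definition main_init :: com where
  "main_init = block [ISet iLo 0, IMove iHi 0, ISet iE 0, ISet iD 0, RSet 29 0, RSet 43 1]"

definition main_body :: com where
  "main_body = block [RLoad 38 0 iL, RLoad 39 1 iL, RLoad 40 2 iL, RAdd 41 40 43, RSub 42 43 40,
     RDiv 42 42 41, RStore 6 iL 42, RAdd 38 38 38, RDiv 38 38 41, RStore 7 iL 38, RMul 39 39 41,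
     RStore 8 iL 39, RAdd 29 29 39]"

text \<open>The penalty is known only after the pass over the input, so the two constraint lines
  come last; register 29, which accumulated it, is then reset to
  \<open>\<alpha> = 0\<close>.\<close>

definition main_penalty :: com where
  "main_penalty = block [RAdd 29 29 43, RSet 38 0, RSub 39 38 43,
     RStore 6 iHi 43, RStore 7 iHi 38, RStore 8 iHi 29, IInc iHi,
     RStore 6 iHi 39, RStore 7 iHi 38, RStore 8 iHi 29, IInc iHi,
     RAdd 30 29 29, RSub 30 38 30, RMove 29 38]"

definition main_output :: com where
  "main_output = block [RSet 38 2, RAdd 0 54 55, RDiv 0 0 38, RSub 1 55 54, RDiv 1 1 38]"

definition main_code :: com where
  "main_code = seq [main_init, for_range iL iLo iHi main_body, main_penalty, Call 2, main_output]"

definition tariff_program :: program where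
  "tariff_program = [main_code, sel_code, solve_code]"

interpretation tariff: solve_program tariff_program
  by unfold_locales (simp_all add: tariff_program_def)

lemma exec_main_loop:
  fixes s :: state
  assumes a: "\<And>i. i < length ds \<Longrightarrow> rarr s 0 i = r (ds ! i) \<and> rarr s 1 i = real (t (ds ! i)) \<and> rarr s 2 i = l (ds ! i)"
    and s: "ireg s iLo = 0" "ireg s iHi = length ds" "rreg s 29 = 0" "rreg s 43 = 1"
  obtains k s' where "exec P (for_range iL iLo iHi main_body) s k s'" "k \<le> length ds * 20 + 2"
    "lines s' 0 (length ds) = map (od_line r t l) ds" "rreg s' 29 + 1 = penalty t l ds"
    "ireg s' iLo = 0" "ireg s' iHi = length ds" "rreg s' 43 = 1"
proof -
  let ?n = "length ds"
  define T :: "nat \<Rightarrow> loc set" where "T = (\<lambda>_. {})"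
  define I where "I = (\<lambda>j (s' :: state). lines s' 0 j = map (od_line r t l) (take j ds) \<and>
    rreg s' 29 = (\<Sum>d\<leftarrow>take j ds. real (t d) * (l d + 1)))"
  obtain k s' where *: "exec P (for_range iL iLo iHi main_body) s k s'"
    "k \<le> (?n - 0) * (18 + 2) + 2" "I ?n s'" "frame (insert (IReg iL) (writes T main_body)) s s'"
  proof (rule exec_for_range[of main_body iL T iHi s iLo 18 I P, unfolded s(1,2)])
    show "I 0 (with_index iL 0 s)" by (simp add: I_def lines_def s)
  next
    fix j s'
    assume I: "I j s'" and fr: "frame (insert (IReg iL) (writes T main_body)) s s'"
      and i: "ireg s' iL = j" and j: "j < ?n"
    have q: "rreg s' 43 = 1" "rarr s' 0 j = r (ds ! j)" "rarr s' (Suc 0) j = real (t (ds ! j))"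
      "rarr s' 2 j = l (ds ! j)"
      using fr a[OF j] s by (auto simp: frame_def main_body_def)
    let ?r = "run main_body s'"
    have e: "rarr ?r 6 = (rarr s' 6)(j := slope (od_line r t l (ds ! j)))"
      "rarr ?r 7 = (rarr s' 7)(j := icpt (od_line r t l (ds ! j)))"
      "rarr ?r 8 = (rarr s' 8)(j := wgt (od_line r t l (ds ! j)))"
      "rreg ?r 29 = rreg s' 29 + real (t (ds ! j)) * (l (ds ! j) + 1)"
      by (simp_all add: main_body_def i q od_line_def)
    have "lines (with_index iL (Suc j) ?r) 0 j = lines s' 0 j"
      by (rule lines_cong) (simp add: e)
    then show "I (Suc j) (with_index iL (Suc j) ?r)"
      using I j by (simp add: I_def lines_upt_Suc e take_Suc_conv_app_nth)
  qed (use s in \<open>simp_all add: main_body_def\<close>)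
  have "ireg s' iLo = 0" "ireg s' iHi = length ds" "rreg s' 43 = 1"
    using *(4) s by (auto simp: frame_def main_body_def)
  with that * show ?thesis by (auto simp: I_def penalty_def)
qed

lemma tariff_program_correct:
  fixes D :: "'d set"
  assumes I: "tariff_instance D r t l" and ds: "distinct ds" "set ds = D"
  obtains k s where "exec tariff_program (Call 0) (input_state r t l ds) k s"
    "k \<le> 104020 * length ds + 208100" "optimal_affine_tariff D r t l (output_tariff s)"
proof -
  let ?s = "input_state r t l ds" and ?n = "length ds" and ?P = tariff_program
  define s1 where "s1 = run main_init ?s"
  have c1: "simple main_init" "cost main_init \<le> 6" by (simp_all add: main_init_def)
  then obtain k1 where 1: "exec ?P main_init ?s k1 s1" "k1 \<le> 6" unfolding s1_def by (rule exec_simple_le)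
  have s1: "ireg s1 iLo = 0" "ireg s1 iHi = ?n" "rreg s1 29 = 0" "rreg s1 43 = 1" "rarr s1 = rarr ?s"
    by (simp_all add: s1_def main_init_def input_state_def)
  obtain k2 s2 where 2: "exec ?P (for_range iL iLo iHi main_body) s1 k2 s2" "k2 \<le> ?n * 20 + 2"
    and s2: "lines s2 0 ?n = map (od_line r t l) ds" "rreg s2 29 + 1 = penalty t l ds"
    "ireg s2 iLo = 0" "ireg s2 iHi = ?n" "rreg s2 43 = 1"
    by (rule exec_main_loop[OF _ s1(1-4), of r t l ?P]) (auto simp: s1 input_state_def)
  define s3 where "s3 = run main_penalty s2"
  have c3: "simple main_penalty" "cost main_penalty \<le> 14" by (simp_all add: main_penalty_def)
  then obtain k3 where 3: "exec ?P main_penalty s2 k3 s3" "k3 \<le> 14" unfolding s3_def by (rule exec_simple_le)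
  let ?M = "penalty t l ds"
  have s3: "ireg s3 iLo = 0" "ireg s3 iHi = Suc (Suc ?n)" "rreg s3 29 = 0" "rreg s3 30 = - 2 * ?M"
    "rarr s3 6 = (rarr s2 6)(?n := 1, Suc ?n := - 1)" "rarr s3 7 = (rarr s2 7)(?n := 0, Suc ?n := 0)"
    "rarr s3 8 = (rarr s2 8)(?n := ?M, Suc ?n := ?M)"
    using s2 by (simp_all add: s3_def main_penalty_def)
  have "lines s3 0 ?n = lines s2 0 ?n" by (rule lines_cong) (simp add: s3)
  then have L: "lines s3 0 (Suc (Suc ?n)) = tariff_lines r t l ds"
    by (simp add: lines_upt_Suc s3 s2 tariff_lines_def)
  obtain k4 s4 where 4: "exec ?P (Call 2) s3 k4 s4" "solve_post s3 k4 s4" using tariff.exec_solve by blast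
  define s5 where "s5 = run main_output s4"
  have c5: "simple main_output" "cost main_output \<le> 5" by (simp_all add: main_output_def)
  then obtain k5 where 5: "exec ?P main_output s4 k5 s5" "k5 \<le> 5" unfolding s5_def by (rule exec_simple_le)
  define p f where pf: "p = (rreg s4 54 + rreg s4 55) / 2" "f = (rreg s4 55 - rreg s4 54) / 2"
  have out: "output_tariff s5 = (p, f)"
    by (simp add: output_tariff_def s5_def main_output_def pf)
  have z: "(p - f, p + f) = (rreg s4 54, rreg s4 55)" by (simp add: pf field_simps)
  have w: "\<forall>l\<in>set (tariff_lines r t l ds). 0 \<le> wgt l"
    using I ds penalty_ge_1[OF I ds(2)] by (auto simp: tariff_lines_def od_line_def tariff_instance_def)
  \<comment> \<open>Nonnegativity provides the boundedness with which the recursion starts.\<close>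
  have "0 \<le> penalised r t l ds y" for y
  proof -
    define p' f' where "p' = (fst y + snd y) / 2" "f' = (snd y - fst y) / 2"
    then have y: "y = (p' - f', p' + f')" by (cases y) (simp add: field_simps)
    show ?thesis unfolding y dev_tariff_lines[OF I ds]
      using tariff_deviation_nonneg[OF I] penalty_ge_1[OF I ds(2)] by simp
  qed
  then have "penalised r t l ds (p - f, p + f) \<le> penalised r t l ds y" for y
    using 4(2) w unfolding solve_post_def s3 L z by blast
  then have "optimal_affine_tariff D r t l (output_tariff s5)"
    unfolding out by (rule penalty_optimal[OF I ds])
  moreover have "exec ?P main_code ?s (k1 + (k2 + (k3 + (k4 + k5)))) s5"
    using exec.Seq[OF 1(1) exec.Seq[OF 2(1) exec.Seq[OF 3(1) exec.Seq[OF 4(1) 5(1)]]]]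
    by (simp add: main_code_def)
  then have "exec ?P (Call 0) ?s (k1 + (k2 + (k3 + (k4 + k5))) + 1) s5"
    using exec.Call[of 0 ?P ?s _ s5] by (simp add: tariff_program_def)
  \<comment> \<open>The two constraint lines account for the summand 2.\<close>
  moreover have "k4 \<le> 104000 * (?n + 2) + 10" using 4(2) by (simp add: solve_post_def s3)
  then have "k1 + (k2 + (k3 + (k4 + k5))) + 1 \<le> 104020 * ?n + 208100"
    using 1 2 3 5 by simp
  ultimately show ?thesis using that by blast
qed

theorem theorem10:
  "\<exists>(P :: program) (T :: nat \<Rightarrow> nat).
     (\<lambda>n. real (T n)) \<in> O(\<lambda>n. real n) \<and>
     (\<forall>(D :: 'd set) r t l ds.
        tariff_instance D r t l \<longrightarrow> distinct ds \<longrightarrow> set ds = D \<longrightarrow>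
        (\<exists>k s. exec P (Call 0) (input_state r t l ds) k s \<and> k \<le> T (card D) \<and>
               optimal_affine_tariff D r t l (output_tariff s)))"
proof (rule exI[of _ tariff_program], rule exI[of _ "\<lambda>n. 104020 * n + 208100"], intro conjI allI impI)
  show "(\<lambda>n. real (104020 * n + 208100)) \<in> O(\<lambda>n. real n)"
  proof (rule bigoI)
    \<comment> \<open>\<open>312120 = 104020 + 208100\<close>, which suffices as soon as
      \<open>n >= 1\<close>.\<close>
    show "\<forall>\<^sub>F n in sequentially. norm (real (104020 * n + 208100)) \<le> 312120 * norm (real n)"
      using eventually_gt_at_top[of 0] by eventually_elim simp
  qed
next
  fix D :: "'d set" and r t l ds
  assume I: "tariff_instance D r t l" and ds: "distinct ds" "set ds = D"
  then have "card D = length ds" using distinct_card by blast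
  then show "\<exists>k s. exec tariff_program (Call 0) (input_state r t l ds) k s \<and>
      k \<le> 104020 * card D + 208100 \<and> optimal_affine_tariff D r t l (output_tariff s)"
    using tariff_program_correct[OF I ds] by metis
qed

end
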